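(* Let $\mathcal{X}_n$ be a sequence of $\Lambda_n$-valued Pfaffian point fields with finite-rank kernels $K_n$ (with respect to background measures $\mu_n$ on $\Lambda_n$). Let $\mathcal{N}_n$ denote the number of points of $\mathcal{X}_n$. Suppose that all eigenvalues of the kernels $K_n$ are real and in the interval $[0,1]$, and that $\mathrm{Var}(\mathcal{N}_n)\to\infty$ as $n\to\infty$. Then the sequence of random variables $$\frac{\mathcal{N}_n-\mathbb{E}(\mathcal{N}_n)}{\sqrt{\mathrm{Var}(\mathcal{N}_n)}}$$ converges in distribution to a standard Gaussian random variable.
   Context: Quaternions. "Quaternions" are complexified quaternions $q=s+x\mathbf{i}+y\mathbf{j}+z\mathbf{k}\in\mathbb{Q}_{\mathbb{C}}$ with $s,x,y,z\in\mathbb{C}$ (usual quaternion multiplication rules, complex scalars central). The conjugate is $q^{*}=s-x\mathbf{i}-y\mathbf{j}-z\mathbf{k}$ (the coefficients are not complex-conjugated). The dual $X^*$ of a quaternion matrix is given by $(X^* )_{lk}=(X_{kl})^*$; $X$ is self-dual if $X^*=X$. A quaternion kernel $K:\Lambda\times\Lambda\to\mathbb{Q}_{\mathbb{C}}$ is self-dual if $K(y,x)=K(x,y)^*$. Moore-Dyson determinant. For an $n\times n$ quaternion matrix $X$, write each permutation $\sigma\in S_n$ as a product of cycles $\sigma=(n_1i_2\ldots i_s)(n_2j_2\ldots j_t)\ldots(n_rk_2\ldots k_l)$ where $n_i$ is the largest element of its cycle and $n_1>n_2>\ldots>n_r$. Then $\mathrm{Det}_M(X)=\sum_{\sigma}(-1)^{n-r}\left(X_{n_1i_2}X_{i_2i_3}\ldots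 X_{i_sn_1}\right)\ldots\left(X_{n_rk_2}X_{k_2k_3}\ldots X_{k_ln_r}\right)$. It is scalar for self-dual $X$. Random point fields. A random point field on a space $\Lambda$ with measure $\mu$ is a probability measure on the space of countable configurations of points of $\Lambda$ (with finitely many points in every compact subset). $\#(A)$ is the number of points in $A$. A locally integrable $R_k:\Lambda^k\to\mathbb{R}_+$ is the $k$-point correlation function with respect to $\mu$ if for all disjoint measurable $A_1,\ldots,A_m\subset\Lambda$ and non-negative integers $k_i$ with $\sum k_i=k$: $\mathbb{E}\prod_{i=1}^m[\#(A_i)\cdots(\#(A_i)-k_i+1)]=\int_{A_1^{k_1}\times\cdots\times A_m^{k_m}}R_k\,d\mu(x_1)\cdots d\mu(x_k)$. The field is Pfaffian with kernel $K$ if $K$ is a self-dual quaternion kernel and $R_m(x_1,\ldots,x_m)=\mathrm{Det}_M(K(x_i,x_j))_{1\le i,j\le m}$ for all $m\ge1$. Finite rank and eigenvalues. Let $\varphi:\mathbb{Q}_{\mathbb{C}}\to M_2(\mathbb{C})$ be the algebra isomorphism with $\mathbf{i}\mapsto\begin{pmatrix}0&i\\i&0\end{pmatrix}$, $\mathbf{j}\mapsto\begin{pmatrix}0&-1\\1&0\end{pmatrix}$, $\mathbf{k}\mapsto\begin{pmatrix}i&0\\0&-i\end{pmatrix}$. A scalar $\lambda$ is an eigenvalue of a quaternion matrix or operator $X$ if $Xv=v\lambda$ for some non-zero quaternion vector (function) $v$; equivalently, $\lambda$ is an eigenvalue of the complex matrix or operator $\varphi(X)$. $K$ is finite-rank if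 the integral operator on $L^2(\Lambda,\mu;\mathbb{C}^2)$ with kernel $\varphi(K(x,y))$ has finite rank. *)

theory Defs
  imports
    "HOL-Probability.Probability"
    "HOL-Combinatorics.Orbits"
begin

section \<open>Complexified quaternions\<close>

datatype cquat =
  CQuat (cq_s: complex) (cq_x: complex) (cq_y: complex) (cq_z: complex)

instantiation cquat :: ring_1
begin

definition zero_cquat :: cquat where
  "0 = CQuat 0 0 0 0"

definition one_cquat :: cquat where
  "1 = CQuat 1 0 0 0"

definition plus_cquat :: "cquat \<Rightarrow> cquat \<Rightarrow> cquat" where
  "p + q = CQuat (cq_s p + cq_s q) (cq_x p + cq_x q) (cq_y p + cq_y q) (cq_z p + cq_z q)"

definition uminus_cquat :: "cquat \<Rightarrow> cquat" where
  "- q = CQuat (- cq_s q) (- cq_x q) (- cq_y q) (- cq_z q)"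

definition minus_cquat :: "cquat \<Rightarrow> cquat \<Rightarrow> cquat" where
  "p - q = CQuat (cq_s p - cq_s q) (cq_x p - cq_x q) (cq_y p - cq_y q) (cq_z p - cq_z q)"

definition times_cquat :: "cquat \<Rightarrow> cquat \<Rightarrow> cquat" where
  "p * q = CQuat
     (cq_s p * cq_s q - cq_x p * cq_x q - cq_y p * cq_y q - cq_z p * cq_z q)
     (cq_s p * cq_x q + cq_x p * cq_s q + cq_y p * cq_z q - cq_z p * cq_y q)
     (cq_s p * cq_y q - cq_x p * cq_z q + cq_y p * cq_s q + cq_z p * cq_x q)
     (cq_s p * cq_z q + cq_x p * cq_y q - cq_y p * cq_x q + cq_z p * cq_s q)"

instance
  by standard
    (simp_all add: zero_cquat_def one_cquat_def plus_cquat_def uminus_cquat_def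
      minus_cquat_def times_cquat_def algebra_simps)

end

definition cq_of_complex :: "complex \<Rightarrow> cquat" where
  "cq_of_complex c = CQuat c 0 0 0"

text \<open>The coefficients are not complex-conjugated.\<close>

definition cq_conj :: "cquat \<Rightarrow> cquat" where
  "cq_conj q = CQuat (cq_s q) (- cq_x q) (- cq_y q) (- cq_z q)"

definition cq_mat :: "cquat \<Rightarrow> complex^2^2" where
  "cq_mat q = vector
     [vector [cq_s q + \<i> * cq_z q, \<i> * cq_x q - cq_y q],
      vector [\<i> * cq_x q + cq_y q, cq_s q - \<i> * cq_z q]]"

lemma cq_mat_units:
  "cq_mat (CQuat 0 1 0 0) = vector [vector [0, \<i>], vector [\<i>, 0]]"
  "cq_mat (CQuat 0 0 1 0) = vector [vector [0, -1], vector [1, 0]]"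
  "cq_mat (CQuat 0 0 0 1) = vector [vector [\<i>, 0], vector [0, -\<i>]]"
  by (simp_all add: cq_mat_def)

lemma cq_mat_one: "cq_mat 1 = mat 1"
  by (simp add: cq_mat_def one_cquat_def vec_eq_iff forall_2 mat_def)

lemma cq_mat_add: "cq_mat (p + q) = cq_mat p + cq_mat q"
  by (simp add: cq_mat_def plus_cquat_def vec_eq_iff forall_2 algebra_simps)

lemma cq_mat_mult: "cq_mat (p * q) = cq_mat p ** cq_mat q"
  by (simp add: cq_mat_def times_cquat_def vec_eq_iff forall_2 matrix_matrix_mult_def sum_2
      algebra_simps)

definition self_dual_kernel :: "'a set \<Rightarrow> ('a \<Rightarrow> 'a \<Rightarrow> cquat) \<Rightarrow> bool" where
  "self_dual_kernel \<Lambda> K \<longleftrightarrow> (\<forall>x\<in>\<Lambda>. \<forall>y\<in>\<Lambda>. K y x = cq_conj (K x y))"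

section \<open>The Moore-Dyson determinant\<close>

definition cycle_maxima :: "nat \<Rightarrow> (nat \<Rightarrow> nat) \<Rightarrow> nat set" where
  "cycle_maxima n \<sigma> = {a. a < n \<and> (\<forall>b\<in>orbit \<sigma> a. b \<le> a)}"

definition cycle_product :: "(nat \<Rightarrow> nat \<Rightarrow> cquat) \<Rightarrow> (nat \<Rightarrow> nat) \<Rightarrow> nat \<Rightarrow> cquat" where
  "cycle_product X \<sigma> a =
     prod_list (map (\<lambda>k. X ((\<sigma> ^^ k) a) ((\<sigma> ^^ Suc k) a)) [0..<card (orbit \<sigma> a)])"

text \<open>
  Rows and columns are indexed by \<open>{..<n}\<close>.  The cycles are multiplied in decreasing order of
  their largest elements, each cycle starting at its largest element.
\<close>

definition det_MD :: "nat \<Rightarrow> (nat \<Rightarrow> nat \<Rightarrow> cquat) \<Rightarrow> cquat" where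
  "det_MD n X =
     (\<Sum>\<sigma> | \<sigma> permutes {..<n}.
        (- 1) ^ (n - card (cycle_maxima n \<sigma>)) *
        prod_list (map (cycle_product X \<sigma>) (rev (sorted_list_of_set (cycle_maxima n \<sigma>)))))"

section \<open>Random point fields\<close>

text \<open>
  The space is carried by an explicit topology, so that it can vary along a sequence.
  Sigma-finiteness makes the powers of the measure meaningful.
\<close>

definition background_space :: "'a topology \<Rightarrow> 'a measure \<Rightarrow> bool" where
  "background_space T \<mu> \<longleftrightarrow>
     space \<mu> = topspace T \<and> (\<forall>U. openin T U \<longrightarrow> U \<in> sets \<mu>) \<and> sigma_finite_measure \<mu>"

text \<open>
  A configuration is given by its multiplicity function, so multiple points are not excluded
  a priori.
\<close>

definition configurations :: "'a topology \<Rightarrow> ('a \<Rightarrow> nat) set" where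
  "configurations T =
     {c. {x. c x \<noteq> 0} \<subseteq> topspace T \<and> countable {x. c x \<noteq> 0} \<and>
         (\<forall>C. compactin T C \<longrightarrow> finite {x\<in>C. c x \<noteq> 0})}"

definition num_points :: "'a set \<Rightarrow> ('a \<Rightarrow> nat) \<Rightarrow> ennreal" where
  "num_points A c = (\<integral>\<^sup>+x. of_nat (c x) \<partial>count_space A)"

definition random_point_field ::
  "'a topology \<Rightarrow> 'a measure \<Rightarrow> ('a \<Rightarrow> nat) measure \<Rightarrow> bool" where
  "random_point_field T \<mu> P \<longleftrightarrow>
     prob_space P \<and> space P = configurations T \<and>
     sets P = sigma_sets (configurations T)
       {{c \<in> configurations T. num_points A c = t} | A t. A \<in> sets \<mu>}"

text \<open>
  The subtraction of type \<open>ennreal\<close> is truncated at zero; for \<open>N\<close> a natural number below \<open>k\<close> the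
  product contains the factor \<open>N - N = 0\<close>, and for \<open>N = \<infinity>\<close>, \<open>k > 0\<close> it is infinite.
\<close>

definition ennreal_ffact :: "nat \<Rightarrow> ennreal \<Rightarrow> ennreal" where
  "ennreal_ffact k N = (\<Prod>j<k. N - of_nat j)"

text \<open>
  The set \<open>A 0 ^ \<kappa> 0 \<times> \<dots> \<times> A (m - 1) ^ \<kappa> (m - 1)\<close>: the \<open>i\<close>-th block of coordinates starts at
  position \<open>\<kappa> 0 + \<dots> + \<kappa> (i - 1)\<close> and has length \<open>\<kappa> i\<close>.
\<close>

definition block_product ::
  "'a measure \<Rightarrow> nat \<Rightarrow> (nat \<Rightarrow> 'a set) \<Rightarrow> (nat \<Rightarrow> nat) \<Rightarrow> (nat \<Rightarrow> 'a) set" where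
  "block_product \<mu> m A \<kappa> =
     {x \<in> {..<(\<Sum>i<m. \<kappa> i)} \<rightarrow>\<^sub>E space \<mu>.
        \<forall>i<m. \<forall>l. (\<Sum>j<i. \<kappa> j) \<le> l \<and> l < (\<Sum>j<i. \<kappa> j) + \<kappa> i \<longrightarrow> x l \<in> A i}"

text \<open>
  Local integrability only has to be tested on the compact sets \<open>C\<^sup>k\<close>, because every compact subset
  of the \<open>k\<close>-th power is contained in one of them.
\<close>

definition correlation_function ::
  "'a topology \<Rightarrow> 'a measure \<Rightarrow> ('a \<Rightarrow> nat) measure \<Rightarrow> nat \<Rightarrow> ((nat \<Rightarrow> 'a) \<Rightarrow> real) \<Rightarrow> bool" where
  "correlation_function T \<mu> P k R \<longleftrightarrow>
     R \<in> borel_measurable (Pi\<^sub>M {..<k} (\<lambda>_. \<mu>)) \<and>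
     (\<forall>x \<in> {..<k} \<rightarrow>\<^sub>E space \<mu>. 0 \<le> R x) \<and>
     (\<forall>C. compactin T C \<longrightarrow>
        (\<integral>\<^sup>+x. ennreal (R x) * indicator ({..<k} \<rightarrow>\<^sub>E C) x \<partial>Pi\<^sub>M {..<k} (\<lambda>_. \<mu>)) < \<infinity>) \<and>
     (\<forall>m A \<kappa>. (\<forall>i<m. A i \<in> sets \<mu>) \<and> disjoint_family_on A {..<m} \<and> (\<Sum>i<m. \<kappa> i) = k \<longrightarrow>
        (\<integral>\<^sup>+c. (\<Prod>i<m. ennreal_ffact (\<kappa> i) (num_points (A i) c)) \<partial>P) =
        (\<integral>\<^sup>+x. ennreal (R x) * indicator (block_product \<mu> m A \<kappa>) x \<partial>Pi\<^sub>M {..<k} (\<lambda>_. \<mu>)))"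

definition pfaffian_point_field ::
  "'a topology \<Rightarrow> 'a measure \<Rightarrow> ('a \<Rightarrow> nat) measure \<Rightarrow> ('a \<Rightarrow> 'a \<Rightarrow> cquat) \<Rightarrow> bool" where
  "pfaffian_point_field T \<mu> P K \<longleftrightarrow>
     random_point_field T \<mu> P \<and> self_dual_kernel (topspace T) K \<and>
     (\<forall>m\<ge>1. \<exists>R. correlation_function T \<mu> P m R \<and>
        (\<forall>x \<in> {..<m} \<rightarrow>\<^sub>E topspace T.
           cq_of_complex (complex_of_real (R x)) = det_MD m (\<lambda>i j. K (x i) (x j))))"

text \<open>
  An infinite count would be sent to zero, and the variance of a random variable that is not square
  integrable is zero; diverging variances therefore concern fields with square integrable counts.
\<close>

definition total_points :: "'a topology \<Rightarrow> ('a \<Rightarrow> nat) \<Rightarrow> real" where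
  "total_points T c = enn2real (num_points (topspace T) c)"

section \<open>Finite rank and eigenvalues\<close>

definition square_integrable :: "'a measure \<Rightarrow> ('a \<Rightarrow> 'b::real_normed_vector) \<Rightarrow> bool" where
  "square_integrable \<mu> f \<longleftrightarrow> f \<in> borel_measurable \<mu> \<and> integrable \<mu> (\<lambda>x. (norm (f x))\<^sup>2)"

definition kernel_op ::
  "'a measure \<Rightarrow> ('a \<Rightarrow> 'a \<Rightarrow> cquat) \<Rightarrow> ('a \<Rightarrow> complex^2) \<Rightarrow> 'a \<Rightarrow> complex^2" where
  "kernel_op \<mu> K f x = (LINT y|\<mu>. cq_mat (K x y) *v f y)"

text \<open>The integral operator is a well-defined bounded operator on the space of square integrable
  functions with values in \<open>complex^2\<close>.\<close>

definition L2_kernel :: "'a measure \<Rightarrow> ('a \<Rightarrow> 'a \<Rightarrow> cquat) \<Rightarrow> bool" where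
  "L2_kernel \<mu> K \<longleftrightarrow>
     (\<lambda>(x, y). cq_mat (K x y)) \<in> borel_measurable (\<mu> \<Otimes>\<^sub>M \<mu>) \<and>
     (\<forall>f. square_integrable \<mu> f \<longrightarrow>
        (AE x in \<mu>. integrable \<mu> (\<lambda>y. cq_mat (K x y) *v f y)) \<and>
        square_integrable \<mu> (kernel_op \<mu> K f)) \<and>
     (\<exists>B. \<forall>f. square_integrable \<mu> f \<longrightarrow>
        (LINT x|\<mu>. (norm (kernel_op \<mu> K f x))\<^sup>2) \<le> B * (LINT x|\<mu>. (norm (f x))\<^sup>2))"

definition finite_rank_kernel :: "'a measure \<Rightarrow> ('a \<Rightarrow> 'a \<Rightarrow> cquat) \<Rightarrow> bool" where
  "finite_rank_kernel \<mu> K \<longleftrightarrow>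
     L2_kernel \<mu> K \<and>
     (\<exists>G. finite G \<and> (\<forall>g\<in>G. square_integrable \<mu> g) \<and>
        (\<forall>f. square_integrable \<mu> f \<longrightarrow>
           (\<exists>a. AE x in \<mu>. kernel_op \<mu> K f x = (\<Sum>g\<in>G. a g *s g x))))"

definition cq_square_integrable :: "'a measure \<Rightarrow> ('a \<Rightarrow> cquat) \<Rightarrow> bool" where
  "cq_square_integrable \<mu> v \<longleftrightarrow>
     square_integrable \<mu> (\<lambda>x. cq_s (v x)) \<and> square_integrable \<mu> (\<lambda>x. cq_x (v x)) \<and>
     square_integrable \<mu> (\<lambda>x. cq_y (v x)) \<and> square_integrable \<mu> (\<lambda>x. cq_z (v x))"

definition cq_integral :: "'a measure \<Rightarrow> ('a \<Rightarrow> cquat) \<Rightarrow> cquat" where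
  "cq_integral \<mu> v =
     CQuat (LINT x|\<mu>. cq_s (v x)) (LINT x|\<mu>. cq_x (v x))
           (LINT x|\<mu>. cq_y (v x)) (LINT x|\<mu>. cq_z (v x))"

text \<open>Eigenfunctions are elements of the space of square integrable quaternion functions, so being
  non-zero and the eigenvalue equation are understood almost everywhere.\<close>

definition kernel_eigenvalue :: "'a measure \<Rightarrow> ('a \<Rightarrow> 'a \<Rightarrow> cquat) \<Rightarrow> complex \<Rightarrow> bool" where
  "kernel_eigenvalue \<mu> K z \<longleftrightarrow>
     (\<exists>v. cq_square_integrable \<mu> v \<and> \<not> (AE x in \<mu>. v x = 0) \<and>
        (AE x in \<mu>. cq_integral \<mu> (\<lambda>y. K x y * v y) = v x * cq_of_complex z))"

end

theory Submission
  imports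
    Defs
    "HOL-Combinatorics.Cycles"
    "HOL-Real_Asymp.Real_Asymp"
    "Jordan_Normal_Form.Schur_Decomposition"
begin

text \<open>
  Expanding the Moore-Dyson determinant along the cycle of its largest index and integrating gives
  Newton's identities: the factorial moments of the number of points \<open>N\<close> are related to
  \<open>p\<^sub>1 = \<integral> K(x, x)\<close> and \<open>p\<^sub>s = tr \<phi>(K)\<^sup>s / 2\<close> for \<open>s \<ge> 2\<close> as elementary symmetric functions are to
  power sums. Since \<open>K\<close> has finite rank, the traces are power sums of finitely many eigenvalues
  \<open>l\<^sub>i \<in> [0, 1]\<close>, and so \<open>(E (1 + t)\<^sup>N)\<^sup>2 = exp (c t) \<Prod>\<^sub>i (1 + t l\<^sub>i)\<close>. The factor \<open>exp (c t)\<close> appears because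
  the values of \<open>K\<close> on the diagonal are not determined by the operator; \<open>c \<ge> 0\<close>, since the left side
  is at least \<open>1\<close> for \<open>t \<ge> 0\<close>. At \<open>1 + t = exp (\<i> u)\<close> the right side is the characteristic function of a
  sum of independent Bernoulli and Poisson variables with variance \<open>2 Var N\<close>. So the squared
  characteristic function of the normalised \<open>N\<close> tends to \<open>exp (- u\<^sup>2)\<close>; continuity in \<open>u\<close> fixes the sign of
  the square root, and Levy's theorem applies. When the variance is not zero, Chebyshev's inequality
  on an exhaustion by sets of finite intensity shows that \<open>p\<^sub>1\<close> is finite.
\<close>

section \<open>Power sums of eigenvalues\<close>

text \<open>The squares come from \<open>\<phi>\<close>: the trace of a 2 x 2 matrix is twice the
  scalar part, so a cycle integrates to only half a power sum. Doubling makes the power sums whole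
  and avoids choosing a square root of the product. Two obstacles shape the proof. The scalar part
  of a quaternion is not multiplicative, so the factors of the cycle expansion do not separate by
  themselves; they do because the minor left after removing a cycle is a correlation function, hence
  a scalar. Moreover the Moore-Dyson determinant evaluates K pointwise, whereas the operator only
  sees K almost everywhere on the product space. A cycle with at least two points uses K at pairs of
  different coordinates only, where a factorization valid almost everywhere can be inserted before
  integrating; only fixed points read the diagonal. The expansion is integrated over a set A instead
  of the whole space, because integrability of the intensity has to be derived. The same lemmas
  serve the exhaustion that proves it and the whole space afterwards.\<close>

primrec fun_mat_pow :: "nat \<Rightarrow> (nat \<Rightarrow> nat \<Rightarrow> complex) \<Rightarrow> nat \<Rightarrow> nat \<Rightarrow> nat \<Rightarrow> complex" where
  "fun_mat_pow r N 0 i j = (if i = j then 1 else 0)"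
| "fun_mat_pow r N (Suc s) i j = (\<Sum>k<r. N i k * fun_mat_pow r N s k j)"

lemma index_pow_mat_fun:
  assumes "i < r" "j < r"
  shows "index_mat (pow_mat (Matrix.mat r r (\<lambda>(i, j). N i j)) s) (i, j) = fun_mat_pow r N s i j"
  using assms
proof (induction s arbitrary: i j)
  case (Suc s)
  let ?A = "Matrix.mat r r (\<lambda>(i, j). N i j)"
  have A: "?A \<in> carrier_mat r r" by simp
  have As: "pow_mat ?A s \<in> carrier_mat r r" by (rule pow_carrier_mat[OF A])
  \<comment> \<open>\<open>pow_mat\<close> puts the new factor on the right,
    \<open>fun_mat_pow\<close> on the left.\<close>
  have "pow_mat ?A (Suc s) = ?A * pow_mat ?A s"
  proof (induction s)
    case (Suc s)
    have "pow_mat ?A (Suc (Suc s)) = pow_mat ?A (Suc s) * ?A" by simp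
    also have "\<dots> = ?A * pow_mat ?A s * ?A" using Suc by simp
    also have "\<dots> = ?A * (pow_mat ?A s * ?A)"
      by (rule assoc_mult_mat[OF A pow_carrier_mat[OF A] A])
    finally show ?case by simp
  qed (simp add: left_mult_one_mat[OF A] right_mult_one_mat[OF A])
  then show ?case
    using Suc As by (auto simp: scalar_prod_def atLeast0LessThan)
qed simp

lemma trace_mult_commute:
  assumes "A \<in> carrier_mat r r" "B \<in> carrier_mat r r"
  shows "(\<Sum>i<r. index_mat (A * B) (i, i)) = (\<Sum>i<r. index_mat (B * A) (i, i :: nat) :: complex)"
proof -
  have "(\<Sum>i<r. index_mat (A * B) (i, i)) = (\<Sum>i<r. \<Sum>j<r. index_mat A (i, j) * index_mat B (j, i))"
    using assms by (intro sum.cong) (auto simp: scalar_prod_def atLeast0LessThan)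
  also have "\<dots> = (\<Sum>j<r. \<Sum>i<r. index_mat B (j, i) * index_mat A (i, j))"
    by (subst sum.swap) (simp add: mult.commute)
  also have "\<dots> = (\<Sum>i<r. index_mat (B * A) (i, i))"
    using assms by (intro sum.cong) (auto simp: scalar_prod_def atLeast0LessThan)
  finally show ?thesis .
qed

text \<open>Although only the diagonal is of interest, the induction needs the zeros of the power
  below the diagonal: together with those of B they leave a single term in the product.\<close>

lemma upper_triangular_pow_index:
  assumes B: "B \<in> carrier_mat r r" and ut: "upper_triangular B"
    and "i < r" "j \<le> i"
  shows "index_mat (pow_mat B s) (i, j) = (if i = j then (index_mat B (i, i)) ^ s else (0 :: complex))"
  using assms(3-)
proof (induction s arbitrary: i j)
  case 0
  then show ?case using B by simp
next
  case (Suc s)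
  have Bs: "pow_mat B s \<in> carrier_mat r r" by (rule pow_carrier_mat[OF B])
  have "index_mat (pow_mat B (Suc s)) (i, j) = (\<Sum>k<r. index_mat (pow_mat B s) (i, k) * index_mat B (k, j))"
    using Suc.prems B Bs by (auto simp: scalar_prod_def atLeast0LessThan)
  also have "\<dots> = (\<Sum>k<r. if k = i then index_mat (pow_mat B s) (i, i) * index_mat B (i, j) else 0)"
  proof (rule sum.cong[OF refl])
    fix k assume k: "k \<in> {..<r}"
    consider "k < i" | "k = i" | "k > i" by linarith
    then show "index_mat (pow_mat B s) (i, k) * index_mat B (k, j) = (if k = i then index_mat (pow_mat B s) (i, i) * index_mat B (i, j) else 0)"
    proof cases
      case 3
      then have "index_mat B (k, j) = 0"
        using ut k Suc.prems B by (auto simp: upper_triangular_def)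
      then show ?thesis using 3 by simp
    qed (use Suc in auto)
  qed
  also have "\<dots> = index_mat (pow_mat B s) (i, i) * index_mat B (i, j)" using Suc.prems by simp
  also have "\<dots> = (if i = j then (index_mat B (i, i)) ^ Suc s else 0)"
    using Suc.IH[of i i] Suc.prems ut B by (auto simp: upper_triangular_def)
  finally show ?case .
qed

text \<open>A Schur decomposition makes the matrix triangular with the roots of its characteristic
  polynomial, counted with multiplicity, on the diagonal, and the traces of powers are invariant
  under similarity. Eigenvectors are returned because each list element must later be recognised as
  an eigenvalue of the kernel.\<close>

lemma eigenvalues_power_sums:
  fixes N :: "nat \<Rightarrow> nat \<Rightarrow> complex"
  obtains ls where
    "\<And>l. l \<in> set ls \<Longrightarrow> \<exists>c. (\<exists>i<r. c i \<noteq> 0) \<and> (\<forall>i<r. (\<Sum>k<r. N i k * c k) = l * c i)"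
    "\<And>s. (\<Sum>i<r. fun_mat_pow r N s i i) = (\<Sum>l\<leftarrow>ls. l ^ s)"
proof -
  define A where "A = Matrix.mat r r (\<lambda>(i, j). N i j)"
  have A: "A \<in> carrier_mat r r" by (simp add: A_def)
  obtain ls where ls: "char_poly A = (\<Prod>a\<leftarrow>ls. [:- a, 1:])" "length ls = r"
    using char_poly_factorized[OF A] by blast
  obtain B P Q where "schur_decomposition A ls = (B, P, Q)" by (metis prod_cases3)
  from schur_decomposition[OF A ls(1) this]
  have wit: "similar_mat_wit A B P Q" and ut: "upper_triangular B" and diag: "diag_mat B = ls" by auto
  from similar_mat_witD2[OF A wit]
  have carr: "B \<in> carrier_mat r r" "P \<in> carrier_mat r r" "Q \<in> carrier_mat r r" and QP: "Q * P = 1\<^sub>m r" by auto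
  show ?thesis
  proof (rule that[of ls])
    fix l assume "l \<in> set ls"
    then have "poly (char_poly A) l = 0"
      unfolding ls(1) poly_prod_list by (force simp: prod_list_zero_iff)
    then have "eigenvalue A l" by (simp add: eigenvalue_root_char_poly[OF A])
    then obtain v where v: "v \<in> carrier_vec r" "v \<noteq> 0\<^sub>v r" "mult_mat_vec A v = smult_vec l v"
      using A by (auto simp: eigenvalue_def eigenvector_def)
    show "\<exists>c. (\<exists>i<r. c i \<noteq> 0) \<and> (\<forall>i<r. (\<Sum>k<r. N i k * c k) = l * c i)"
    proof (intro exI[of _ "vec_index v"] conjI allI impI)
      show "\<exists>i<r. vec_index v i \<noteq> 0"
      proof (rule ccontr)
        assume "\<not> ?thesis"
        then have "v = 0\<^sub>v r" using v(1) by (intro eq_vecI) auto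
        then show False using v(2) by simp
      qed
      fix i assume "i < r"
      moreover have "vec_index (mult_mat_vec A v) i = vec_index (smult_vec l v) i" by (simp only: v(3))
      ultimately show "(\<Sum>k<r. N i k * vec_index v k) = l * vec_index v i"
        using v(1) by (simp add: A_def scalar_prod_def atLeast0LessThan)
    qed
  next
    fix s
    have Bs: "pow_mat B s \<in> carrier_mat r r" by (rule pow_carrier_mat[OF carr(1)])
    have "(\<Sum>i<r. fun_mat_pow r N s i i) = (\<Sum>i<r. index_mat (pow_mat A s) (i, i))"
      by (simp add: A_def index_pow_mat_fun)
    also have "pow_mat A s = P * pow_mat B s * Q" by (rule similar_mat_wit_pow_id[OF wit])
    also have "\<dots> = P * (pow_mat B s * Q)" by (rule assoc_mult_mat[OF carr(2) Bs carr(3)])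
    also have "(\<Sum>i<r. index_mat \<dots> (i, i)) = (\<Sum>i<r. index_mat (pow_mat B s * Q * P) (i, i))"
      by (rule trace_mult_commute[OF carr(2)]) (use Bs carr in auto)
    also have "pow_mat B s * Q * P = pow_mat B s"
      using assoc_mult_mat[OF Bs carr(3,2)] QP right_mult_one_mat[OF Bs] by simp
    also have "(\<Sum>i<r. index_mat (pow_mat B s) (i, i)) = (\<Sum>i<r. (index_mat B (i, i)) ^ s)"
      by (intro sum.cong refl) (simp add: upper_triangular_pow_index[OF carr(1) ut])
    also have "\<dots> = (\<Sum>l\<leftarrow>ls. l ^ s)"
      using carr(1) unfolding diag[symmetric] diag_mat_def
      by (simp add: comp_def interv_sum_list_conv_sum_set_nat atLeast0LessThan)
    finally show "(\<Sum>i<r. fun_mat_pow r N s i i) = (\<Sum>l\<leftarrow>ls. l ^ s)" .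
  qed
qed

no_notation vec_index (infixl "$" 100)

section \<open>Central limit theorem from squared characteristic functions\<close>

text \<open>For the upper bound, \<open>1 + y + y\<^sup>2 / 2 \<le> exp y\<close> is combined with
  the fact that this polynomial times its value at -y is \<open>1 + y ^ 4 / 4\<close>, hence at
  least 1.\<close>

lemma exp_minus_linear_bound:
  fixes y :: real
  assumes "0 \<le> y"
  shows "\<bar>exp (- y) - (1 - y)\<bar> \<le> y\<^sup>2 / 2"
proof -
  have "1 \<le> (1 - y + y\<^sup>2 / 2) * (1 + y + y\<^sup>2 / 2)"
  proof -
    have "(1 - y + y\<^sup>2 / 2) * (1 + y + y\<^sup>2 / 2) = 1 + y ^ 4 / 4"
      by (simp add: power2_eq_square power4_eq_xxxx field_simps)
    then show ?thesis by simp
  qed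
  also have "\<dots> \<le> (1 - y + y\<^sup>2 / 2) * exp y"
  proof (rule mult_left_mono[OF exp_lower_Taylor_quadratic[OF assms]])
    have "1 - y + y\<^sup>2 / 2 = ((1 - y)\<^sup>2 + 1) / 2" by (simp add: power2_eq_square field_simps)
    also have "\<dots> \<ge> 0" by (intro divide_nonneg_nonneg add_nonneg_nonneg) auto
    finally show "0 \<le> 1 - y + y\<^sup>2 / 2" .
  qed
  finally have "exp (- y) \<le> 1 - y + y\<^sup>2 / 2" by (simp add: exp_minus field_simps)
  moreover have "1 - y \<le> exp (- y)" using exp_ge_add_one_self[of "- y"] by simp
  ultimately show ?thesis by simp
qed

text \<open>A centred Bernoulli variable against the Gaussian of the same variance. The point is
  that the error is proportional to the variance \<open>l * (1 - l)\<close>: summed over all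
  eigenvalues, it stays below a multiple of the total variance, however many eigenvalues there
  are.\<close>

lemma bernoulli_char_bound:
  fixes l u :: real
  assumes "0 \<le> l" "l \<le> 1"
  shows "norm (iexp (- (l * u)) * (1 + l * (iexp u - 1)) - exp (- (l * (1 - l) * u\<^sup>2 / 2)))
         \<le> l * (1 - l) * (\<bar>u\<bar> ^ 3 + u ^ 4)"
proof -
  define v where "v = l * (1 - l)"
  have v: "0 \<le> v" "v \<le> 1" using assms by (auto simp: v_def mult_le_one)
  define T where "T x = (\<Sum>k\<le>2. (\<i> * complex_of_real x) ^ k / fact k)" for x
  have T: "norm (iexp x - T x) \<le> \<bar>x\<bar> ^ 3 / 6" for x
    using iexp_approx1[of x 2] by (simp add: T_def eval_nat_numeral)
  have T_eq: "T x = 1 + \<i> * x - x\<^sup>2 / 2" for x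
    by (simp add: T_def eval_nat_numeral algebra_simps)
  have h1: "iexp (- (l * u)) * (1 + l * (iexp u - 1)) =
      (1 - l) * iexp (- (l * u)) + l * iexp ((1 - l) * u)"
    by (simp add: algebra_simps flip: exp_add)
  \<comment> \<open>The variable is centred, so the linear terms cancel and the quadratic ones add
    up to its variance.\<close>
  have h2: "(1 - l) * T (- (l * u)) + l * T ((1 - l) * u) = complex_of_real (1 - v * u\<^sup>2 / 2)"
    by (simp add: T_eq v_def complex_eq_iff power2_eq_square field_simps)
  have "iexp (- (l * u)) * (1 + l * (iexp u - 1)) - complex_of_real (1 - v * u\<^sup>2 / 2) =
      complex_of_real (1 - l) * (iexp (- (l * u)) - T (- (l * u))) + complex_of_real l * (iexp ((1 - l) * u) - T ((1 - l) * u))"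
    unfolding h1 h2[symmetric] by (simp add: algebra_simps)
  also have "norm \<dots> \<le> (1 - l) * (\<bar>- (l * u)\<bar> ^ 3 / 6) + l * (\<bar>(1 - l) * u\<bar> ^ 3 / 6)"
    unfolding norm_mult using assms
    by (intro order_trans[OF norm_triangle_ineq] add_mono)
      (simp_all only: norm_mult norm_of_real abs_of_nonneg diff_ge_0_iff_ge mult_left_mono[OF T])
  also have "\<bar>- (l * u)\<bar> = l * \<bar>u\<bar>" using assms by (simp add: abs_mult)
  also have "\<bar>(1 - l) * u\<bar> = (1 - l) * \<bar>u\<bar>" using assms by (simp add: abs_mult)
  \<comment> \<open>The third absolute moment of the centred variable is its variance times
    \<open>l\<^sup>2 + (1 - l)\<^sup>2\<close>, and this factor is at most 1.\<close>
  also have "(1 - l) * ((l * \<bar>u\<bar>) ^ 3 / 6) + l * (((1 - l) * \<bar>u\<bar>) ^ 3 / 6) = v * (l\<^sup>2 + (1 - l)\<^sup>2) * \<bar>u\<bar> ^ 3 / 6"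
    by (simp add: v_def power2_eq_square power3_eq_cube field_simps)
  also have "\<dots> \<le> v * 1 * \<bar>u\<bar> ^ 3 / 1"
  proof (intro frac_le mult_mono)
    have "l\<^sup>2 + (1 - l)\<^sup>2 = 1 - 2 * v" by (simp add: v_def power2_eq_square algebra_simps)
    then show "l\<^sup>2 + (1 - l)\<^sup>2 \<le> 1" using v by simp
  qed (use v in auto)
  finally have 1: "norm (iexp (- (l * u)) * (1 + l * (iexp u - 1)) - complex_of_real (1 - v * u\<^sup>2 / 2)) \<le> v * \<bar>u\<bar> ^ 3"
    by simp
  have "norm (complex_of_real (1 - v * u\<^sup>2 / 2) - exp (- (v * u\<^sup>2 / 2))) \<le> (v * u\<^sup>2 / 2)\<^sup>2 / 2"
  proof -
    have "norm (complex_of_real (1 - v * u\<^sup>2 / 2) - exp (- (v * u\<^sup>2 / 2))) =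
        norm (complex_of_real (exp (- (v * u\<^sup>2 / 2)) - (1 - v * u\<^sup>2 / 2)))"
      by (simp only: of_real_diff norm_minus_commute)
    also have "\<dots> = \<bar>exp (- (v * u\<^sup>2 / 2)) - (1 - v * u\<^sup>2 / 2)\<bar>" by (rule norm_of_real)
    finally show ?thesis using exp_minus_linear_bound[of "v * u\<^sup>2 / 2"] v by simp
  qed
  also have "\<dots> = v * v * u ^ 4 / 8" by (simp add: power2_eq_square power4_eq_xxxx)
  also have "\<dots> \<le> v * 1 * u ^ 4 / 1"
    using v by (intro frac_le mult_mono) (auto intro: mult_left_le)
  finally have "norm (complex_of_real (1 - v * u\<^sup>2 / 2) - exp (- (v * u\<^sup>2 / 2))) \<le> v * u ^ 4" by simp
  with 1 have "norm (iexp (- (l * u)) * (1 + l * (iexp u - 1)) - exp (- (v * u\<^sup>2 / 2))) \<le> v * \<bar>u\<bar> ^ 3 + v * u ^ 4"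
    by (meson norm_diff_triangle_le)
  then show ?thesis by (simp add: v_def algebra_simps)
qed

text \<open>The derivative of exp has modulus at most 1 on the closed left half-plane, which is
  convex.\<close>

lemma norm_exp_diff_le:
  fixes a b :: complex
  assumes "Re a \<le> 0" "Re b \<le> 0"
  shows "norm (exp a - exp b) \<le> norm (a - b)"
proof -
  have "norm (exp a - exp b) \<le> 1 * norm (a - b)"
  proof (rule field_differentiable_bound[where S = "{z. Re z \<le> 0}" and f' = exp])
    show "convex {z. Re z \<le> 0}" by (rule convex_halfspace_Re_le)
  qed (use assms in \<open>auto intro!: derivative_eq_intros\<close>)
  then show ?thesis by simp
qed

text \<open>A centred Poisson variable, whose mean and variance are c. Both sides are exponentials
  with exponents of nonpositive real part, so it suffices to compare the exponents by Taylor's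
  formula.\<close>

lemma poisson_char_bound:
  fixes c u :: real
  assumes "0 \<le> c"
  shows "norm (iexp (- (c * u)) * exp (c * (iexp u - 1)) - exp (- (c * u\<^sup>2 / 2))) \<le> c * \<bar>u\<bar> ^ 3"
proof -
  define T where "T = (\<Sum>k\<le>2. (\<i> * complex_of_real u) ^ k / fact k)"
  have T: "norm (iexp u - T) \<le> \<bar>u\<bar> ^ 3 / 6"
    using iexp_approx1[of u 2] by (simp add: T_def eval_nat_numeral)
  have T_eq: "T = 1 + \<i> * u - u\<^sup>2 / 2"
    by (simp add: T_def eval_nat_numeral algebra_simps)
  define a where "a = c * (iexp u - 1) - \<i> * (c * u)"
  have "Re a = c * (cos u - 1)" by (simp add: a_def Re_exp)
  then have Re: "Re a \<le> 0" using assms by (simp add: mult_nonneg_nonpos)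
  have "iexp (- (c * u)) * exp (c * (iexp u - 1)) = exp a"
    by (simp add: a_def algebra_simps flip: exp_add)
  moreover have "complex_of_real (exp (- (c * u\<^sup>2 / 2))) = exp (complex_of_real (- (c * u\<^sup>2 / 2)))"
    by (simp only: exp_of_real)
  ultimately have "norm (iexp (- (c * u)) * exp (c * (iexp u - 1)) - exp (- (c * u\<^sup>2 / 2))) \<le> norm (a - complex_of_real (- (c * u\<^sup>2 / 2)))"
    using norm_exp_diff_le[OF Re, of "complex_of_real (- (c * u\<^sup>2 / 2))"] assms by simp
  also have "a - complex_of_real (- (c * u\<^sup>2 / 2)) = c * (iexp u - T)"
    by (simp add: a_def T_eq algebra_simps)
  also have "norm \<dots> \<le> c * (\<bar>u\<bar> ^ 3 / 6)"
    unfolding norm_mult using assms T by (intro mult_mono) auto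
  also have "\<dots> \<le> c * \<bar>u\<bar> ^ 3" using assms by (intro mult_left_mono) auto
  finally show ?thesis .
qed

lemma norm_mult_diff_le:
  fixes a b c d :: complex
  assumes "norm a \<le> 1" "norm d \<le> 1"
  shows "norm (a * b - c * d) \<le> norm (a - c) + norm (b - d)"
proof -
  have "a * b - c * d = a * (b - d) + (a - c) * d" by (simp add: algebra_simps)
  also have "norm \<dots> \<le> norm a * norm (b - d) + norm (a - c) * norm d"
    by (metis norm_triangle_ineq norm_mult)
  also have "\<dots> \<le> 1 * norm (b - d) + norm (a - c) * 1"
    using assms by (intro add_mono mult_mono) auto
  finally show ?thesis by simp
qed

text \<open>The factors are replaced by Gaussian ones one at a time. All of them have modulus at
  most 1, so the errors add up, and being proportional to the variances they add up to a multiple of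
  V.\<close>

lemma bernoulli_poisson_char_bound:
  fixes c u :: real and ls :: "real list"
  assumes "0 \<le> c" and "set ls \<subseteq> {0..1}"
  defines "V \<equiv> c + (\<Sum>l\<leftarrow>ls. l * (1 - l))"
  shows "norm (iexp (- ((c + sum_list ls) * u)) * (exp (c * (iexp u - 1)) * (\<Prod>l\<leftarrow>ls. 1 + complex_of_real l * (iexp u - 1)))
             - exp (- (V * u\<^sup>2 / 2))) \<le> V * (\<bar>u\<bar> ^ 3 + u ^ 4)"
  using assms(2) unfolding V_def
proof (induction ls)
  case Nil
  have "c * \<bar>u\<bar> ^ 3 \<le> c * (\<bar>u\<bar> ^ 3 + u ^ 4)" using assms(1) by (intro mult_left_mono) auto
  with poisson_char_bound[OF assms(1), of u] show ?case by simp
next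
  case (Cons l ls)
  have l: "0 \<le> l" "l \<le> 1" using Cons.prems by auto
  define a where "a = iexp (- (l * u)) * (1 + l * (iexp u - 1))"
  define a' where "a' = complex_of_real (exp (- (l * (1 - l) * u\<^sup>2 / 2)))"
  define b where "b = iexp (- ((c + sum_list ls) * u)) * (exp (c * (iexp u - 1)) * (\<Prod>l\<leftarrow>ls. 1 + complex_of_real l * (iexp u - 1)))"
  define b' where "b' = complex_of_real (exp (- ((c + (\<Sum>l\<leftarrow>ls. l * (1 - l))) * u\<^sup>2 / 2)))"
  have "norm (a * b - a' * b') \<le> norm (a - a') + norm (b - b')"
  proof (rule norm_mult_diff_le)
    have "norm a = norm (1 + l * (iexp u - 1))" by (simp add: a_def norm_mult norm_exp_i_times del: of_real_mult of_real_minus)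
    also have "1 + l * (iexp u - 1) = complex_of_real (1 - l) + l * iexp u" by (simp add: algebra_simps)
    also have "norm \<dots> \<le> norm (complex_of_real (1 - l)) + norm (l * iexp u)" by (rule norm_triangle_ineq)
    also have "\<dots> = 1" using l by (simp add: norm_mult del: of_real_diff)
    finally show "norm a \<le> 1" .
    have "0 \<le> (\<Sum>l\<leftarrow>ls. l * (1 - l))" using Cons.prems by (intro sum_list_nonneg) auto
    then show "norm b' \<le> 1" using assms(1) by (simp add: b'_def)
  qed
  also have "\<dots> \<le> l * (1 - l) * (\<bar>u\<bar> ^ 3 + u ^ 4) + (c + (\<Sum>l\<leftarrow>ls. l * (1 - l))) * (\<bar>u\<bar> ^ 3 + u ^ 4)"
    using bernoulli_char_bound[OF l, of u] Cons.IH Cons.prems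
    by (intro add_mono) (simp_all add: a_def a'_def b_def b'_def)
  also have "a' * b' = exp (- ((c + (\<Sum>l\<leftarrow>l # ls. l * (1 - l))) * u\<^sup>2 / 2))"
    unfolding a'_def b'_def of_real_mult[symmetric] exp_add[symmetric] by (simp add: field_simps)
  also have "a * b = iexp (- ((c + sum_list (l # ls)) * u)) * (exp (c * (iexp u - 1)) * (\<Prod>l\<leftarrow>l # ls. 1 + complex_of_real l * (iexp u - 1)))"
  proof -
    have "iexp (- ((c + sum_list (l # ls)) * u)) = iexp (- (l * u)) * iexp (- ((c + sum_list ls) * u))"
      by (simp add: exp_add[symmetric] algebra_simps)
    then show ?thesis by (simp add: a_def b_def mult_ac)
  qed
  finally show ?case by (simp add: algebra_simps)
qed

text \<open>Divided by the Gaussian characteristic function, the characteristic function has a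
  square uniformly close to 1 on the interval between 0 and t. It therefore cannot change from a
  neighbourhood of 1 to one of -1, and it starts at 1. This is why the bound must hold for all
  arguments and not only for t.\<close>

lemma char_limit_of_square:
  fixes M :: "nat \<Rightarrow> real measure" and s :: "nat \<Rightarrow> real"
  assumes M: "\<And>n. real_distribution (M n)"
    and s: "filterlim s at_top sequentially"
    and bound: "\<forall>\<^sub>F n in sequentially. \<forall>t. norm ((char (M n) t)\<^sup>2 - exp (- (t\<^sup>2))) \<le> 2 * (\<bar>t\<bar> ^ 3 / s n + t ^ 4 / (s n)\<^sup>2)"
  shows "(\<lambda>n. char (M n) t) \<longlonglongrightarrow> complex_of_real (exp (- (t\<^sup>2) / 2))"
proof -
  define f where "f n r = char (M n) r * complex_of_real (exp (r\<^sup>2 / 2))" for n r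
  define e where "e n = 2 * (\<bar>t\<bar> ^ 3 / s n + t ^ 4 / (s n)\<^sup>2) * exp (t\<^sup>2)" for n
  have e: "e \<longlonglongrightarrow> 0"
  proof -
    have "(\<lambda>n. inverse (s n)) \<longlonglongrightarrow> 0" by (rule tendsto_inverse_0_at_top[OF s])
    then have "(\<lambda>n. 2 * (\<bar>t\<bar> ^ 3 * inverse (s n) + t ^ 4 * (inverse (s n))\<^sup>2) * exp (t\<^sup>2)) \<longlonglongrightarrow> 2 * (\<bar>t\<bar> ^ 3 * 0 + t ^ 4 * 0\<^sup>2) * exp (t\<^sup>2)"
      by (intro tendsto_intros)
    then show ?thesis by (simp add: e_def[abs_def] field_simps)
  qed
  have e1: "\<forall>\<^sub>F n in sequentially. e n < 1"
    by (rule Topological_Spaces.order_tendstoD(2)[OF e]) simp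
  have "\<forall>\<^sub>F n in sequentially. norm (f n t - 1) \<le> e n"
    using bound s[unfolded filterlim_at_top_dense, rule_format, of 0] e1
  proof eventually_elim
    case (elim n)
    interpret real_distribution "M n" by (rule M)
    have sq: "norm ((f n r)\<^sup>2 - 1) \<le> e n" if "\<bar>r\<bar> \<le> \<bar>t\<bar>" for r
    proof -
      have ex: "complex_of_real (exp (r\<^sup>2 / 2)) ^ 2 = complex_of_real (exp (r\<^sup>2))"
        by (simp flip: of_real_power exp_of_real exp_double)
      have "(f n r)\<^sup>2 - 1 = ((char (M n) r)\<^sup>2 - exp (- (r\<^sup>2))) * complex_of_real (exp (r\<^sup>2))"
        unfolding f_def power_mult_distrib ex
        by (simp add: algebra_simps of_real_mult[symmetric] exp_add[symmetric] del: of_real_mult)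
      also have "norm \<dots> = norm ((char (M n) r)\<^sup>2 - exp (- (r\<^sup>2))) * exp (r\<^sup>2)"
        by (simp only: norm_mult norm_of_real abs_exp_cancel)
      also have "\<dots> \<le> (2 * (\<bar>r\<bar> ^ 3 / s n + r ^ 4 / (s n)\<^sup>2)) * exp (r\<^sup>2)"
        using elim(1) by (intro mult_right_mono) auto
      also have "\<dots> \<le> e n"
        unfolding e_def
      proof (intro mult_mono add_mono divide_right_mono)
        show "\<bar>r\<bar> ^ 3 \<le> \<bar>t\<bar> ^ 3" using that by (intro power_mono) auto
        have "\<bar>r\<bar> ^ 4 \<le> \<bar>t\<bar> ^ 4" using that by (intro power_mono) auto
        then show "r ^ 4 \<le> t ^ 4" by (simp add: power_even_abs)
        show "exp (r\<^sup>2) \<le> exp (t\<^sup>2)" using that by (simp add: abs_le_square_iff)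
      qed (use elim(2) in auto)
      finally show ?thesis .
    qed
    \<comment> \<open>The square of a number on the imaginary axis is at most 0, hence at distance
      at least 1 from 1.\<close>
    have Re: "Re (f n r) \<noteq> 0" if "\<bar>r\<bar> \<le> \<bar>t\<bar>" for r
    proof
      assume "Re (f n r) = 0"
      then have "(f n r)\<^sup>2 - 1 = complex_of_real (- ((Im (f n r))\<^sup>2) - 1)"
        by (simp add: complex_eq_iff power2_eq_square)
      then have "norm ((f n r)\<^sup>2 - 1) = \<bar>- ((Im (f n r))\<^sup>2) - 1\<bar>" by (simp only: norm_of_real)
      also have "\<dots> \<ge> 1" using zero_le_power2[of "Im (f n r)"] by linarith
      finally show False using sq[OF that] elim(3) by simp
    qed
    have "Re (f n t) > 0"
    proof (rule ccontr)
      assume "\<not> Re (f n t) > 0"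
      have cont: "isCont (\<lambda>r. Re (f n r)) r" for r
        unfolding f_def using isCont_char[of r] by (auto intro!: continuous_intros)
      have f0: "Re (f n 0) = 1" by (simp add: f_def char_zero)
      show False
      proof (cases "t \<ge> 0")
        case True
        have "\<exists>r. 0 \<le> r \<and> r \<le> t \<and> Re (f n r) = 0"
          using True \<open>\<not> Re (f n t) > 0\<close> f0 cont by (intro IVT2) auto
        with Re show False by auto
      next
        case False
        have "\<exists>r. t \<le> r \<and> r \<le> 0 \<and> Re (f n r) = 0"
          using False \<open>\<not> Re (f n t) > 0\<close> f0 cont by (intro IVT) auto
        with Re show False by auto
      qed
    qed
    \<comment> \<open>Since \<open>f\<^sup>2 - 1\<close> has the factor f + 1 of modulus at least 1,
      f is at least as close to 1 as its square.\<close>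
    then have "1 \<le> norm (f n t + 1)" using complex_Re_le_cmod[of "f n t + 1"] by simp
    then have "norm (f n t - 1) \<le> norm (f n t - 1) * norm (f n t + 1)"
      by (metis mult.right_neutral mult_left_mono norm_ge_zero)
    also have "\<dots> = norm ((f n t)\<^sup>2 - 1)"
      by (simp add: norm_mult[symmetric] power2_eq_square algebra_simps)
    also have "\<dots> \<le> e n" by (rule sq) simp
    finally show ?case .
  qed
  then have "(\<lambda>n. f n t - 1) \<longlonglongrightarrow> 0"
    by (rule Lim_null_comparison[OF _ e])
  then have "(\<lambda>n. f n t * complex_of_real (exp (- (t\<^sup>2) / 2))) \<longlonglongrightarrow> 1 * complex_of_real (exp (- (t\<^sup>2) / 2))"
    by (intro tendsto_mult tendsto_const) (simp add: LIM_zero_iff)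
  moreover have "f n t * complex_of_real (exp (- (t\<^sup>2) / 2)) = char (M n) t" for n
    by (simp add: f_def mult.assoc of_real_mult[symmetric] exp_add[symmetric] del: of_real_mult)
  ultimately show ?thesis by simp
qed

text \<open>The assumption says that the sum of two independent copies of \<open>X n\<close> has the law of the sum of a
  Poisson variable with mean \<open>c n\<close> and independent Bernoulli variables with parameters \<open>ls n\<close>.\<close>

lemma clt_of_square_char:
  fixes M :: "nat \<Rightarrow> 'b measure" and X :: "nat \<Rightarrow> 'b \<Rightarrow> real"
    and c m v :: "nat \<Rightarrow> real" and ls :: "nat \<Rightarrow> real list"
  assumes M: "\<And>n. prob_space (M n)" and X[measurable]: "\<And>n. X n \<in> borel_measurable (M n)"
    and v: "filterlim v at_top sequentially"
    and ev: "\<forall>\<^sub>F n in sequentially. 0 \<le> c n \<and> set (ls n) \<subseteq> {0..1} \<and>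
        2 * m n = c n + sum_list (ls n) \<and> 2 * v n = c n + (\<Sum>l\<leftarrow>ls n. l * (1 - l)) \<and>
        (\<forall>u. (char (distr (M n) borel (X n)) u)\<^sup>2 =
             exp (c n * (iexp u - 1)) * (\<Prod>l\<leftarrow>ls n. 1 + complex_of_real l * (iexp u - 1)))"
  shows "weak_conv_m (\<lambda>n. distr (M n) borel (\<lambda>x. (X n x - m n) / sqrt (v n))) std_normal_distribution"
proof (rule levy_continuity)
  define D where "D n = distr (M n) borel (\<lambda>x. (X n x - m n) / sqrt (v n))" for n
  have rd: "real_distribution (D n)" for n
    unfolding D_def by (intro prob_space.real_distribution_distr M) measurable
  then show "real_distribution (distr (M n) borel (\<lambda>x. (X n x - m n) / sqrt (v n)))" for n
    by (simp add: D_def)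
  show "real_distribution std_normal_distribution" by (rule real_dist_normal_dist)
  have s: "filterlim (\<lambda>n. sqrt (v n)) at_top sequentially"
    by (rule filterlim_compose[OF sqrt_at_top v])
  have "(\<lambda>n. char (D n) t) \<longlonglongrightarrow> complex_of_real (exp (- (t\<^sup>2) / 2))" for t
  proof (rule char_limit_of_square[OF rd s])
    show "\<forall>\<^sub>F n in sequentially. \<forall>t. norm ((char (D n) t)\<^sup>2 - exp (- (t\<^sup>2))) \<le> 2 * (\<bar>t\<bar> ^ 3 / sqrt (v n) + t ^ 4 / (sqrt (v n))\<^sup>2)"
      using ev v[unfolded filterlim_at_top_dense, rule_format, of 0]
    proof eventually_elim
      case (elim n)
      define \<sigma> where "\<sigma> = sqrt (v n)"
      have \<sigma>: "\<sigma> > 0" "\<sigma>\<^sup>2 = v n" using elim(2) by (auto simp: \<sigma>_def)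
      show ?case
      proof
        fix t :: real
        have "char (D n) t = (LINT x|M n. iexp (t * ((X n x - m n) / \<sigma>)))"
          unfolding char_def D_def by (simp add: integral_distr \<sigma>_def)
        also have "\<dots> = (LINT x|M n. iexp (- (m n * (t / \<sigma>))) * iexp ((t / \<sigma>) * X n x))"
        proof (rule Bochner_Integration.integral_cong[OF refl])
          fix x
          have "t * ((X n x - m n) / \<sigma>) = - (m n * (t / \<sigma>)) + (t / \<sigma>) * X n x"
            by (simp add: diff_divide_distrib algebra_simps)
          then show "iexp (t * ((X n x - m n) / \<sigma>)) = iexp (- (m n * (t / \<sigma>))) * iexp ((t / \<sigma>) * X n x)"
            by (simp only: of_real_add distrib_left exp_add)
        qed
        also have "\<dots> = iexp (- (m n * (t / \<sigma>))) * (LINT x|M n. iexp ((t / \<sigma>) * X n x))"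
          by (rule integral_mult_right_zero)
        also have "(LINT x|M n. iexp ((t / \<sigma>) * X n x)) = char (distr (M n) borel (X n)) (t / \<sigma>)"
          unfolding char_def by (simp add: integral_distr)
        finally have D: "char (D n) t = iexp (- (m n * (t / \<sigma>))) * char (distr (M n) borel (X n)) (t / \<sigma>)" .
        have "(char (D n) t)\<^sup>2 = iexp (- ((c n + sum_list (ls n)) * (t / \<sigma>))) *
            (exp (c n * (iexp (t / \<sigma>) - 1)) * (\<Prod>l\<leftarrow>ls n. 1 + complex_of_real l * (iexp (t / \<sigma>) - 1)))"
        proof -
          have "(iexp (- (m n * (t / \<sigma>))))\<^sup>2 = iexp (- (2 * m n * (t / \<sigma>)))"
            unfolding exp_double[symmetric] by (simp add: algebra_simps)
          also have "2 * m n = c n + sum_list (ls n)" using elim by simp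
          finally show ?thesis using elim(1) unfolding D power_mult_distrib by presburger
        qed
        then have "norm ((char (D n) t)\<^sup>2 - exp (- (2 * v n * (t / \<sigma>)\<^sup>2 / 2))) \<le> 2 * v n * (\<bar>t / \<sigma>\<bar> ^ 3 + (t / \<sigma>) ^ 4)"
          using bernoulli_poisson_char_bound[of "c n" "ls n" "t / \<sigma>"] elim(1) by simp
        \<comment> \<open>The doubled variance turns the limit of the square into
          \<open>exp (- t\<^sup>2)\<close>, the square of the standard Gaussian characteristic
          function.\<close>
        moreover have "2 * v n * (t / \<sigma>)\<^sup>2 / 2 = t\<^sup>2"
          unfolding \<sigma>(2)[symmetric] using \<sigma>(1) by (simp add: power_divide)
        moreover have "2 * v n * (\<bar>t / \<sigma>\<bar> ^ 3 + (t / \<sigma>) ^ 4) = 2 * (\<bar>t\<bar> ^ 3 / \<sigma> + t ^ 4 / \<sigma>\<^sup>2)"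
          unfolding \<sigma>(2)[symmetric] using \<sigma>(1) by (simp add: abs_divide power_divide eval_nat_numeral field_simps)
        ultimately show "norm ((char (D n) t)\<^sup>2 - exp (- (t\<^sup>2))) \<le> 2 * (\<bar>t\<bar> ^ 3 / sqrt (v n) + t ^ 4 / (sqrt (v n))\<^sup>2)"
          by (simp add: \<sigma>_def)
      qed
    qed
  qed
  then show "(\<lambda>n. char (distr (M n) borel (\<lambda>x. (X n x - m n) / sqrt (v n))) t) \<longlonglongrightarrow> char std_normal_distribution t" for t
    by (simp add: D_def char_std_normal_distribution)
qed

section \<open>Generating functions of factorial moments\<close>

text \<open>The equation expresses each coefficient of positive degree through those of lower
  degree; characteristic zero permits the division by the degree.\<close>

lemma fps_deriv_unique:
  fixes F G Q :: "'a :: field_char_0 fps"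
  assumes "fps_deriv F = Q * F" "fps_deriv G = Q * G" "fps_nth F 0 = fps_nth G 0"
  shows "F = G"
proof (rule fps_ext)
  fix n
  show "fps_nth F n = fps_nth G n"
  proof (induction n rule: less_induct)
    case (less n)
    show ?case
    proof (cases n)
      case (Suc m)
      have "of_nat (Suc m) * fps_nth F (Suc m) = fps_nth (Q * F) m" by (metis assms(1) fps_deriv_nth Suc_eq_plus1)
      also have "\<dots> = fps_nth (Q * G) m"
        unfolding fps_mult_nth using less Suc by (intro sum.cong) auto
      also have "\<dots> = of_nat (Suc m) * fps_nth G (Suc m)" by (metis assms(2) fps_deriv_nth Suc_eq_plus1)
      finally show ?thesis using Suc by (simp del: of_nat_Suc)
    qed (use assms in simp)
  qed
qed

text \<open>In the variable t = z - 1, the probability generating function of a Poisson variable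
  with mean c plus independent Bernoulli variables with parameters ls.\<close>

definition bp_series :: "'a :: field_char_0 \<Rightarrow> 'a list \<Rightarrow> 'a fps" where
  "bp_series c ls = fps_exp c * (\<Prod>l\<leftarrow>ls. 1 + fps_const l * fps_X)"

text \<open>The expansion of c plus the sum of l / (1 + l t). Its coefficients are signed power
  sums, corrected by c in degree 0.\<close>

definition bp_log_deriv :: "'a :: field_char_0 \<Rightarrow> 'a list \<Rightarrow> 'a fps" where
  "bp_log_deriv c ls = fps_const c + Abs_fps (\<lambda>s. (- 1) ^ s * (\<Sum>l\<leftarrow>ls. l ^ Suc s))"

lemma bp_log_deriv_Cons:
  "bp_log_deriv c (l # ls) = bp_log_deriv c ls + Abs_fps (\<lambda>s. (- 1) ^ s * l ^ Suc s)"
  by (rule fps_ext) (simp add: bp_log_deriv_def algebra_simps)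

lemma bp_factor_log_deriv:
  "(1 + fps_const l * fps_X) * Abs_fps (\<lambda>s. (- 1) ^ s * l ^ Suc s) = (fps_const l :: 'a :: field_char_0 fps)"
proof (rule fps_ext)
  fix n
  show "fps_nth ((1 + fps_const l * fps_X) * Abs_fps (\<lambda>s. (- 1) ^ s * l ^ Suc s)) n = fps_nth (fps_const l) n"
    by (cases n) (simp_all add: distrib_right mult.assoc)
qed

lemma bp_series_deriv: "fps_deriv (bp_series c ls) = bp_log_deriv c ls * bp_series c ls"
proof (induction ls)
  case Nil
  have "Abs_fps (\<lambda>s. 0 :: 'a) = 0" by (rule fps_ext) simp
  then show ?case by (simp add: bp_series_def bp_log_deriv_def)
next
  case (Cons l ls)
  define L where "L = 1 + fps_const l * fps_X"
  have S: "bp_series c (l # ls) = L * bp_series c ls"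
    by (simp add: bp_series_def L_def mult_ac)
  have "fps_deriv (bp_series c (l # ls)) = fps_const l * bp_series c ls + L * fps_deriv (bp_series c ls)"
    unfolding S by (simp add: L_def)
  also have "fps_const l = L * Abs_fps (\<lambda>s. (- 1) ^ s * l ^ Suc s)"
    unfolding L_def by (rule bp_factor_log_deriv[symmetric])
  finally show ?case unfolding Cons bp_log_deriv_Cons S by (simp add: algebra_simps)
qed

lemma bp_series_0: "fps_nth (bp_series c ls) 0 = 1"
  by (induction ls) (simp_all add: bp_series_def mult.left_commute[of "fps_exp c"] fps_mult_nth_0)

text \<open>Newton's identities for the factorial moments say that their generating series \<open>G\<close> satisfies
  \<open>G' = P G\<close>, while \<open>bp_series\<close> satisfies \<open>H' = 2 P H\<close>; hence \<open>G\<^sup>2 = H\<close>.\<close>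

lemma fps_square_of_newton:
  fixes b p :: "nat \<Rightarrow> 'a :: field_char_0" and c :: 'a and ls :: "'a list"
  assumes b0: "b 0 = 1"
    and rec: "\<And>k. b (Suc k) = (\<Sum>s\<le>k. (- 1) ^ s * (fact k / fact (k - s)) * p (Suc s) * b (k - s))"
    and p1: "2 * p 1 = c + sum_list ls" and ps: "\<And>s. s \<ge> 2 \<Longrightarrow> 2 * p s = (\<Sum>l\<leftarrow>ls. l ^ s)"
  shows "(Abs_fps (\<lambda>k. b k / fact k))\<^sup>2 = bp_series c ls"
proof -
  define G where "G = Abs_fps (\<lambda>k. b k / fact k)"
  define P where "P = Abs_fps (\<lambda>s. (- 1) ^ s * p (Suc s))"
  have "fps_deriv G = P * G"
  proof (rule fps_ext)
    fix k
    have "fps_nth (fps_deriv G) k = b (Suc k) / fact k"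
      by (simp add: G_def field_simps del: of_nat_Suc)
    also have "\<dots> = (\<Sum>s\<le>k. (- 1) ^ s * p (Suc s) * (b (k - s) / fact (k - s)))"
      unfolding rec sum_divide_distrib by (intro sum.cong) (auto simp: field_simps)
    also have "\<dots> = fps_nth (P * G) k"
      by (simp add: fps_mult_nth P_def G_def atLeast0AtMost)
    finally show "fps_nth (fps_deriv G) k = fps_nth (P * G) k" .
  qed
  then have "fps_deriv (G\<^sup>2) = (2 * P) * G\<^sup>2" by (simp add: power2_eq_square algebra_simps)
  also have "2 * P = bp_log_deriv c ls"
  proof (rule fps_ext)
    fix s
    have "fps_nth (2 * P) s = (- 1) ^ s * (2 * p (Suc s))"
      by (simp add: P_def numeral_fps_const)
    also have "\<dots> = fps_nth (bp_log_deriv c ls) s"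
    proof (cases s)
      case 0
      then show ?thesis using p1 by (simp add: bp_log_deriv_def)
    next
      case (Suc t)
      have "2 * p (Suc s) = (\<Sum>l\<leftarrow>ls. l ^ Suc s)" by (rule ps) (simp add: Suc)
      then show ?thesis by (simp add: bp_log_deriv_def Suc)
    qed
    finally show "fps_nth (2 * P) s = fps_nth (bp_log_deriv c ls) s" .
  qed
  finally have "G\<^sup>2 = bp_series c ls"
    by (rule fps_deriv_unique[OF _ bp_series_deriv]) (simp add: bp_series_0 G_def b0 power2_eq_square fps_mult_nth_0)
  then show ?thesis by (simp add: G_def)
qed

section \<open>Analytic evaluation of the generating series\<close>

lemma bp_series_conv_radius: "fps_conv_radius (bp_series c ls) = (\<infinity> :: ereal)" for c :: complex
proof (induction ls)
  case (Cons l ls)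
  have S: "bp_series c (l # ls) = (1 + fps_const l * fps_X) * bp_series c ls"
    by (simp add: bp_series_def mult_ac)
  have "fps_conv_radius (1 + fps_const l * fps_X :: complex fps) = \<infinity>"
  proof -
    have "fps_conv_radius (fps_const l * fps_X :: complex fps) = \<infinity>"
      using fps_conv_radius_mult[of "fps_const l" "fps_X :: complex fps"] by simp
    then show ?thesis
      using fps_conv_radius_add[of 1 "fps_const l * fps_X :: complex fps"] by simp
  qed
  then show ?case unfolding S
    using fps_conv_radius_mult[of "1 + fps_const l * fps_X" "bp_series c ls"] Cons by simp
qed (simp add: bp_series_def)

lemma bp_series_eval: "eval_fps (bp_series c ls) t = exp (c * t) * (\<Prod>l\<leftarrow>ls. 1 + l * t)" for t c :: complex
proof (induction ls)
  case (Cons l ls)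
  have S: "bp_series c (l # ls) = bp_series c ls + fps_const l * (fps_X * bp_series c ls)"
    by (simp add: bp_series_def algebra_simps)
  have r: "fps_conv_radius (fps_X * bp_series c ls) = \<infinity>"
    using fps_conv_radius_mult[of "fps_X" "bp_series c ls"] bp_series_conv_radius[of c ls] by simp
  have r': "fps_conv_radius (fps_const l * (fps_X * bp_series c ls)) = \<infinity>"
    using fps_conv_radius_mult[of "fps_const l" "fps_X * bp_series c ls"] r by simp
  have "eval_fps (bp_series c (l # ls)) t = eval_fps (bp_series c ls) t + l * (t * eval_fps (bp_series c ls) t)"
    unfolding S using r r' bp_series_conv_radius[of c ls]
    by (simp add: eval_fps_add eval_fps_mult)
  then show ?case by (simp add: Cons algebra_simps)
qed (simp add: bp_series_def eval_fps_exp)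

text \<open>The identity of formal series must become one of functions. The coefficients g k are
  nonnegative, so \<open>(g k)\<^sup>2\<close> is one term of the sum that forms the coefficient of
  degree 2 k of the square H. As H is entire, g decays faster than any geometric sequence, so that G
  is entire too and summation may be exchanged with expectation.\<close>

lemma newton_bernoulli_poisson:
  fixes M :: "'b measure" and n :: "'b \<Rightarrow> nat" and b p :: "nat \<Rightarrow> real" and c :: real and ls :: "real list"
  assumes M: "prob_space M" and n[measurable]: "n \<in> measurable M (count_space UNIV)"
    and int: "\<And>k. integrable M (\<lambda>x. real (n x choose k))"
    and b: "\<And>k. b k = fact k * (LINT x|M. real (n x choose k))"
    and rec: "\<And>k. b (Suc k) = (\<Sum>s\<le>k. (- 1) ^ s * (fact k / fact (k - s)) * p (Suc s) * b (k - s))"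
    and p1: "2 * p 1 = c + sum_list ls" and ps: "\<And>s. s \<ge> 2 \<Longrightarrow> 2 * p s = (\<Sum>l\<leftarrow>ls. l ^ s)"
    and ls: "set ls \<subseteq> {0..1}"
  shows "0 \<le> c"
    and "(char (distr M borel (\<lambda>x. real (n x))) u)\<^sup>2 =
           exp (c * (iexp u - 1)) * (\<Prod>l\<leftarrow>ls. 1 + complex_of_real l * (iexp u - 1))"
    and "2 * prob_space.expectation M (\<lambda>x. real (n x)) = c + sum_list ls"
    and "2 * prob_space.variance M (\<lambda>x. real (n x)) = c + (\<Sum>l\<leftarrow>ls. l * (1 - l))"
proof -
  interpret prob_space M by (rule M)
  define g where "g k = (LINT x|M. real (n x choose k))" for k
  have bg: "b k / fact k = g k" for k by (simp add: b g_def)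
  have g0: "0 \<le> g k" for k by (simp add: g_def)
  have b0: "b 0 = 1" by (simp add: b prob_space)
  define G where "G = Abs_fps (\<lambda>k. complex_of_real (g k))"
  define H where "H = bp_series (complex_of_real c) (map complex_of_real ls)"
  have "(Abs_fps (\<lambda>k. complex_of_real (b k) / fact k))\<^sup>2 = H"
    unfolding H_def
  proof (rule fps_square_of_newton[where p = "\<lambda>s. complex_of_real (p s)"])
    show "complex_of_real (b (Suc k)) = (\<Sum>s\<le>k. (- 1) ^ s * (fact k / fact (k - s)) * complex_of_real (p (Suc s)) * complex_of_real (b (k - s)))" for k
      by (simp add: rec)
    have "complex_of_real (2 * p 1) = complex_of_real (c + sum_list ls)" by (simp only: p1)
    also have "\<dots> = complex_of_real c + sum_list (map complex_of_real ls)"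
      by (induction ls) auto
    finally show "2 * complex_of_real (p 1) = complex_of_real c + sum_list (map complex_of_real ls)" by simp
    fix s :: nat assume "s \<ge> 2"
    then have "complex_of_real (2 * p s) = complex_of_real (\<Sum>l\<leftarrow>ls. l ^ s)" by (simp only: ps)
    also have "\<dots> = (\<Sum>l\<leftarrow>map complex_of_real ls. l ^ s)" by (induction ls) auto
    finally show "2 * complex_of_real (p s) = (\<Sum>l\<leftarrow>map complex_of_real ls. l ^ s)" by simp
  qed (simp add: b0)
  also have "Abs_fps (\<lambda>k. complex_of_real (b k) / fact k) = G"
    unfolding G_def bg[symmetric] by simp
  finally have GH: "G\<^sup>2 = H" .
  have summable_g: "summable (\<lambda>k. g k * r ^ k)" if "r > 0" for r :: real
  proof -
    \<comment> \<open>Convergence at 2 r instead of r leaves a factor \<open>(1 / 2) ^ k\<close>,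
      which makes the bounded terms summable.\<close>
    have "summable (\<lambda>k. fps_nth H k * complex_of_real (2 * r) ^ k)"
      by (rule summable_fps) (simp add: H_def bp_series_conv_radius)
    then have "Bseq (\<lambda>k. fps_nth H k * complex_of_real (2 * r) ^ k)"
      using summable_LIMSEQ_zero convergentI convergent_imp_Bseq by blast
    then obtain C where C: "C > 0" "\<And>k. norm (fps_nth H k * complex_of_real (2 * r) ^ k) \<le> C"
      by (auto simp: Bseq_def)
    show ?thesis
    proof (rule summable_comparison_test')
      show "summable (\<lambda>k. sqrt C * (1 / 2) ^ k)" by (intro summable_mult summable_geometric) simp
      fix k
      have "(g k)\<^sup>2 \<le> (\<Sum>i=0..2 * k. g i * g (2 * k - i))"
        using member_le_sum[of k "{0..2 * k}" "\<lambda>i. g i * g (2 * k - i)"] g0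
        by (simp add: power2_eq_square mult_2)
      also have "\<dots> = norm (complex_of_real (\<Sum>i=0..2 * k. g i * g (2 * k - i)))"
        using g0 by (simp only: norm_of_real) (simp add: sum_nonneg)
      also have "complex_of_real (\<Sum>i=0..2 * k. g i * g (2 * k - i)) = fps_nth H (2 * k)"
        unfolding GH[symmetric] by (simp add: power2_eq_square fps_mult_nth G_def)
      finally have "(g k)\<^sup>2 * (2 * r) ^ (2 * k) \<le> norm (fps_nth H (2 * k)) * (2 * r) ^ (2 * k)"
        using that by (intro mult_right_mono) auto
      also have "\<dots> \<le> C" using C(2)[of "2 * k"] that by (simp add: norm_mult norm_power)
      finally have "(g k * (2 * r) ^ k)\<^sup>2 \<le> C" by (simp add: power_mult_distrib power_mult[symmetric] mult.commute)
      then have "g k * (2 * r) ^ k \<le> sqrt C" by (rule real_le_rsqrt)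
      then have "g k * (2 * r) ^ k * (1 / 2) ^ k \<le> sqrt C * (1 / 2) ^ k" by (intro mult_right_mono) auto
      also have "g k * (2 * r) ^ k * (1 / 2) ^ k = g k * r ^ k" by (simp add: power_mult_distrib power_divide)
      finally show "norm (g k * r ^ k) \<le> sqrt C * (1 / 2) ^ k" using g0 that by simp
    qed
  qed
  have conv: "summable (\<lambda>k. fps_nth G k * t ^ k)" and radius: "fps_conv_radius G = \<infinity>" for t
  proof -
    have *: "summable (\<lambda>k. norm (fps_nth G k * t ^ k))" for t
    proof -
      have "summable (\<lambda>k. g k * (norm t + 1) ^ k)" by (rule summable_g) (simp add: add_nonneg_pos)
      then show ?thesis
        by (rule summable_comparison_test'[where N = 0]) (auto simp: G_def norm_mult norm_power g0 intro!: mult_left_mono power_mono)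
    qed
    then show "summable (\<lambda>k. fps_nth G k * t ^ k)" by (rule summable_norm_cancel)
    show "fps_conv_radius G = \<infinity>"
      unfolding fps_conv_radius_def
      using * by (intro conv_radius_inftyI'') (rule summable_norm_cancel)
  qed
  have pgf: "(LINT x|M. (1 + t) ^ n x) = eval_fps G t" for t :: complex
  proof -
    have exp: "(1 + t) ^ n x = (\<Sum>k. of_nat (n x choose k) * t ^ k)"
      and sm: "summable (\<lambda>k. norm (of_nat (n x choose k) * t ^ k))" for x
    proof -
      have "(1 + t) ^ n x = (\<Sum>k\<le>n x. of_nat (n x choose k) * t ^ k)"
        using binomial_ring[of t 1 "n x"] by (simp add: add.commute)
      also have "\<dots> = (\<Sum>k. of_nat (n x choose k) * t ^ k)"
        by (rule suminf_finite[symmetric]) auto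
      finally show "(1 + t) ^ n x = (\<Sum>k. of_nat (n x choose k) * t ^ k)" .
      show "summable (\<lambda>k. norm (of_nat (n x choose k) * t ^ k))"
        by (rule summable_finite[where N = "{..n x}"]) auto
    qed
    have I: "integrable M (\<lambda>x. of_nat (n x choose k) * t ^ k)" for k
    proof -
      have "integrable M (\<lambda>x. complex_of_real (real (n x choose k)) * t ^ k)"
        by (intro integrable_mult_left integrable_of_real int)
      then show ?thesis by simp
    qed
    have "(LINT x|M. (1 + t) ^ n x) = (LINT x|M. (\<Sum>k. of_nat (n x choose k) * t ^ k))"
      by (simp only: exp)
    also have "\<dots> = (\<Sum>k. LINT x|M. of_nat (n x choose k) * t ^ k)"
    proof (rule integral_suminf[OF I])
      show "AE x in M. summable (\<lambda>k. norm (of_nat (n x choose k) * t ^ k))" using sm by simp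
      have "(LINT x|M. norm (of_nat (n x choose k) * t ^ k)) = g k * norm t ^ k" for k
        by (simp add: norm_mult norm_power g_def)
      moreover have "summable (\<lambda>k. g k * norm t ^ k)"
      proof (cases "t = 0")
        case True
        then show ?thesis by (intro summable_finite[where N = "{0}"]) auto
      qed (use summable_g in auto)
      ultimately show "summable (\<lambda>k. LINT x|M. norm (of_nat (n x choose k) * t ^ k))" by simp
    qed
    also have "(\<lambda>k. LINT x|M. of_nat (n x choose k) * t ^ k) = (\<lambda>k. fps_nth G k * t ^ k)"
    proof
      fix k
      have "(LINT x|M. of_nat (n x choose k) * t ^ k) = (LINT x|M. complex_of_real (real (n x choose k))) * t ^ k"
        by (subst integral_mult_left_zero[symmetric]) simp
      also have "(LINT x|M. complex_of_real (real (n x choose k))) = complex_of_real (g k)"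
        unfolding g_def by (rule integral_complex_of_real)
      finally show "(LINT x|M. of_nat (n x choose k) * t ^ k) = fps_nth G k * t ^ k" by (simp add: G_def)
    qed
    finally show ?thesis by (simp add: eval_fps_def)
  qed
  have square: "(LINT x|M. (1 + t) ^ n x)\<^sup>2 = exp (c * t) * (\<Prod>l\<leftarrow>ls. 1 + complex_of_real l * t)" for t :: complex
  proof -
    have "(LINT x|M. (1 + t) ^ n x)\<^sup>2 = eval_fps (G\<^sup>2) t"
      unfolding pgf power2_eq_square by (simp add: eval_fps_mult radius)
    then show ?thesis by (simp add: GH H_def bp_series_eval comp_def)
  qed
  show "0 \<le> c"
  proof (rule ccontr)
    assume "\<not> 0 \<le> c"
    then have c: "c < 0" by simp
    \<comment> \<open>Since the parameters are at most 1, the product is at most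
      \<open>(1 + t) ^ m\<close>. For c < 0 the exponential would make the right side tend to 0,
      while the left side is at least its term of degree 0, which is 1.\<close>
    define m where "m = length ls"
    have le: "1 \<le> exp (c * t) * (1 + t) ^ m" if "t \<ge> 0" for t :: real
    proof -
      have "(LINT x|M. (1 + complex_of_real t) ^ n x) = complex_of_real (\<Sum>k. g k * t ^ k)"
        unfolding pgf eval_fps_def G_def using that summable_g[of t]
        by (cases "t = 0") (auto simp: suminf_of_real[symmetric] simp flip: of_real_power of_real_mult)
      moreover have "complex_of_real (\<Prod>l\<leftarrow>ls. 1 + l * t) = (\<Prod>l\<leftarrow>ls. 1 + complex_of_real l * complex_of_real t)"
        by (induction ls) auto
      ultimately have "complex_of_real ((\<Sum>k. g k * t ^ k)\<^sup>2) = complex_of_real (exp (c * t) * (\<Prod>l\<leftarrow>ls. 1 + l * t))"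
        using square[of "complex_of_real t"] by (simp add: exp_of_real[symmetric])
      then have eq: "(\<Sum>k. g k * t ^ k)\<^sup>2 = exp (c * t) * (\<Prod>l\<leftarrow>ls. 1 + l * t)" by (simp only: of_real_eq_iff)
      have "summable (\<lambda>k. g k * t ^ k)"
      proof (cases "t = 0")
        case True
        then show ?thesis by (intro summable_finite[where N = "{0}"]) auto
      qed (use summable_g that in auto)
      then have "(\<Sum>k\<in>{0}. g k * t ^ k) \<le> (\<Sum>k. g k * t ^ k)"
        by (rule sum_le_suminf) (use g0 that in auto)
      then have "1 \<le> (\<Sum>k. g k * t ^ k)" by (simp add: g_def prob_space)
      then have "1 \<le> exp (c * t) * (\<Prod>l\<leftarrow>ls. 1 + l * t)" unfolding eq[symmetric] by (simp add: one_le_power)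
      also have "(\<Prod>l\<leftarrow>ls. 1 + l * t) \<le> (1 + t) ^ m \<and> 0 \<le> (\<Prod>l\<leftarrow>ls. 1 + l * t)"
        using ls unfolding m_def
      proof (induction ls)
        case (Cons l ls)
        then show ?case using that by (auto intro!: mult_mono simp: mult_left_le_one_le)
      qed simp
      then have "exp (c * t) * (\<Prod>l\<leftarrow>ls. 1 + l * t) \<le> exp (c * t) * (1 + t) ^ m"
        by (intro mult_left_mono) auto
      finally show ?thesis .
    qed
    have "((\<lambda>y. (2 / (- c)) ^ m * (y ^ m / exp y)) \<longlongrightarrow> (2 / (- c)) ^ m * 0) at_top"
      by (intro tendsto_intros tendsto_power_div_exp_0)
    then have "\<forall>\<^sub>F y in at_top. (2 / (- c)) ^ m * (y ^ m / exp y) < 1"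
      by (rule Topological_Spaces.order_tendstoD) simp
    \<comment> \<open>The lower bound on y gives t at least 1 below, so that 1 + t is at most 2
      t.\<close>
    then obtain y where y: "y \<ge> - c" "(2 / (- c)) ^ m * (y ^ m / exp y) < 1"
      using eventually_conj[OF _ eventually_ge_at_top[of "- c"]] eventually_happens by fastforce
    define t where "t = y / (- c)"
    have t: "1 \<le> t" using y c by (simp add: t_def field_simps)
    have "1 \<le> exp (c * t) * (1 + t) ^ m" by (rule le) (use t in simp)
    also have "\<dots> \<le> exp (c * t) * (2 * t) ^ m"
      using t by (intro mult_left_mono power_mono) auto
    also have "\<dots> = (2 / (- c)) ^ m * (y ^ m / exp y)"
    proof -
      have "exp (c * t) = 1 / exp y" using c by (simp add: t_def exp_minus field_simps)
      moreover have "2 * t = 2 / (- c) * y" by (simp add: t_def)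
      ultimately show ?thesis by (simp only: power_mult_distrib) simp
    qed
    finally show False using y(2) by simp
  qed
  show "(char (distr M borel (\<lambda>x. real (n x))) u)\<^sup>2 =
           exp (c * (iexp u - 1)) * (\<Prod>l\<leftarrow>ls. 1 + complex_of_real l * (iexp u - 1))"
  proof -
    have "char (distr M borel (\<lambda>x. real (n x))) u = (LINT x|M. iexp (u * real (n x)))"
      unfolding char_def by (rule integral_distr) auto
    also have "\<dots> = (LINT x|M. (1 + (iexp u - 1)) ^ n x)"
      by (simp add: exp_of_nat_mult[symmetric] mult_ac)
    finally show ?thesis using square[of "iexp u - 1"] by simp
  qed
  \<comment> \<open>The first two Newton identities; they make the mean p 1 and the variance p 1 - p
    2.\<close>
  have b1: "b 1 = p 1" using rec[of 0] b0 by simp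
  have b2: "b 2 = (p 1)\<^sup>2 - p 2" using rec[of 1] b0 b1 by (simp add: numeral_2_eq_2 power2_eq_square)
  have E: "expectation (\<lambda>x. real (n x)) = p 1" using b[of 1] b1 by simp
  show "2 * expectation (\<lambda>x. real (n x)) = c + sum_list ls" using E p1 by simp
  have sq: "(real k)\<^sup>2 = 2 * real (k choose 2) + real (k choose 1)" for k
    using choose_two[of k] by (cases k) (auto simp: power2_eq_square algebra_simps real_of_nat_div)
  have "integrable M (\<lambda>x. (real (n x))\<^sup>2)"
    unfolding sq by (intro Bochner_Integration.integrable_add integrable_mult_right int)
  moreover have "integrable M (\<lambda>x. real (n x))" using int[of 1] by simp
  ultimately have "variance (\<lambda>x. real (n x)) = expectation (\<lambda>x. (real (n x))\<^sup>2) - (p 1)\<^sup>2"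
    by (subst variance_eq) (auto simp: E)
  also have "expectation (\<lambda>x. (real (n x))\<^sup>2) = 2 * expectation (\<lambda>x. real (n x choose 2)) + expectation (\<lambda>x. real (n x choose 1))"
    unfolding sq using int by (subst Bochner_Integration.integral_add) (simp_all only: integrable_mult_right Bochner_Integration.integral_mult_right simp_thms not_False_eq_True)
  also have "2 * expectation (\<lambda>x. real (n x choose 2)) = b 2" by (simp add: b numeral_2_eq_2)
  also have "expectation (\<lambda>x. real (n x choose 1)) = b 1" by (simp add: b)
  finally have "2 * variance (\<lambda>x. real (n x)) = 2 * p 1 - 2 * p 2" using b1 b2 by simp
  also have "\<dots> = c + (sum_list ls - (\<Sum>l\<leftarrow>ls. l ^ 2))" using p1 ps[of 2] by simp
  also have "sum_list ls - (\<Sum>l\<leftarrow>ls. l ^ 2) = (\<Sum>l\<leftarrow>ls. l * (1 - l))"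
    by (induction ls) (auto simp: power2_eq_square algebra_simps)
  finally show "2 * variance (\<lambda>x. real (n x)) = c + (\<Sum>l\<leftarrow>ls. l * (1 - l))" .
qed

section \<open>Expansion of the Moore-Dyson determinant along a cycle\<close>

definition maxima_on :: "nat set \<Rightarrow> (nat \<Rightarrow> nat) \<Rightarrow> nat set" where
  "maxima_on S \<sigma> = {a \<in> S. \<forall>b\<in>orbit \<sigma> a. b \<le> a}"

text \<open>Deleting a cycle from an initial segment leaves an arbitrary finite set, so the
  recursion needs determinants over such index sets.\<close>

definition det_MD_on :: "nat set \<Rightarrow> (nat \<Rightarrow> nat \<Rightarrow> cquat) \<Rightarrow> cquat" where
  "det_MD_on S X =
     (\<Sum>\<sigma> | \<sigma> permutes S.
        (- 1) ^ (card S - card (maxima_on S \<sigma>)) *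
        prod_list (map (cycle_product X \<sigma>) (rev (sorted_list_of_set (maxima_on S \<sigma>)))))"

text \<open>For \<open>a = b = m\<close> this is the factor of the cycle \<open>m # xs\<close>.
  Keeping the two end points apart lets inductions move the start along the list.\<close>

fun walk :: "('a \<Rightarrow> 'a \<Rightarrow> 'b :: monoid_mult) \<Rightarrow> 'a \<Rightarrow> 'a list \<Rightarrow> 'a \<Rightarrow> 'b" where
  "walk X a [] b = X a b"
| "walk X a (x # xs) b = X a x * walk X x xs b"

text \<open>With the largest element of a cycle written in front, such lists of further points
  describe every cycle exactly once.\<close>

definition path_lists :: "'a set \<Rightarrow> 'a list set" where
  "path_lists A = {xs. distinct xs \<and> set xs \<subseteq> A}"

lemma finite_path_lists: "finite A \<Longrightarrow> finite (path_lists A)"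
  using finite_subset_distinct[of A] by (simp add: path_lists_def conj_commute)

lemma det_MD_eq_on: "det_MD n X = det_MD_on {..<n} X"
  by (simp add: det_MD_def det_MD_on_def cycle_maxima_def maxima_on_def)

lemma walk_eq_prod_list:
  "walk X a xs b = prod_list (map (\<lambda>k. X ((a # xs) ! k) ((xs @ [b]) ! k)) [0..<Suc (length xs)])"
proof (induction xs arbitrary: a)
  case (Cons x xs)
  have "[0..<Suc (length (x # xs))] = 0 # map Suc [0..<Suc (length xs)]"
    by (simp add: map_Suc_upt upt_conv_Cons del: upt_Suc)
  then show ?case by (simp only: walk.simps Cons) (simp add: comp_def)
qed simp

lemma walk_map: "walk X (f a) (map f xs) (f b) = walk (\<lambda>i j. X (f i) (f j)) a xs b"
  by (induction xs arbitrary: a) auto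

lemma cycle_of_list_nth:
  assumes "distinct cs" "k < length cs"
  shows "cycle_of_list cs (cs ! k) = cs ! (Suc k mod length cs)"
proof -
  have "map (cycle_of_list cs) cs = rotate1 cs" using cyclic_rotation[OF assms(1), of 1] by simp
  then show ?thesis using assms(2) by (metis nth_map nth_rotate1)
qed

text \<open>A permutation of \<open>S\<close> is determined by the cycle \<open>m # xs\<close> through its largest element and a permutation
  \<open>\<tau>\<close> of the other points.\<close>

context
  fixes m :: nat and xs :: "nat list" and S :: "nat set" and \<tau> \<sigma> :: "nat \<Rightarrow> nat"
  assumes fin: "finite S" and m: "m \<in> S" "\<And>a. a \<in> S \<Longrightarrow> a \<le> m" and xs: "xs \<in> path_lists (S - {m})"
    and \<tau>: "\<tau> permutes (S - insert m (set xs))"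
    and \<sigma>_def: "\<sigma> = cycle_of_list (m # xs) \<circ> \<tau>"
begin

lemma adjoin_dist: "distinct (m # xs)" and adjoin_sub: "set (m # xs) \<subseteq> S"
  using xs m(1) by (auto simp: path_lists_def)

lemma adjoin_permutes: "\<sigma> permutes S"
  unfolding \<sigma>_def using adjoin_sub
  by (intro permutes_compose permutes_subset[OF \<tau>] permutes_subset[OF cycle_permutes]) auto

lemma adjoin_permutation: "permutation \<sigma>"
  using adjoin_permutes fin by (auto simp: permutation_permutes)

lemma adjoin_rest: "x \<notin> set (m # xs) \<Longrightarrow> \<sigma> x = \<tau> x"
  using permutes_in_image[OF \<tau>, of x] permutes_not_in[OF \<tau>, of x]
  by (auto simp: \<sigma>_def id_outside_supp)

lemma adjoin_funpow: "k \<le> length xs \<Longrightarrow> (\<sigma> ^^ k) m = (m # xs) ! k"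
proof (induction k)
  case (Suc k)
  then have *: "(m # xs) ! k \<in> set (m # xs)" by (intro nth_mem) auto
  have "(\<sigma> ^^ Suc k) m = \<sigma> ((m # xs) ! k)" using Suc by simp
  also have "\<dots> = cycle_of_list (m # xs) ((m # xs) ! k)"
    using * permutes_not_in[OF \<tau>, of "(m # xs) ! k"] by (simp add: \<sigma>_def)
  also have "\<dots> = (m # xs) ! Suc k"
    using cycle_of_list_nth[OF adjoin_dist, of k] Suc.prems by simp
  finally show ?case .
qed simp

lemma adjoin_funpow_length: "(\<sigma> ^^ Suc (length xs)) m = m"
proof -
  have *: "(m # xs) ! length xs \<in> set (m # xs)" by (intro nth_mem) auto
  have "(\<sigma> ^^ Suc (length xs)) m = \<sigma> ((m # xs) ! length xs)" using adjoin_funpow[of "length xs"] by simp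
  also have "\<dots> = cycle_of_list (m # xs) ((m # xs) ! length xs)"
    using * permutes_not_in[OF \<tau>, of "(m # xs) ! length xs"] by (simp add: \<sigma>_def)
  also have "\<dots> = m"
    using cycle_of_list_nth[OF adjoin_dist, of "length xs"] by simp
  finally show ?thesis .
qed

lemma adjoin_orbit: "orbit \<sigma> m = set (m # xs)"
proof -
  have "orbit \<sigma> m = {(\<sigma> ^^ k) m | k. k < Suc (length xs)}"
    using orbit_altdef_bounded[OF adjoin_funpow_length] by simp
  also have "\<dots> = {(m # xs) ! k | k. k < Suc (length xs)}"
    using adjoin_funpow by (metis less_Suc_eq_le)
  also have "\<dots> = set (m # xs)" by (simp add: set_conv_nth)
  finally show ?thesis .
qed

lemma adjoin_card_orbit: "card (orbit \<sigma> m) = Suc (length xs)"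
  unfolding adjoin_orbit using distinct_card[OF adjoin_dist] by simp

lemma adjoin_orbit_rest:
  assumes "a \<in> S - insert m (set xs)"
  shows "orbit \<sigma> a = orbit \<tau> a"
proof (rule orbit_cong)
  have "permutation \<tau>" using \<tau> fin by (auto simp: permutation_permutes)
  then show "a \<in> orbit \<tau> a" by (rule permutation_self_in_orbit)
  fix s assume "s \<in> orbit \<tau> a"
  then have "s \<in> S - insert m (set xs)" using permutes_orbit_subset[OF \<tau> assms] by auto
  then show "\<sigma> s = \<tau> s" by (intro adjoin_rest) auto
qed

text \<open>Every point of the new cycle has m in its orbit, so m is the only maximum there; the
  other orbits are those of \<open>\<tau>\<close>.\<close>

lemma adjoin_maxima: "maxima_on S \<sigma> = insert m (maxima_on (S - insert m (set xs)) \<tau>)"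
proof (intro Set.set_eqI iffI)
  fix a assume a: "a \<in> maxima_on S \<sigma>"
  show "a \<in> insert m (maxima_on (S - insert m (set xs)) \<tau>)"
  proof (cases "a \<in> set (m # xs)")
    case True
    then have "m \<in> orbit \<sigma> a"
      using adjoin_orbit by (metis adjoin_permutation orbit_swap permutation_self_in_orbit)
    then have "m \<le> a" using a by (auto simp: maxima_on_def)
    then have "a = m" using a m by (simp add: maxima_on_def order_antisym)
    then show ?thesis by simp
  next
    case False
    then show ?thesis using a adjoin_orbit_rest[of a] by (auto simp: maxima_on_def)
  qed
next
  fix a assume "a \<in> insert m (maxima_on (S - insert m (set xs)) \<tau>)"
  then show "a \<in> maxima_on S \<sigma>"
    using adjoin_orbit_rest[of a] adjoin_orbit adjoin_sub m by (auto simp: maxima_on_def)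
qed

lemma adjoin_cycle_product_max: "cycle_product X \<sigma> m = walk X m xs m"
  unfolding walk_eq_prod_list cycle_product_def adjoin_card_orbit
proof (intro arg_cong[of _ _ prod_list] map_cong refl)
  fix k assume "k \<in> set [0..<Suc (length xs)]"
  then have k: "k \<le> length xs" by auto
  show "X ((\<sigma> ^^ k) m) ((\<sigma> ^^ Suc k) m) = X ((m # xs) ! k) ((xs @ [m]) ! k)"
  proof (cases "k = length xs")
    case True
    then show ?thesis using adjoin_funpow[of k] adjoin_funpow_length by simp
  next
    case False
    then show ?thesis using adjoin_funpow[of k] adjoin_funpow[of "Suc k"] k by (simp add: nth_append)
  qed
qed

lemma adjoin_cycle_product_rest:
  assumes a: "a \<in> S - insert m (set xs)"
  shows "cycle_product X \<sigma> a = cycle_product X \<tau> a"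
proof -
  have "(\<tau> ^^ k) a \<in> S - insert m (set xs) \<and> (\<sigma> ^^ k) a = (\<tau> ^^ k) a" for k
  proof (induction k)
    case (Suc k)
    then show ?case using adjoin_rest[of "(\<tau> ^^ k) a"] permutes_in_image[OF \<tau>, of "(\<tau> ^^ k) a"] by auto
  qed (use a in auto)
  then show ?thesis
    using adjoin_orbit_rest[OF a] by (simp add: cycle_product_def del: funpow.simps)
qed

text \<open>The new cycle has \<open>Suc (length xs)\<close> points and one maximum, which changes
  the exponent of the sign by \<open>length xs\<close>. As m is the largest element, its cycle
  stands first in the noncommutative product.\<close>

lemma adjoin_term:
  "(- 1) ^ (card S - card (maxima_on S \<sigma>)) *
      prod_list (map (cycle_product X \<sigma>) (rev (sorted_list_of_set (maxima_on S \<sigma>)))) =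
   (- 1) ^ length xs * walk X m xs m *
     ((- 1) ^ (card (S - insert m (set xs)) - card (maxima_on (S - insert m (set xs)) \<tau>)) *
      prod_list (map (cycle_product X \<tau>) (rev (sorted_list_of_set (maxima_on (S - insert m (set xs)) \<tau>)))))"
proof -
  define S' where "S' = S - insert m (set xs)"
  define M where "M = maxima_on S' \<tau>"
  have M: "M \<subseteq> S'" by (auto simp: M_def maxima_on_def)
  have finM: "finite M" using M fin by (auto simp: S'_def intro: finite_subset)
  have mM: "m \<notin> M" using M by (auto simp: S'_def)
  have sl: "sorted_list_of_set (insert m M) = sorted_list_of_set M @ [m]"
  proof -
    have "sorted_wrt (<) (sorted_list_of_set M @ [m])"
      using finM mM M m(2) by (auto simp: sorted_wrt_append S'_def order_less_le)
    then show ?thesis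
      using sorted_list_of_set_unique[of "insert m M" "sorted_list_of_set M @ [m]"] finM mM by simp
  qed
  have "S = set (m # xs) \<union> S'" using adjoin_sub by (auto simp: S'_def)
  moreover have "card (set (m # xs) \<union> S') = card (set (m # xs)) + card S'"
    using fin by (intro card_Un_disjoint) (auto simp: S'_def)
  ultimately have "card S = Suc (length xs) + card S'" using distinct_card[OF adjoin_dist] by simp
  moreover have "card M \<le> card S'" using M fin by (intro card_mono) (auto simp: S'_def)
  ultimately have "card S - card (insert m M) = length xs + (card S' - card M)"
    using finM mM by simp
  moreover have "map (cycle_product X \<sigma>) (rev (sorted_list_of_set M)) = map (cycle_product X \<tau>) (rev (sorted_list_of_set M))"
    using M finM by (intro map_cong refl adjoin_cycle_product_rest) (auto simp: S'_def)
  \<comment> \<open>Signs are central, so the sign of the remaining permutation passes the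
    walk.\<close>
  moreover have "walk X m xs m * ((- 1) ^ d * p) = (- 1) ^ d * (walk X m xs m * p)" for d p
    by (simp add: minus_one_power_iff)
  ultimately show ?thesis
    using adjoin_maxima adjoin_cycle_product_max[of X]
    by (simp del: map_eq_conv add: S'_def[symmetric] M_def[symmetric] sl power_add mult.assoc)
qed

end

lemma det_MD_on_empty: "det_MD_on {} X = 1"
  by (simp add: det_MD_on_def maxima_on_def)

text \<open>The analogue of Laplace expansion, along a whole cycle: permutations of S correspond to
  pairs of a cycle through m and a permutation of the points off that cycle, with \<open>G\<close>
  and \<open>J\<close> inverse to each other.\<close>

lemma det_MD_on_rec:
  assumes fin: "finite S" and m: "m \<in> S" "\<And>a. a \<in> S \<Longrightarrow> a \<le> m"
  shows "det_MD_on S X =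
    (\<Sum>xs\<in>path_lists (S - {m}). (- 1) ^ length xs * walk X m xs m * det_MD_on (S - insert m (set xs)) X)"
proof -
  define G where "G = (\<lambda>(xs, \<tau>). cycle_of_list (m # xs) \<circ> (\<tau> :: nat \<Rightarrow> nat))"
  \<comment> \<open>The list starts at \<open>\<sigma> m\<close>, because m itself is kept
    apart.\<close>
  define J where "J \<sigma> = (map (\<lambda>k. (\<sigma> ^^ k) m) [1..<card (orbit \<sigma> m)], perm_restrict \<sigma> (S - orbit \<sigma> m))" for \<sigma> :: "nat \<Rightarrow> nat"
  define B where "B = Sigma (path_lists (S - {m})) (\<lambda>xs. {\<tau>. \<tau> permutes (S - insert m (set xs))})"
  define t where "t S \<sigma> = (- 1) ^ (card S - card (maxima_on S \<sigma>)) *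
        prod_list (map (cycle_product X \<sigma>) (rev (sorted_list_of_set (maxima_on S \<sigma>))))" for S \<sigma>
  have J: "J \<sigma> \<in> B \<and> G (J \<sigma>) = \<sigma>" if \<sigma>: "\<sigma> permutes S" for \<sigma>
  proof -
    define n where "n = card (orbit \<sigma> m)"
    define xs where "xs = map (\<lambda>k. (\<sigma> ^^ k) m) [1..<n]"
    define \<tau> where "\<tau> = perm_restrict \<sigma> (S - orbit \<sigma> m)"
    have perm: "permutation \<sigma>" using \<sigma> fin by (auto simp: permutation_permutes)
    have self: "m \<in> orbit \<sigma> m" by (rule permutation_self_in_orbit[OF perm])
    have orb: "orbit \<sigma> m = (\<lambda>k. (\<sigma> ^^ k) m) ` {0..<funpow_dist1 \<sigma> m m}"
      by (rule orbit_conv_funpow_dist1[OF self])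
    have inj: "inj_on (\<lambda>k. (\<sigma> ^^ k) m) {0..<funpow_dist1 \<sigma> m m}"
      by (rule inj_on_funpow_dist1[OF self])
    \<comment> \<open>The size of the orbit is the first return time to m, so the n listed points
      are distinct and close up to a cycle.\<close>
    have n: "n = funpow_dist1 \<sigma> m m" unfolding n_def orb using card_image[OF inj] by simp
    have closing: "(\<sigma> ^^ n) m = m" unfolding n by (rule funpow_dist1_prop[OF self])
    have npos: "n > 0" unfolding n by simp
    have mxs: "m # xs = map (\<lambda>k. (\<sigma> ^^ k) m) [0..<n]"
      using npos by (simp add: xs_def upt_conv_Cons)
    have dist: "distinct (m # xs)" unfolding mxs distinct_map using inj[folded n] by simp
    have set_mxs: "set (m # xs) = orbit \<sigma> m" unfolding mxs orb n[symmetric] by simp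
    have sub: "orbit \<sigma> m \<subseteq> S" by (rule permutes_orbit_subset[OF \<sigma> m(1)])
    have xs_in: "xs \<in> path_lists (S - {m})" using dist set_mxs sub by (auto simp: path_lists_def)
    \<comment> \<open>The orbit is invariant in both directions, so the permutation also preserves
      its complement.\<close>
    have closed: "\<sigma> x \<in> orbit \<sigma> m \<longleftrightarrow> x \<in> orbit \<sigma> m" for x
    proof
      assume "\<sigma> x \<in> orbit \<sigma> m"
      moreover have "x \<in> orbit \<sigma> (\<sigma> x)"
        unfolding permutation_orbit_step[OF perm] by (rule permutation_self_in_orbit[OF perm])
      ultimately show "x \<in> orbit \<sigma> m" by (rule orbit_trans[rotated])
    qed (rule orbit.step)
    have \<tau>: "\<tau> permutes (S - insert m (set xs))"
    proof -
      have inj: "inj_on \<sigma> (S - orbit \<sigma> m)" using permutes_inj[OF \<sigma>] by (rule inj_on_subset) simp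
      moreover have "\<sigma> ` (S - orbit \<sigma> m) = S - orbit \<sigma> m"
        using fin inj closed permutes_in_image[OF \<sigma>] by (intro endo_inj_surj) auto
      ultimately have "bij_betw \<sigma> (S - orbit \<sigma> m) (S - orbit \<sigma> m)" by (simp add: bij_betw_def)
      then have "bij_betw \<tau> (S - orbit \<sigma> m) (S - orbit \<sigma> m)"
        using bij_betw_cong[of "S - orbit \<sigma> m" \<tau> \<sigma>] by (simp add: \<tau>_def perm_restrict_def)
      then have "\<tau> permutes (S - orbit \<sigma> m)"
        by (rule bij_imp_permutes) (auto simp: \<tau>_def perm_restrict_def)
      then show ?thesis using set_mxs by simp
    qed
    have "cycle_of_list (m # xs) (\<tau> x) = \<sigma> x" for x
    proof (cases "x \<in> orbit \<sigma> m")
      case True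
      have len: "length (m # xs) = n" unfolding mxs by simp
      from True obtain k where k: "k < n" "x = (m # xs) ! k"
        unfolding set_mxs[symmetric] in_set_conv_nth len by blast
      have "\<tau> x = x" using True by (simp add: \<tau>_def perm_restrict_def)
      then have "cycle_of_list (m # xs) (\<tau> x) = (m # xs) ! (Suc k mod n)"
        using cycle_of_list_nth[OF dist, of k] k unfolding len by simp
      also have "\<dots> = (\<sigma> ^^ (Suc k mod n)) m" unfolding mxs using npos by simp
      also have "\<dots> = (\<sigma> ^^ Suc k) m" by (rule funpow_mod_eq[OF closing])
      also have "\<dots> = \<sigma> x" using k unfolding mxs by simp
      finally show ?thesis .
    next
      case False
      then have "\<tau> x = \<sigma> x" using permutes_not_in[OF \<sigma>, of x] by (auto simp: \<tau>_def perm_restrict_def)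
      moreover have "\<sigma> x \<notin> set (m # xs)" using False closed set_mxs by simp
      ultimately show ?thesis by (simp add: id_outside_supp)
    qed
    then show ?thesis using xs_in \<tau> by (auto simp: J_def G_def B_def xs_def \<tau>_def n_def)
  qed
  have G: "J (G z) = z \<and> G z permutes S \<and>
      t S (G z) = (case z of (xs, \<tau>) \<Rightarrow> (- 1) ^ length xs * walk X m xs m * t (S - insert m (set xs)) \<tau>)"
    if z: "z \<in> B" for z
  proof -
    obtain xs \<tau> where z_eq: "z = (xs, \<tau>)" by force
    have xs: "xs \<in> path_lists (S - {m})" and \<tau>: "\<tau> permutes (S - insert m (set xs))"
      using z by (auto simp: z_eq B_def)
    define \<sigma> where "\<sigma> = cycle_of_list (m # xs) \<circ> \<tau>"
    note facts = fin m xs \<tau> \<sigma>_def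
    have "map (\<lambda>k. (\<sigma> ^^ k) m) [1..<card (orbit \<sigma> m)] = xs"
    proof (rule nth_equalityI)
      show "length (map (\<lambda>k. (\<sigma> ^^ k) m) [1..<card (orbit \<sigma> m)]) = length xs"
        using adjoin_card_orbit[OF facts] by (simp del: upt_Suc)
      fix i assume "i < length (map (\<lambda>k. (\<sigma> ^^ k) m) [1..<card (orbit \<sigma> m)])"
      then have i: "i < length xs" using adjoin_card_orbit[OF facts] by (simp del: upt_Suc)
      then have "map (\<lambda>k. (\<sigma> ^^ k) m) [1..<card (orbit \<sigma> m)] ! i = (\<sigma> ^^ Suc i) m"
        using adjoin_card_orbit[OF facts] by (simp add: nth_upt del: upt_Suc)
      also have "\<dots> = xs ! i" using adjoin_funpow[OF facts, of "Suc i"] i by simp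
      finally show "map (\<lambda>k. (\<sigma> ^^ k) m) [1..<card (orbit \<sigma> m)] ! i = xs ! i" .
    qed
    moreover have "perm_restrict \<sigma> (S - orbit \<sigma> m) = \<tau>"
    proof
      fix x
      show "perm_restrict \<sigma> (S - orbit \<sigma> m) x = \<tau> x"
        using adjoin_rest[OF facts, of x] adjoin_orbit[OF facts] permutes_not_in[OF \<tau>, of x]
        by (auto simp: perm_restrict_def)
    qed
    ultimately have "J \<sigma> = (xs, \<tau>)" by (simp add: J_def)
    then show ?thesis
      using adjoin_permutes[OF facts] adjoin_term[OF facts, of X]
      by (simp add: z_eq G_def \<sigma>_def t_def del: cycle_of_list.simps)
  qed
  have "det_MD_on S X = (\<Sum>\<sigma> | \<sigma> permutes S. t S \<sigma>)" by (simp add: det_MD_on_def t_def)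
  also have "\<dots> = (\<Sum>(xs, \<tau>)\<in>B. (- 1) ^ length xs * walk X m xs m * t (S - insert m (set xs)) \<tau>)"
  proof (rule sum.reindex_bij_witness[where i = G and j = J])
    fix \<sigma> assume "\<sigma> \<in> {\<sigma>. \<sigma> permutes S}"
    then have "J \<sigma> \<in> B" "G (J \<sigma>) = \<sigma>" using J by auto
    with G[of "J \<sigma>"] show "(case J \<sigma> of (xs, \<tau>) \<Rightarrow> (- 1) ^ length xs * walk X m xs m * t (S - insert m (set xs)) \<tau>) = t S \<sigma>"
      by simp
  qed (use J G in auto)
  also have "\<dots> = (\<Sum>xs\<in>path_lists (S - {m}). \<Sum>\<tau> | \<tau> permutes (S - insert m (set xs)). (- 1) ^ length xs * walk X m xs m * t (S - insert m (set xs)) \<tau>)"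
    unfolding B_def using fin by (intro sum.Sigma[symmetric] finite_path_lists ballI finite_permutations) auto
  also have "\<dots> = (\<Sum>xs\<in>path_lists (S - {m}). (- 1) ^ length xs * walk X m xs m * det_MD_on (S - insert m (set xs)) X)"
    by (simp add: det_MD_on_def t_def sum_distrib_left)
  finally show ?thesis .
qed

text \<open>The determinant depends on the order of the indices, through the choice of the largest
  element of each cycle and the order of the factors. A strictly increasing relabelling preserves
  both; the cycle expansion reduces this to relabelling walks.\<close>

lemma det_MD_on_image:
  assumes "finite S" "strict_mono_on S f"
  shows "det_MD_on (f ` S) X = det_MD_on S (\<lambda>i j. X (f i) (f j))"
  using assms
proof (induction "card S" arbitrary: S rule: less_induct)
  case less
  show ?case
  proof (cases "S = {}")
    case False
    define m where "m = Max S"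
    have m: "m \<in> S" "\<And>a. a \<in> S \<Longrightarrow> a \<le> m" using False less.prems by (auto simp: m_def)
    have inj: "inj_on f S" by (rule strict_mono_on_imp_inj_on[OF less.prems(2)])
    have fm: "f m \<in> f ` S" "\<And>a. a \<in> f ` S \<Longrightarrow> a \<le> f m"
      using m strict_mono_onD[OF less.prems(2)] by (auto simp: order_le_less)
    have im: "f ` S - {f m} = f ` (S - {m})" using inj_on_image_set_diff[OF inj, of S "{m}"] m by auto
    have bij: "bij_betw (map f) (path_lists (S - {m})) (path_lists (f ` S - {f m}))"
    proof (rule bij_betw_imageI)
      show "inj_on (map f) (path_lists (S - {m}))"
        by (intro inj_on_mapI inj_on_subset[OF inj]) (auto simp: path_lists_def)
      show "map f ` path_lists (S - {m}) = path_lists (f ` S - {f m})"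
      proof (intro Set.set_eqI iffI)
        fix ys assume "ys \<in> map f ` path_lists (S - {m})"
        then show "ys \<in> path_lists (f ` S - {f m})"
          unfolding im by (force simp: path_lists_def distinct_map intro!: inj_on_subset[OF inj])
      next
        fix ys assume ys: "ys \<in> path_lists (f ` S - {f m})"
        then have "ys \<in> lists (f ` (S - {m}))" by (simp add: im path_lists_def lists_eq_set)
        then obtain xs where "set xs \<subseteq> S - {m}" "ys = map f xs"
          unfolding lists_image by (auto simp: lists_eq_set)
        with ys show "ys \<in> map f ` path_lists (S - {m})"
          by (auto simp: path_lists_def distinct_map)
      qed
    qed
    have "det_MD_on (f ` S) X = (\<Sum>ys\<in>path_lists (f ` S - {f m}). (- 1) ^ length ys * walk X (f m) ys (f m) * det_MD_on (f ` S - insert (f m) (set ys)) X)"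
      by (rule det_MD_on_rec) (use less.prems fm in auto)
    also have "\<dots> = (\<Sum>xs\<in>path_lists (S - {m}). (- 1) ^ length (map f xs) * walk X (f m) (map f xs) (f m) * det_MD_on (f ` S - insert (f m) (set (map f xs))) X)"
      by (rule sum.reindex_bij_betw[OF bij, symmetric])
    also have "\<dots> = (\<Sum>xs\<in>path_lists (S - {m}). (- 1) ^ length xs * walk (\<lambda>i j. X (f i) (f j)) m xs m * det_MD_on (S - insert m (set xs)) (\<lambda>i j. X (f i) (f j)))"
    proof (rule sum.cong[OF refl])
      fix xs assume xs: "xs \<in> path_lists (S - {m})"
      then have "f ` S - insert (f m) (set (map f xs)) = f ` (S - insert m (set xs))"
        using inj_on_image_set_diff[OF inj, of S "insert m (set xs)"] m by (auto simp: path_lists_def)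
      moreover have "det_MD_on (f ` (S - insert m (set xs))) X = det_MD_on (S - insert m (set xs)) (\<lambda>i j. X (f i) (f j))"
      proof (rule less.hyps)
        show "card (S - insert m (set xs)) < card S"
          using m less.prems by (intro psubset_card_mono) auto
      qed (use less.prems in \<open>auto intro: monotone_on_subset\<close>)
      ultimately show "(- 1) ^ length (map f xs) * walk X (f m) (map f xs) (f m) * det_MD_on (f ` S - insert (f m) (set (map f xs))) X =
          (- 1) ^ length xs * walk (\<lambda>i j. X (f i) (f j)) m xs m * det_MD_on (S - insert m (set xs)) (\<lambda>i j. X (f i) (f j))"
        by (simp only: length_map walk_map)
    qed
    also have "\<dots> = det_MD_on S (\<lambda>i j. X (f i) (f j))"
      by (rule det_MD_on_rec[symmetric]) (use less.prems m in auto)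
    finally show ?thesis .
  qed (simp add: det_MD_on_empty)
qed

section \<open>Finite-rank kernels\<close>

lemma indicator_mult_complex: "indicator S z * (w :: complex) = indicator S z *\<^sub>R w"
  by (simp add: indicator_def)

text \<open>The sets over which f integrates to 0 form a Dynkin system that contains the rectangles.
  Testing with the set where f is positive, for f and for -f, gives the claim.\<close>

lemma (in pair_sigma_finite) AE_zero_of_rectangles:
  fixes f :: "'a \<times> 'b \<Rightarrow> real"
  assumes f[simp]: "integrable (M1 \<Otimes>\<^sub>M M2) f"
    and zero: "\<And>A B. A \<in> sets M1 \<Longrightarrow> B \<in> sets M2 \<Longrightarrow> (LINT z|(M1 \<Otimes>\<^sub>M M2). indicator (A \<times> B) z * f z) = 0"
  shows "AE z in M1 \<Otimes>\<^sub>M M2. f z = 0"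
proof -
  let ?P = "M1 \<Otimes>\<^sub>M M2"
  have [measurable]: "f \<in> borel_measurable ?P" using f by (rule borel_measurable_integrable)
  have int: "integrable ?P (\<lambda>z. indicator C z * f z)" if "C \<in> sets ?P" for C
    using integrable_mult_indicator[OF that f] by simp
  have total: "(LINT z|?P. f z) = 0"
  proof -
    have "(LINT z|?P. indicator (space M1 \<times> space M2) z * f z) = (LINT z|?P. f z)"
      by (rule Bochner_Integration.integral_cong) (auto simp: space_pair_measure)
    then show ?thesis using zero[of "space M1" "space M2"] by simp
  qed
  have all: "(LINT z|?P. indicator C z * f z) = 0" if "C \<in> sets ?P" for C
    using that unfolding sets_pair_measure
  proof (induction rule: sigma_sets_induct_disjoint[OF Int_stable_pair_measure_generator pair_measure_closed, consumes 1, case_names basic empty compl union])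
    case (basic A)
    then show ?case using zero by auto
  next
    case (compl A)
    then have A: "A \<in> sets ?P" by (simp add: sets_pair_measure)
    have "(LINT z|?P. indicator (space M1 \<times> space M2 - A) z * f z) = (LINT z|?P. f z - indicator A z * f z)"
      by (rule Bochner_Integration.integral_cong) (auto simp: space_pair_measure indicator_def)
    also have "\<dots> = 0" using compl int[OF A] total by simp
    finally show ?case .
  next
    case (union A)
    then have A: "range A \<subseteq> sets ?P" by (auto simp: sets_pair_measure)
    have "(LINT z:(\<Union>i. A i)|?P. f z) = (\<Sum>i. (LINT z:(A i)|?P. f z))"
    proof (rule lebesgue_integral_countable_add)
      show "set_integrable ?P (\<Union>i. A i) f"
        unfolding set_integrable_def using int[of "\<Union>i. A i"] A by auto
    qed (use A union in \<open>auto simp: disjoint_family_on_def\<close>)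
    then show ?case using union by (simp add: set_lebesgue_integral_def)
  qed simp
  have le: "AE z in ?P. f z \<le> 0" if [measurable]: "f \<in> borel_measurable ?P" and int: "\<And>C. C \<in> sets ?P \<Longrightarrow> integrable ?P (\<lambda>z. indicator C z * f z)"
     and all: "\<And>C. C \<in> sets ?P \<Longrightarrow> (LINT z|?P. indicator C z * f z) = 0" for f :: "'a \<times> 'b \<Rightarrow> real"
  proof -
    let ?C = "{z \<in> space ?P. f z > 0}"
    have C: "?C \<in> sets ?P" by measurable
    have "AE z in ?P. indicator ?C z * f z = 0"
      using all[OF C] integral_nonneg_eq_0_iff_AE[OF int[OF C]] by (auto simp: indicator_def)
    then show ?thesis using AE_space by eventually_elim (auto simp: indicator_def split: if_splits)
  qed
  have "AE z in ?P. f z \<le> 0" by (rule le) (use int all in auto)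
  moreover have "AE z in ?P. - f z \<le> 0" by (rule le) (use int all in auto)
  ultimately show ?thesis by eventually_elim simp
qed

lemma (in sigma_finite_measure) pair_sigma_finite_self: "pair_sigma_finite M M"
  by (simp add: pair_sigma_finite_def sigma_finite_measure_axioms)

text \<open>The sections are integrable without a uniform bound. Restricting x to a set of finite
  measure on which the norm of the section has integral at most n makes the weighted kernel jointly
  integrable, as Fubini's theorem requires.\<close>

lemma (in sigma_finite_measure) kernel_bounded_exhaustion:
  fixes k :: "'a \<Rightarrow> 'a \<Rightarrow> complex"
  assumes k[measurable]: "(\<lambda>(x, y). k x y) \<in> borel_measurable (M \<Otimes>\<^sub>M M)"
    and int: "AE x in M. integrable M (k x)"
  shows "\<exists>A :: nat \<Rightarrow> 'a set. (\<forall>n. A n \<in> sets M) \<and> (\<forall>n. emeasure M (A n) < \<infinity>) \<and>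
    (AE x in M. \<exists>n. x \<in> A n) \<and>
    (\<forall>n \<psi>. \<psi> \<in> borel_measurable M \<longrightarrow> (\<forall>x. norm (\<psi> x) \<le> indicator (A n) x) \<longrightarrow>
       integrable (M \<Otimes>\<^sub>M M) (\<lambda>(x, y). \<psi> x * k x y))"
proof -
  interpret P: pair_sigma_finite M M by (rule pair_sigma_finite_self)
  obtain S :: "nat \<Rightarrow> 'a set" where S: "range S \<subseteq> sets M" "(\<Union>i. S i) = space M" "\<And>i. emeasure M (S i) \<noteq> \<infinity>" "incseq S"
    using sigma_finite_incseq by metis
  have [measurable]: "S n \<in> sets M" for n using S by auto
  define N where "N x = (\<integral>\<^sup>+y. ennreal (norm (k x y)) \<partial>M)" for x
  have [measurable]: "N \<in> borel_measurable M" unfolding N_def by measurable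
  define A where "A n = {x \<in> S n. N x \<le> of_nat n}" for n
  have A_eq: "A n = S n \<inter> {x \<in> space M. N x \<le> of_nat n}" for n
    using S(2) by (auto simp: A_def)
  have [measurable]: "A n \<in> sets M" for n unfolding A_eq by measurable
  have fin: "emeasure M (A n) < \<infinity>" for n
    using emeasure_mono[of "A n" "S n" M] S(3)[of n] by (auto simp: A_def less_top top_unique)
  show ?thesis
  proof (intro exI[of _ A] conjI allI impI)
    show "A n \<in> sets M" for n by measurable
    show "emeasure M (A n) < \<infinity>" for n
      by (rule fin)
    show "AE x in M. \<exists>n. x \<in> A n"
      using int AE_space
    proof eventually_elim
      case (elim x)
      obtain i where i: "x \<in> S i" using S(2) elim by auto
      have "N x < \<infinity>" using elim by (simp add: N_def integrable_iff_bounded)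
      then obtain j where "N x < of_nat j" using ennreal_Ex_less_of_nat[of "N x"] by (auto simp: less_top[symmetric])
      then have "N x \<le> of_nat (max i j)"
        by (meson less_imp_le max.cobounded2 of_nat_le_iff order_trans)
      moreover have "x \<in> S (max i j)" using i incseqD[OF S(4), of i "max i j"] by auto
      ultimately show ?case by (auto simp: A_def intro!: exI[of _ "max i j"])
    qed
    fix n and \<psi> :: "'a \<Rightarrow> complex"
    assume [measurable]: "\<psi> \<in> borel_measurable M" and \<psi>: "\<forall>x. norm (\<psi> x) \<le> indicator (A n) x"
    show "integrable (M \<Otimes>\<^sub>M M) (\<lambda>(x, y). \<psi> x * k x y)"
    proof (rule integrableI_bounded)
      have "(\<integral>\<^sup>+z. ennreal (norm (case z of (x, y) \<Rightarrow> \<psi> x * k x y)) \<partial>(M \<Otimes>\<^sub>M M)) = (\<integral>\<^sup>+x. \<integral>\<^sup>+y. ennreal (norm (\<psi> x * k x y)) \<partial>M \<partial>M)"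
        by (subst nn_integral_fst[symmetric]) simp_all
      also have "\<dots> \<le> (\<integral>\<^sup>+x. of_nat n * indicator (A n) x \<partial>M)"
      proof (rule nn_integral_mono)
        fix x assume x: "x \<in> space M"
        have "(\<integral>\<^sup>+y. ennreal (norm (\<psi> x * k x y)) \<partial>M) = ennreal (norm (\<psi> x)) * N x"
          using x by (simp add: norm_mult ennreal_mult N_def nn_integral_cmult)
        also have "\<dots> \<le> indicator (A n) x * N x"
          using \<psi>[rule_format, of x] by (intro mult_right_mono) (auto simp: indicator_def split: if_splits)
        also have "\<dots> \<le> of_nat n * indicator (A n) x" by (auto simp: A_def indicator_def)
        finally show "(\<integral>\<^sup>+y. ennreal (norm (\<psi> x * k x y)) \<partial>M) \<le> of_nat n * indicator (A n) x" .
      qed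
      also have "\<dots> = of_nat n * emeasure M (A n)" by (rule nn_integral_cmult_indicator) simp
      also have "\<dots> < \<infinity>" using fin[of n] by (auto simp: ennreal_mult_less_top of_nat_less_top)
      finally show "(\<integral>\<^sup>+z. ennreal (norm (case z of (x, y) \<Rightarrow> \<psi> x * k x y)) \<partial>(M \<Otimes>\<^sub>M M)) < \<infinity>" .
    qed measurable
  qed
qed

text \<open>The null set of exceptional x depends on B, so x cannot be fixed before B varies.
  Integrating over x as well absorbs it and leaves a statement about rectangles.\<close>

lemma (in sigma_finite_measure) kernel_zero_of_sections:
  fixes k :: "'a \<Rightarrow> 'a \<Rightarrow> complex"
  assumes k[measurable]: "(\<lambda>(x, y). k x y) \<in> borel_measurable (M \<Otimes>\<^sub>M M)"
    and int: "AE x in M. integrable M (k x)"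
    and zero: "\<And>B. B \<in> sets M \<Longrightarrow> AE x in M. (LINT y|M. indicator B y * k x y) = 0"
  shows "AE z in M \<Otimes>\<^sub>M M. k (fst z) (snd z) = 0"
proof -
  interpret P: pair_sigma_finite M M by (rule pair_sigma_finite_self)
  obtain A :: "nat \<Rightarrow> 'a set" where A_all: "\<forall>n. A n \<in> sets M" and Afin: "\<forall>n. emeasure M (A n) < \<infinity>" and cover: "AE x in M. \<exists>n. x \<in> A n"
    and Aint: "\<forall>n \<psi>. \<psi> \<in> borel_measurable M \<longrightarrow> (\<forall>x. norm (\<psi> x) \<le> indicator (A n) x) \<longrightarrow>
       integrable (M \<Otimes>\<^sub>M M) (\<lambda>(x, y). \<psi> x * k x y)"
    using kernel_bounded_exhaustion[OF k int] by blast
  have A[measurable]: "A n \<in> sets M" for n using A_all by simp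
  have "AE z in M \<Otimes>\<^sub>M M. indicator (A n) (fst z) * k (fst z) (snd z) = 0" for n
  proof -
    define f where "f z = indicator (A n) (fst z) * k (fst z) (snd z)" for z
    have f: "integrable (M \<Otimes>\<^sub>M M) f"
      using Aint[rule_format, of "indicator (A n)" n] by (simp add: f_def[abs_def] split_beta' indicator_def)
    have z: "(LINT z|(M \<Otimes>\<^sub>M M). indicator (C \<times> B) z * f z) = 0" if [measurable]: "C \<in> sets M" "B \<in> sets M" for B C
    proof -
      have CB: "C \<times> B \<in> sets (M \<Otimes>\<^sub>M M)" by measurable
      have i: "integrable (M \<Otimes>\<^sub>M M) (\<lambda>z. indicator (C \<times> B) z * f z)"
        unfolding indicator_mult_complex by (rule integrable_mult_indicator[OF CB f])
      then have "(LINT z|(M \<Otimes>\<^sub>M M). indicator (C \<times> B) z * f z) = (LINT x|M. LINT y|M. indicator (C \<times> B) (x, y) * f (x, y))"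
        by (rule P.integral_fst'[symmetric])
      also have "\<dots> = (LINT x|M. indicator C x * indicator (A n) x * (LINT y|M. indicator B y * k x y))"
        by (simp add: f_def indicator_times mult.assoc mult.left_commute[of "indicator B _"])
      also have "\<dots> = 0"
        by (rule integral_eq_zero_AE) (use zero[OF that(2)] in auto)
      finally show ?thesis .
    qed
    have ind: "indicator S z * Re (f z) = Re (indicator S z * f z)" "indicator S z * Im (f z) = Im (indicator S z * f z)" for S z
      by (auto simp: indicator_def)
    have intCB: "integrable (M \<Otimes>\<^sub>M M) (\<lambda>z. indicator (C \<times> B) z * f z)" if "C \<in> sets M" "B \<in> sets M" for B C
    proof -
      have CB: "C \<times> B \<in> sets (M \<Otimes>\<^sub>M M)" using that by measurable
      show ?thesis
        unfolding indicator_mult_complex by (rule integrable_mult_indicator[OF CB f])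
    qed
    have "AE z in M \<Otimes>\<^sub>M M. Re (f z) = 0"
    proof (rule P.AE_zero_of_rectangles)
      show "(LINT z|(M \<Otimes>\<^sub>M M). indicator (C \<times> B) z * Re (f z)) = 0" if "C \<in> sets M" "B \<in> sets M" for C B
        unfolding ind by (subst integral_Re[OF intCB]) (use z that in simp_all)
    qed (use f in simp)
    moreover have "AE z in M \<Otimes>\<^sub>M M. Im (f z) = 0"
    proof (rule P.AE_zero_of_rectangles)
      show "(LINT z|(M \<Otimes>\<^sub>M M). indicator (C \<times> B) z * Im (f z)) = 0" if "C \<in> sets M" "B \<in> sets M" for C B
        unfolding ind by (subst integral_Im[OF intCB]) (use z that in simp_all)
    qed (use f in simp)
    ultimately show ?thesis by eventually_elim (simp add: f_def[symmetric] complex_eq_iff)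
  qed
  then have "AE z in M \<Otimes>\<^sub>M M. \<forall>n. indicator (A n) (fst z) * k (fst z) (snd z) = 0"
    by (subst AE_all_countable) blast
  moreover have "AE z in M \<Otimes>\<^sub>M M. \<exists>n. fst z \<in> A n"
    by (rule P.AE_pair_measure) (use cover in auto)
  ultimately show ?thesis by eventually_elim (auto simp: indicator_def split: if_splits)
qed

section \<open>Square integrable functions and scalar kernels of finite rank\<close>

lemma (in sigma_finite_measure) integrable_of_square_integrable:
  fixes f :: "'a \<Rightarrow> complex"
  assumes f: "square_integrable M f" and A[measurable]: "A \<in> sets M" "emeasure M A < \<infinity>"
    and \<psi>[measurable]: "\<psi> \<in> borel_measurable M" "\<And>x. norm (\<psi> x) \<le> indicator A x"
  shows "integrable M (\<lambda>x. \<psi> x * f x)"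
proof (rule Bochner_Integration.integrable_bound)
  have [measurable]: "f \<in> borel_measurable M" using f by (simp add: square_integrable_def)
  show "integrable M (\<lambda>x. indicator A x + (norm (f x))\<^sup>2)"
    using f A by (intro Bochner_Integration.integrable_add integrable_real_indicator) (auto simp: square_integrable_def)
  show "(\<lambda>x. \<psi> x * f x) \<in> borel_measurable M" by measurable
  show "AE x in M. norm (\<psi> x * f x) \<le> norm (indicator A x + (norm (f x))\<^sup>2 :: real)"
  proof (rule AE_I2)
    fix x
    have "norm (f x) \<le> 1 + (norm (f x))\<^sup>2"
      using zero_le_power2[of "norm (f x) - 1 / 2"] by (simp add: power2_eq_square algebra_simps)
    then show "norm (\<psi> x * f x) \<le> norm (indicator A x + (norm (f x))\<^sup>2 :: real)"
      using \<psi>(2)[of x] mult_right_mono[of "norm (\<psi> x)" 1 "norm (f x)"]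
      by (cases "x \<in> A") (auto simp: norm_mult)
  qed
qed

lemma square_integrable_cmult:
  fixes f :: "'a \<Rightarrow> complex"
  assumes "square_integrable M f"
  shows "square_integrable M (\<lambda>x. c * f x)"
proof -
  have "integrable M (\<lambda>x. (norm c)\<^sup>2 * (norm (f x))\<^sup>2)" using assms by (auto simp: square_integrable_def)
  then show ?thesis using assms by (auto simp: square_integrable_def norm_mult power_mult_distrib)
qed

lemma square_integrable_add:
  fixes f g :: "'a \<Rightarrow> 'b :: {second_countable_topology, real_normed_vector}"
  assumes f: "square_integrable M f" and g: "square_integrable M g"
  shows "square_integrable M (\<lambda>x. f x + g x)"
  unfolding square_integrable_def
proof
  have [measurable]: "f \<in> borel_measurable M" "g \<in> borel_measurable M"
    using assms by (auto simp: square_integrable_def)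
  show "(\<lambda>x. f x + g x) \<in> borel_measurable M" by measurable
  show "integrable M (\<lambda>x. (norm (f x + g x))\<^sup>2)"
  proof (rule Bochner_Integration.integrable_bound)
    show "integrable M (\<lambda>x. 2 * (norm (f x))\<^sup>2 + 2 * (norm (g x))\<^sup>2)"
      using assms by (auto simp: square_integrable_def)
    show "AE x in M. norm ((norm (f x + g x))\<^sup>2) \<le> norm (2 * (norm (f x))\<^sup>2 + 2 * (norm (g x))\<^sup>2)"
    proof (rule AE_I2)
      fix x
      have "(norm (f x + g x))\<^sup>2 \<le> (norm (f x) + norm (g x))\<^sup>2"
        by (intro power_mono norm_triangle_ineq) simp
      also have "\<dots> \<le> 2 * (norm (f x))\<^sup>2 + 2 * (norm (g x))\<^sup>2"
        using zero_le_power2[of "norm (f x) - norm (g x)"] by (simp add: power2_eq_square algebra_simps)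
      finally show "norm ((norm (f x + g x))\<^sup>2) \<le> norm (2 * (norm (f x))\<^sup>2 + 2 * (norm (g x))\<^sup>2)" by simp
    qed
  qed measurable
qed

lemma square_integrable_sum:
  fixes g :: "'i \<Rightarrow> 'a \<Rightarrow> complex"
  assumes "finite I" "\<And>i. i \<in> I \<Longrightarrow> square_integrable M (g i)"
  shows "square_integrable M (\<lambda>x. \<Sum>i\<in>I. c i * g i x)"
  using assms
proof (induction I rule: finite_induct)
  case empty
  then show ?case by (simp add: square_integrable_def)
next
  case (insert i I)
  then show ?case by (simp add: square_integrable_add square_integrable_cmult)
qed

text \<open>Induction on the number of generators: a functional \<open>\<psi>\<close> that does not vanish on one section
  integral \<open>u\<close> splits off the rank-one kernel \<open>u(x) w(y)\<close>, with \<open>w\<close> proportional to the integral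
  of \<open>\<psi>(x) k(x, y)\<close>; the remaining sections lie in the kernel of \<open>\<psi>\<close>.\<close>

lemma (in sigma_finite_measure) finite_rank_sections:
  fixes k :: "'a \<Rightarrow> 'a \<Rightarrow> complex" and g :: "'i \<Rightarrow> 'a \<Rightarrow> complex"
  assumes fin: "finite I"
    and k: "(\<lambda>(x, y). k x y) \<in> borel_measurable (M \<Otimes>\<^sub>M M)"
    and int: "AE x in M. integrable M (k x)"
    and g: "\<And>i. i \<in> I \<Longrightarrow> square_integrable M (g i)"
    and rank: "\<And>B. B \<in> sets M \<Longrightarrow> \<exists>a. AE x in M. (LINT y|M. indicator B y * k x y) = (\<Sum>i\<in>I. a i * g i x)"
  shows "\<exists>C w. (\<forall>j\<in>I. integrable M (w j)) \<and>
    (AE z in M \<Otimes>\<^sub>M M. k (fst z) (snd z) = (\<Sum>j\<in>I. (\<Sum>i\<in>I. C j i * g i (fst z)) * (w j (snd z) :: complex)))"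
  using assms
proof (induction "card I" arbitrary: I k g)
  case 0
  then have "I = {}" by simp
  moreover have "AE z in M \<Otimes>\<^sub>M M. k (fst z) (snd z) = 0"
    using 0 \<open>I = {}\<close> by (intro kernel_zero_of_sections) auto
  ultimately show ?case by simp
next
  case (Suc r)
  interpret P: pair_sigma_finite M M by (rule pair_sigma_finite_self)
  note k[measurable] = Suc.prems(2) and g = Suc.prems(4)
  have gm[measurable]: "i \<in> I \<Longrightarrow> g i \<in> borel_measurable M" for i
    using g by (auto simp: square_integrable_def)
  define F where "F B x = (LINT y|M. indicator B y * k x y)" for B x
  have Fm[measurable]: "F B \<in> borel_measurable M" if [measurable]: "B \<in> sets M" for B
    unfolding F_def by measurable
  show ?case
  proof (cases "\<forall>B\<in>sets M. AE x in M. F B x = 0")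
    case True
    then have "AE z in M \<Otimes>\<^sub>M M. k (fst z) (snd z) = 0"
      using Suc.prems by (intro kernel_zero_of_sections) (auto simp: F_def)
    then show ?thesis
      by (intro exI[of _ "\<lambda>_ _. 0"]) simp
  next
    case False
    then obtain B0 where B0[measurable]: "B0 \<in> sets M" and nz: "\<not> (AE x in M. F B0 x = 0)" by auto
    obtain a where a: "AE x in M. F B0 x = (\<Sum>i\<in>I. a i * g i x)"
      using Suc.prems(5)[OF B0] unfolding F_def by blast
    define u where "u x = (\<Sum>i\<in>I. a i * g i x)" for x
    have u2: "square_integrable M u" unfolding u_def[abs_def] using Suc.prems by (intro square_integrable_sum) auto
    then have [measurable]: "u \<in> borel_measurable M" by (simp add: square_integrable_def)
    obtain A :: "nat \<Rightarrow> 'a set" where A_all: "\<forall>n. A n \<in> sets M" and Afin: "\<forall>n. emeasure M (A n) < \<infinity>" and cover: "AE x in M. \<exists>n. x \<in> A n"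
      and Aint: "\<forall>n \<psi>. \<psi> \<in> borel_measurable M \<longrightarrow> (\<forall>x. norm (\<psi> x) \<le> indicator (A n) x) \<longrightarrow>
         integrable (M \<Otimes>\<^sub>M M) (\<lambda>(x, y). \<psi> x * k x y)"
      using kernel_bounded_exhaustion[OF k Suc.prems(3)] by blast
    have A[measurable]: "A n \<in> sets M" for n using A_all by simp
    have "\<exists>n. \<not> (AE x in M. indicator (A n) x * norm (u x) = 0)"
    proof (rule ccontr)
      assume "\<not> ?thesis"
      then have "AE x in M. \<forall>n. indicator (A n) x * norm (u x) = 0" by (subst AE_all_countable) blast
      with cover a have "AE x in M. F B0 x = 0"
        by eventually_elim (auto simp: u_def indicator_def split: if_splits)
      with nz show False by simp
    qed
    then obtain n where n: "\<not> (AE x in M. indicator (A n) x * norm (u x) = 0)" by blast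
    \<comment> \<open>The conjugate phase turns u into its norm on A n, where u is not almost
      everywhere zero; the bound by the indicator makes the integrals against \<open>\<psi>\<close>
      exist.\<close>
    define \<psi> where "\<psi> x = indicator (A n) x * (cnj (u x) / norm (u x))" for x
    have [measurable]: "cnj \<in> borel_measurable borel" "complex_of_real \<in> borel_measurable borel"
      by (intro borel_measurable_continuous_onI continuous_on_cnj continuous_on_of_real continuous_on_id)+
    have \<psi>[measurable]: "\<psi> \<in> borel_measurable M" unfolding \<psi>_def by measurable
    have \<psi>_le: "norm (\<psi> x) \<le> indicator (A n) x" for x
      by (simp add: \<psi>_def norm_mult norm_divide indicator_def)
    have \<psi>int: "integrable M (\<lambda>x. \<psi> x * f x)" if "square_integrable M f" for f :: "'a \<Rightarrow> complex"
      by (rule integrable_of_square_integrable[OF that A Afin[rule_format] \<psi> \<psi>_le])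
    have pk: "integrable (M \<Otimes>\<^sub>M M) (\<lambda>(x, y). \<psi> x * k x y)" by (rule Aint[rule_format, OF \<psi> \<psi>_le])
    define D where "D = (LINT x|M. \<psi> x * u x)"
    have "\<psi> x * u x = complex_of_real (indicator (A n) x * norm (u x))" for x
    proof (cases "u x = 0")
      case False
      have "cnj (u x) * u x = complex_of_real (norm (u x)) * complex_of_real (norm (u x))"
        using complex_norm_square[of "u x"] by (simp only: power2_eq_square mult.commute of_real_mult)
      then have "cnj (u x) / complex_of_real (norm (u x)) * u x = complex_of_real (norm (u x))"
        using False by (simp only: times_divide_eq_left) simp
      then show ?thesis by (simp add: \<psi>_def indicator_def)
    qed simp
    then have \<psi>u: "(\<lambda>x. \<psi> x * u x) = (\<lambda>x. complex_of_real (indicator (A n) x * norm (u x)))" by auto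
    have "integrable M (\<lambda>x. indicator (A n) x * norm (u x))"
      using \<psi>int[OF u2] unfolding \<psi>u by (simp only: complex_of_real_integrable_eq)
    then have "(LINT x|M. indicator (A n) x * norm (u x)) \<noteq> 0"
      using n by (subst integral_nonneg_eq_0_iff_AE) auto
    then have D: "D \<noteq> 0" unfolding D_def \<psi>u by (simp only: integral_complex_of_real of_real_eq_0_iff not_False_eq_True)
    define d where "d i = (LINT x|M. \<psi> x * g i x)" for i
    have \<psi>_lin: "(LINT x|M. \<psi> x * (\<Sum>i\<in>I. b i * g i x)) = (\<Sum>i\<in>I. b i * d i)" for b
    proof -
      have "(LINT x|M. \<psi> x * (\<Sum>i\<in>I. b i * g i x)) = (LINT x|M. (\<Sum>i\<in>I. b i * (\<psi> x * g i x)))"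
        by (simp add: sum_distrib_left mult.left_commute)
      also have "\<dots> = (\<Sum>i\<in>I. b i * d i)"
        using g by (subst Bochner_Integration.integral_sum) (auto simp: d_def intro!: integrable_mult_right \<psi>int)
      finally show ?thesis .
    qed
    have D_sum: "D = (\<Sum>i\<in>I. a i * d i)" unfolding D_def u_def by (rule \<psi>_lin)
    with D obtain p where p: "p \<in> I" "d p \<noteq> 0" by (metis (no_types, lifting) mult_zero_right sum.neutral)
    \<comment> \<open>Normalised so that the rank-one kernel \<open>u x * w0 y\<close> has the same
      integral against \<open>\<psi>\<close> as k; the difference \<open>k'\<close> is then
      annihilated by \<open>\<psi>\<close>.\<close>
    define w0 where "w0 y = (LINT x|M. \<psi> x * k x y) / D" for y
    have w0: "integrable M w0"
      unfolding w0_def[abs_def] using P.integrable_snd[OF pk] by simp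
    have [measurable]: "w0 \<in> borel_measurable M" using w0 by (rule borel_measurable_integrable)
    define I' where "I' = I - {p}"
    \<comment> \<open>The projection along \<open>g p\<close> onto the null space of
      \<open>\<psi>\<close>. It sends \<open>g p\<close> to 0, which removes one generator.\<close>
    define g' where "g' i x = g i x - d i / d p * g p x" for i x
    define k' where "k' x y = k x y - u x * w0 y" for x y
    have "\<exists>C w. (\<forall>j\<in>I'. integrable M (w j)) \<and>
      (AE z in M \<Otimes>\<^sub>M M. k' (fst z) (snd z) = (\<Sum>j\<in>I'. (\<Sum>i\<in>I'. C j i * g' i (fst z)) * (w j (snd z) :: complex)))"
    proof (rule Suc.hyps(1))
      show "r = card I'" using Suc.hyps(2) p Suc.prems(1) by (simp add: I'_def)
      show "finite I'" using Suc.prems(1) by (simp add: I'_def)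
      show "(\<lambda>(x, y). k' x y) \<in> borel_measurable (M \<Otimes>\<^sub>M M)" unfolding k'_def by measurable
      show "AE x in M. integrable M (k' x)"
        using Suc.prems(3)
      proof eventually_elim
        case (elim x)
        then show ?case unfolding k'_def[abs_def] using w0 by (intro Bochner_Integration.integrable_diff integrable_mult_right)
      qed
      show "square_integrable M (g' i)" if "i \<in> I'" for i
        using square_integrable_add[OF g[of i] square_integrable_cmult[OF g[OF p(1)], of "- (d i / d p)"]] that
        by (simp add: I'_def g'_def[abs_def])
    next
      fix B assume B[measurable]: "B \<in> sets M"
      obtain a' where a': "AE x in M. F B x = (\<Sum>i\<in>I. a' i * g i x)"
        using Suc.prems(5)[OF B] unfolding F_def by blast
      define \<beta> where "\<beta> = (LINT y|M. indicator B y * w0 y)"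
      have intB: "integrable M (\<lambda>y. indicator B y * f y)" if "integrable M f" for f :: "'a \<Rightarrow> complex"
        unfolding indicator_mult_complex by (rule integrable_mult_indicator[OF B that])
      define b where "b i = a' i - \<beta> * a i" for i
      have F': "AE x in M. (LINT y|M. indicator B y * k' x y) = (\<Sum>i\<in>I. b i * g i x)"
        using a' Suc.prems(3)
      proof eventually_elim
        case (elim x)
        have "(LINT y|M. indicator B y * k' x y) = (LINT y|M. indicator B y * k x y - u x * (indicator B y * w0 y))"
          by (simp add: k'_def algebra_simps)
        also have "\<dots> = F B x - u x * \<beta>"
          using intB[OF elim(2)] intB[OF w0]
          by (subst Bochner_Integration.integral_diff) (auto simp: F_def \<beta>_def intro!: integrable_mult_right)
        also have "\<dots> = (\<Sum>i\<in>I. b i * g i x)"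
          by (simp add: elim(1) u_def b_def sum_subtractf sum_distrib_left sum_distrib_right algebra_simps)
        finally show ?case .
      qed
      \<comment> \<open>The left side is \<open>\<psi>\<close> applied to a section integral of
        \<open>k'\<close>. By Fubini's theorem it vanishes through the choice of \<open>w0\<close>;
        as \<open>d p \<noteq> 0\<close>, the coefficient \<open>b p\<close> is then determined by
        the others.\<close>
      have "(\<Sum>i\<in>I. b i * d i) = 0"
      proof -
        have "D * \<beta> = (LINT y|M. indicator B y * (LINT x|M. \<psi> x * k x y))"
          unfolding \<beta>_def w0_def using D by (subst integral_mult_right_zero[symmetric]) (simp add: mult.left_commute)
        also have "\<dots> = (LINT y|M. LINT x|M. indicator B y * (\<psi> x * k x y))" by simp
        also have "\<dots> = (LINT x|M. LINT y|M. indicator B y * (\<psi> x * k x y))"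
        proof (rule P.Fubini_integral)
          have "space M \<times> B \<in> sets (M \<Otimes>\<^sub>M M)" by measurable
          from integrable_mult_indicator[OF this pk]
          show "integrable (M \<Otimes>\<^sub>M M) (\<lambda>(x, y). indicator B y * (\<psi> x * k x y))"
            by (rule iffD1[OF Bochner_Integration.integrable_cong, rotated 2])
              (auto simp: indicator_def space_pair_measure)
        qed
        also have "\<dots> = (LINT x|M. \<psi> x * F B x)"
          by (simp add: F_def mult.left_commute)
        also have "\<dots> = (LINT x|M. \<psi> x * (\<Sum>i\<in>I. a' i * g i x))"
          using a' by (intro integral_cong_AE) auto
        also have "\<dots> = (\<Sum>i\<in>I. a' i * d i)" by (rule \<psi>_lin)
        finally show ?thesis
          unfolding b_def by (simp add: D_sum algebra_simps sum_subtractf sum_distrib_left)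
      qed
      then have bp: "b p = - (\<Sum>i\<in>I'. b i * d i) / d p"
        using p Suc.prems(1) by (simp add: I'_def sum_diff1 field_simps)
      have "(\<Sum>i\<in>I. b i * g i x) = (\<Sum>i\<in>I'. b i * g' i x)" for x
      proof -
        have "(\<Sum>i\<in>I. b i * g i x) = b p * g p x + (\<Sum>i\<in>I'. b i * g i x)"
          using p Suc.prems(1) by (simp add: I'_def sum.remove)
        also have "b p * g p x = - (\<Sum>i\<in>I'. b i * (d i / d p * g p x))"
          unfolding bp by (simp add: sum_distrib_right sum_divide_distrib mult.assoc)
        finally show ?thesis by (simp add: g'_def algebra_simps sum_subtractf)
      qed
      with F' show "\<exists>a. AE x in M. (LINT y|M. indicator B y * k' x y) = (\<Sum>i\<in>I'. a i * g' i x)" by auto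
    qed
    then obtain C w where w: "\<forall>j\<in>I'. integrable M (w j)"
      and dec: "AE z in M \<Otimes>\<^sub>M M. k' (fst z) (snd z) = (\<Sum>j\<in>I'. (\<Sum>i\<in>I'. C j i * g' i (fst z)) * (w j (snd z) :: complex))"
      by blast
    \<comment> \<open>The freed index p carries the rank-one term, with u expanded in the
      generators; the other rows express \<open>g'\<close> through g again.\<close>
    define C' where "C' j i = (if j = p then a i else if i = p then - (\<Sum>i\<in>I'. C j i * (d i / d p)) else C j i)" for j i
    define w' where "w' j = (if j = p then w0 else w j)" for j
    have "\<forall>j\<in>I. integrable M (w' j)" using w w0 by (auto simp: w'_def I'_def)
    moreover have "AE z in M \<Otimes>\<^sub>M M. k (fst z) (snd z) = (\<Sum>j\<in>I. (\<Sum>i\<in>I. C' j i * g i (fst z)) * w' j (snd z))"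
      using dec
    proof eventually_elim
      case (elim z)
      have row: "(\<Sum>i\<in>I. C' j i * g i x) = (\<Sum>i\<in>I'. C j i * g' i x)" if "j \<in> I'" for j x
      proof -
        have "j \<noteq> p" using that by (simp add: I'_def)
        have "(\<Sum>i\<in>I. C' j i * g i x) = C' j p * g p x + (\<Sum>i\<in>I'. C' j i * g i x)"
          using p Suc.prems(1) by (simp add: I'_def sum.remove)
        also have "(\<Sum>i\<in>I'. C' j i * g i x) = (\<Sum>i\<in>I'. C j i * g i x)"
          using \<open>j \<noteq> p\<close> by (intro sum.cong) (auto simp: C'_def I'_def)
        also have "C' j p * g p x = - (\<Sum>i\<in>I'. C j i * (d i / d p * g p x))"
          using \<open>j \<noteq> p\<close> by (simp add: C'_def sum_distrib_right mult.assoc)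
        finally show ?thesis by (simp add: g'_def algebra_simps sum_subtractf)
      qed
      have "(\<Sum>j\<in>I. (\<Sum>i\<in>I. C' j i * g i (fst z)) * w' j (snd z)) =
          (\<Sum>i\<in>I. C' p i * g i (fst z)) * w' p (snd z) + (\<Sum>j\<in>I'. (\<Sum>i\<in>I. C' j i * g i (fst z)) * w' j (snd z))"
        unfolding I'_def by (rule sum.remove[OF Suc.prems(1) p(1)])
      also have "(\<Sum>j\<in>I'. (\<Sum>i\<in>I. C' j i * g i (fst z)) * w' j (snd z)) = (\<Sum>j\<in>I'. (\<Sum>i\<in>I'. C j i * g' i (fst z)) * w j (snd z))"
        by (intro sum.cong refl) (simp add: row, auto simp: w'_def I'_def)
      also have "(\<Sum>i\<in>I. C' p i * g i (fst z)) * w' p (snd z) = u (fst z) * w0 (snd z)"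
        by (simp add: C'_def w'_def u_def)
      finally show ?case using elim by (simp add: k'_def algebra_simps)
    qed
    ultimately show ?thesis by blast
  qed
qed

section \<open>Passage from scalar kernels to matrix-valued kernels\<close>

lemma borel_measurable_vec_nth_comp [measurable (raw)]:
  fixes f :: "'a \<Rightarrow> ('b :: euclidean_space) ^ 'n"
  assumes "f \<in> borel_measurable M"
  shows "(\<lambda>x. f x $ i) \<in> borel_measurable M"
  by (rule borel_measurable_continuous_on[OF _ assms]) (intro continuous_intros)

lemma norm_axis_complex: "norm (axis i x :: complex ^ 2) = norm x"
  using exhaust_2[of i] by (auto simp: norm_vec_def axis_def L2_set_def sum_2)

lemma borel_measurable_axis:
  fixes f :: "'a \<Rightarrow> complex"
  assumes "f \<in> borel_measurable M"
  shows "(\<lambda>x. axis i (f x) :: complex ^ 2) \<in> borel_measurable M"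
proof (rule borel_measurable_continuous_on[OF _ assms])
  have "bounded_linear (axis i :: complex \<Rightarrow> complex ^ 2)"
  proof
    fix x y :: complex and r :: real
    show "(axis i (x + y) :: complex ^ 2) = axis i x + axis i y" "(axis i (r *\<^sub>R x) :: complex ^ 2) = r *\<^sub>R axis i x"
      by (auto simp: axis_def Finite_Cartesian_Product.vec_eq_iff)
    show "\<exists>K. \<forall>x :: complex. norm (axis i x :: complex ^ 2) \<le> norm x * K"
      by (rule exI[of _ 1]) (simp add: norm_axis_complex)
  qed
  then show "continuous_on UNIV (\<lambda>x. axis i x :: complex ^ 2)"
    by (rule linear_continuous_on)
qed

lemma matrix_vector_mult_axis_nth:
  "((A :: complex ^ 2 ^ 2) *v axis b c) $ a = A $ a $ b * c"
  using exhaust_2[of b] by (auto simp: matrix_vector_mult_def axis_def sum_2)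

lemma square_integrable_vec_nth:
  fixes g :: "'a \<Rightarrow> complex ^ 2"
  assumes g: "square_integrable M g"
  shows "square_integrable M (\<lambda>x. g x $ a)"
  unfolding square_integrable_def
proof
  have [measurable]: "g \<in> borel_measurable M" using g by (simp add: square_integrable_def)
  show [measurable]: "(\<lambda>x. g x $ a) \<in> borel_measurable M" by measurable
  show "integrable M (\<lambda>x. (norm (g x $ a))\<^sup>2)"
  proof (rule Bochner_Integration.integrable_bound)
    show "integrable M (\<lambda>x. (norm (g x))\<^sup>2)" using g by (simp add: square_integrable_def)
    show "AE x in M. norm ((norm (g x $ a))\<^sup>2) \<le> norm ((norm (g x))\<^sup>2)"
      by (auto intro!: AE_I2 power_mono Finite_Cartesian_Product.norm_nth_le)
  qed measurable
qed

text \<open>The scalar result is applied to each of the four matrix entries. The operator is only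
  defined on square integrable functions, so the second variable is weighted by a positive square
  integrable \<open>\<rho>\<close>; then an indicator of any measurable set, placed on a coordinate
  axis, becomes an admissible test function.\<close>

lemma finite_rank_kernel_decomposition_index:
  assumes sf: "sigma_finite_measure M" and fr: "finite_rank_kernel M K"
  shows "\<exists>(I :: (2 \<times> 2 \<times> ('a \<Rightarrow> complex ^ 2)) set) g h. finite I \<and>
    (\<forall>i\<in>I. square_integrable M (g i :: 'a \<Rightarrow> complex ^ 2)) \<and> (\<forall>i\<in>I. h i \<in> borel_measurable M) \<and>
    (\<forall>i\<in>I. \<forall>j\<in>I. \<forall>b. integrable M (\<lambda>y. (h i y :: complex ^ 2) $ b * g j y $ b)) \<and>
    (AE z in M \<Otimes>\<^sub>M M. \<forall>a b. cq_mat (K (fst z) (snd z)) $ a $ b = (\<Sum>i\<in>I. g i (fst z) $ a * h i (snd z) $ b))"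
proof -
  interpret sigma_finite_measure M by (rule sf)
  have Km[measurable]: "(\<lambda>(x, y). cq_mat (K x y)) \<in> borel_measurable (M \<Otimes>\<^sub>M M)"
    and Kint: "\<And>f. square_integrable M f \<Longrightarrow> AE x in M. integrable M (\<lambda>y. cq_mat (K x y) *v f y)"
    using fr by (auto simp: finite_rank_kernel_def L2_kernel_def)
  obtain G :: "('a \<Rightarrow> complex ^ 2) set" where G: "finite G" "\<And>g. g \<in> G \<Longrightarrow> square_integrable M g"
    and rank: "\<And>f. square_integrable M f \<Longrightarrow> \<exists>a. AE x in M. kernel_op M K f x = (\<Sum>g\<in>G. a g *s g x)"
    using fr unfolding finite_rank_kernel_def by blast
  have Gm[measurable]: "g \<in> G \<Longrightarrow> g \<in> borel_measurable M" for g using G by (auto simp: square_integrable_def)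
  obtain \<phi> :: "'a \<Rightarrow> real" where \<phi>[measurable]: "\<phi> \<in> borel_measurable M" and \<phi>0: "\<And>x. \<phi> x > 0" and \<phi>i: "integrable M \<phi>"
    by (rule obtain_positive_integrable_function) blast
  \<comment> \<open>The summand \<open>sqrt (\<phi> x)\<close> makes the weight positive, the other
    summands make it dominate every generator.\<close>
  define \<rho> where "\<rho> x = sqrt (\<phi> x) + (\<Sum>g\<in>G. norm (g x))" for x
  have \<rho>0: "\<rho> x > 0" for x
    unfolding \<rho>_def using \<phi>0[of x] by (intro add_pos_nonneg sum_nonneg) auto
  have [measurable]: "\<rho> \<in> borel_measurable M" unfolding \<rho>_def by measurable
  have \<rho>_ge: "norm (g x $ a) \<le> \<rho> x" if "g \<in> G" for g x a
  proof -
    have "norm (g x $ a) \<le> norm (g x)" by (rule Finite_Cartesian_Product.norm_nth_le)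
    also have "\<dots> \<le> (\<Sum>g\<in>G. norm (g x))" using that G by (intro member_le_sum) auto
    also have "\<dots> \<le> \<rho> x" using less_imp_le[OF \<phi>0[of x]] by (simp add: \<rho>_def)
    finally show ?thesis .
  qed
  have \<rho>2: "square_integrable M \<rho>"
  proof -
    have "square_integrable M (\<lambda>x. sqrt (\<phi> x))"
      using \<phi>i less_imp_le[OF \<phi>0] by (simp add: square_integrable_def)
    moreover have "square_integrable M (\<lambda>x. \<Sum>g\<in>G'. norm (g x))" if "finite G'" "G' \<subseteq> G" for G'
      using that
    proof (induction G' rule: finite_induct)
      case (insert g G')
      then have "square_integrable M (\<lambda>x. norm (g x))"
        using G(2)[of g] by (auto simp: square_integrable_def)
      then show ?case using insert by (simp add: square_integrable_add)
    qed (simp add: square_integrable_def)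
    ultimately show ?thesis unfolding \<rho>_def[abs_def] using G by (intro square_integrable_add) auto
  qed
  define k where "k a b x y = cq_mat (K x y) $ a $ b * complex_of_real (\<rho> y)" for a b x y
  have [measurable]: "complex_of_real \<in> borel_measurable borel"
    by (intro borel_measurable_continuous_onI continuous_on_of_real continuous_on_id)
  have km: "(\<lambda>(x, y). k a b x y) \<in> borel_measurable (M \<Otimes>\<^sub>M M)" for a b
    unfolding k_def by measurable
  have f2: "square_integrable M (\<lambda>y. axis b (indicator B y * complex_of_real (\<rho> y)) :: complex ^ 2)" if [measurable]: "B \<in> sets M" for b B
    unfolding square_integrable_def
  proof
    show "(\<lambda>y. axis b (indicator B y * complex_of_real (\<rho> y)) :: complex ^ 2) \<in> borel_measurable M"
      by (rule borel_measurable_axis) measurable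
    have "integrable M (\<lambda>y. indicator B y *\<^sub>R (\<rho> y)\<^sup>2)"
      using \<rho>2 that by (intro integrable_mult_indicator) (auto simp: square_integrable_def)
    then show "integrable M (\<lambda>y. (norm (axis b (indicator B y * complex_of_real (\<rho> y)) :: complex ^ 2))\<^sup>2)"
      by (rule iffD1[OF Bochner_Integration.integrable_cong, rotated 2])
        (auto simp: norm_axis_complex norm_mult indicator_def)
  qed
  have kop: "AE x in M. integrable M (\<lambda>y. indicator B y * k a b x y) \<and>
      kernel_op M K (\<lambda>y. axis b (indicator B y * complex_of_real (\<rho> y))) x $ a = (LINT y|M. indicator B y * k a b x y)"
    if "B \<in> sets M" for a b B
    using Kint[OF f2[OF that, of b]]
  proof eventually_elim
    case (elim x)
    have eq: "(cq_mat (K x y) *v axis b (indicator B y * complex_of_real (\<rho> y))) $ a = indicator B y * k a b x y" for y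
      by (simp add: matrix_vector_mult_axis_nth k_def)
    show ?case
      using integrable_bounded_linear[OF bounded_linear_vec_nth[of a] elim]
        integral_bounded_linear[OF bounded_linear_vec_nth[of a] elim]
      unfolding kernel_op_def eq by simp
  qed
  define Q where "Q a b C w \<longleftrightarrow> (\<forall>j\<in>G. integrable M (w j)) \<and>
    (AE z in M \<Otimes>\<^sub>M M. k a b (fst z) (snd z) = (\<Sum>j\<in>G. (\<Sum>i\<in>G. C j i * (i (fst z) $ a)) * (w j (snd z) :: complex)))" for a b C w
  have "\<exists>C w. Q a b C w" for a b
    unfolding Q_def
  proof (rule finite_rank_sections[OF G(1) km])
    show "AE x in M. integrable M (k a b x)"
      using kop[OF sets.top, of a b] AE_space
    proof eventually_elim
      case (elim x)
      then have "integrable M (\<lambda>y. indicator (space M) y * k a b x y)" by simp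
      then show ?case by (rule iffD1[OF Bochner_Integration.integrable_cong, rotated 2]) auto
    qed
    show "square_integrable M (\<lambda>x. g x $ a)" if "g \<in> G" for g
      by (rule square_integrable_vec_nth[OF G(2)[OF that]])
    fix B assume B: "B \<in> sets M"
    obtain c where c: "AE x in M. kernel_op M K (\<lambda>y. axis b (indicator B y * complex_of_real (\<rho> y))) x = (\<Sum>g\<in>G. c g *s g x)"
      using rank[OF f2[OF B]] by blast
    have "AE x in M. (LINT y|M. indicator B y * k a b x y) = (\<Sum>g\<in>G. c g * (g x $ a))"
      using c kop[OF B, of a b]
    proof eventually_elim
      case (elim x)
      have "(LINT y|M. indicator B y * k a b x y) = (\<Sum>g\<in>G. c g *s g x) $ a" using elim by metis
      then show ?case by (simp add: sum_component)
    qed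
    then show "\<exists>c. AE x in M. (LINT y|M. indicator B y * k a b x y) = (\<Sum>g\<in>G. c g * (g x $ a))" by blast
  qed
  then obtain C w where Q: "\<And>a b. Q a b (C a b) (w a b)" by metis
  have w: "\<And>a b j. j \<in> G \<Longrightarrow> integrable M (w a b j)"
    and dec: "\<And>a b. AE z in M \<Otimes>\<^sub>M M. k a b (fst z) (snd z) = (\<Sum>j\<in>G. (\<Sum>i\<in>G. C a b j i * (i (fst z) $ a)) * (w a b j (snd z) :: complex))"
    using Q unfolding Q_def by blast+
  define u where "u a b j x = (\<Sum>i\<in>G. C a b j i * (i x $ a))" for a b j and x :: 'a
  \<comment> \<open>The index (a, b, j) stands for a rank-one term that contributes to the matrix
    entry (a, b) only.\<close>
  define I :: "(2 \<times> 2 \<times> ('a \<Rightarrow> complex ^ 2)) set" where "I = UNIV \<times> UNIV \<times> G"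
  define g :: "2 \<times> 2 \<times> ('a \<Rightarrow> complex ^ 2) \<Rightarrow> 'a \<Rightarrow> complex ^ 2" where "g = (\<lambda>(a, b, j) x. axis a (u a b j x))"
  \<comment> \<open>Dividing by \<open>\<rho>\<close> undoes the weight. The products with the
    \<open>g\<close> remain integrable: each \<open>g\<close> is at most a multiple of
    \<open>\<rho>\<close>, so they are dominated by a multiple of the integrable w.\<close>
  define h :: "2 \<times> 2 \<times> ('a \<Rightarrow> complex ^ 2) \<Rightarrow> 'a \<Rightarrow> complex ^ 2" where "h = (\<lambda>(a, b, j) y. axis b (w a b j y / complex_of_real (\<rho> y)))"
  have um[measurable]: "u a b j \<in> borel_measurable M" for a b j
    unfolding u_def[abs_def] by (intro borel_measurable_sum borel_measurable_times borel_measurable_const borel_measurable_vec_nth_comp Gm)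
  have wm[measurable]: "j \<in> G \<Longrightarrow> w a b j \<in> borel_measurable M" for a b j
    by (rule borel_measurable_integrable[OF w])
  have u_le: "norm (u a b j x) \<le> (\<Sum>i\<in>G. norm (C a b j i)) * \<rho> x" for a b j x
    unfolding u_def sum_distrib_right
    by (intro order_trans[OF norm_sum] sum_mono) (auto simp: norm_mult intro!: mult_left_mono \<rho>_ge)
  have u2: "integrable M (\<lambda>x. (norm (u a b j x))\<^sup>2)" for a b j
  proof (rule Bochner_Integration.integrable_bound)
    show "integrable M (\<lambda>x. (\<Sum>i\<in>G. norm (C a b j i))\<^sup>2 * (norm (\<rho> x))\<^sup>2)"
      using \<rho>2 by (auto simp: square_integrable_def)
    show "AE x in M. norm ((norm (u a b j x))\<^sup>2) \<le> norm ((\<Sum>i\<in>G. norm (C a b j i))\<^sup>2 * (norm (\<rho> x))\<^sup>2)"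
    proof (rule AE_I2)
      fix x
      show "norm ((norm (u a b j x))\<^sup>2) \<le> norm ((\<Sum>i\<in>G. norm (C a b j i))\<^sup>2 * (norm (\<rho> x))\<^sup>2)"
        using power_mono[OF u_le[of a b j x], of 2] by (simp add: power_mult_distrib)
    qed
  qed measurable
  have hm: "h i \<in> borel_measurable M" if "i \<in> I" for i
  proof -
    obtain a b j where i: "i = (a, b, j)" by (cases i)
    with that have "j \<in> G" by (simp add: I_def)
    then have [measurable]: "w a b j \<in> borel_measurable M" by (rule wm)
    show ?thesis unfolding i h_def prod.case by (intro borel_measurable_axis) measurable
  qed
  have g2: "square_integrable M (g i)" for i
    using u2 by (cases i) (simp add: square_integrable_def g_def norm_axis_complex borel_measurable_axis)
  have [measurable]: "g i \<in> borel_measurable M" for i using g2 by (simp add: square_integrable_def)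
  have hg: "integrable M (\<lambda>y. h i y $ b' * g i' y $ b')" if I: "i \<in> I" "i' \<in> I" for i i' b'
  proof -
    obtain a b j a1 b1 j1 where i: "i = (a, b, j)" and i': "i' = (a1, b1, j1)" by (cases i, cases i')
    with I have j: "j \<in> G" by (simp add: I_def)
    show ?thesis
    proof (rule Bochner_Integration.integrable_bound)
      show "integrable M (\<lambda>y. (\<Sum>i\<in>G. norm (C a1 b1 j1 i)) *\<^sub>R w a b j y)"
        using w[OF j] by (rule integrable_scaleR_right)
      show "(\<lambda>y. h i y $ b' * g i' y $ b') \<in> borel_measurable M" using hm[OF I(1)] by measurable
      show "AE y in M. norm (h i y $ b' * g i' y $ b') \<le> norm ((\<Sum>i\<in>G. norm (C a1 b1 j1 i)) *\<^sub>R w a b j y)"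
      proof (rule AE_I2)
        fix y
        have "norm (h i y $ b' * g i' y $ b') \<le> norm (w a b j y) / \<rho> y * norm (u a1 b1 j1 y)"
          using \<rho>0[of y] by (auto simp: i i' h_def g_def axis_def norm_mult norm_divide)
        also have "\<dots> \<le> norm (w a b j y) / \<rho> y * ((\<Sum>i\<in>G. norm (C a1 b1 j1 i)) * \<rho> y)"
          using \<rho>0[of y] by (intro mult_left_mono u_le) auto
        also have "\<dots> = norm ((\<Sum>i\<in>G. norm (C a1 b1 j1 i)) *\<^sub>R w a b j y)"
          using \<rho>0[of y] by (simp add: sum_nonneg)
        finally show "norm (h i y $ b' * g i' y $ b') \<le> norm ((\<Sum>i\<in>G. norm (C a1 b1 j1 i)) *\<^sub>R w a b j y)" .
      qed
    qed
  qed
  show ?thesis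
  proof (rule exI[of _ I], rule exI[of _ g], rule exI[of _ h], intro conjI)
    show "finite I" using G by (simp add: I_def)
    show "\<forall>i\<in>I. square_integrable M (g i)" "\<forall>i\<in>I. h i \<in> borel_measurable M"
      "\<forall>i\<in>I. \<forall>j\<in>I. \<forall>b. integrable M (\<lambda>y. h i y $ b * g j y $ b)"
      using g2 hm hg by blast+
  next
    have "AE z in M \<Otimes>\<^sub>M M. \<forall>a\<in>UNIV. \<forall>b\<in>UNIV. k a b (fst z) (snd z) = (\<Sum>j\<in>G. u a b j (fst z) * w a b j (snd z))"
      using dec by (intro AE_finite_allI) (auto simp: u_def)
    then show "AE z in M \<Otimes>\<^sub>M M. \<forall>a b. cq_mat (K (fst z) (snd z)) $ a $ b = (\<Sum>i\<in>I. g i (fst z) $ a * h i (snd z) $ b)"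
    proof eventually_elim
      case (elim z)
      show ?case
      proof (intro allI)
        fix a b
        have "(\<Sum>i\<in>I. g i (fst z) $ a * h i (snd z) $ b) =
            (\<Sum>a'\<in>UNIV. \<Sum>b'\<in>UNIV. \<Sum>j\<in>G. g (a', b', j) (fst z) $ a * h (a', b', j) (snd z) $ b)"
          unfolding I_def by (simp add: sum.cartesian_product)
        also have "\<dots> = (\<Sum>j\<in>G. u a b j (fst z) * (w a b j (snd z) / complex_of_real (\<rho> (snd z))))"
          using exhaust_2[of a] exhaust_2[of b] by (auto simp: g_def h_def axis_def sum_2)
        also have "\<dots> = k a b (fst z) (snd z) / complex_of_real (\<rho> (snd z))"
          using elim by (simp add: sum_divide_distrib)
        also have "\<dots> = cq_mat (K (fst z) (snd z)) $ a $ b" using \<rho>0[of "snd z"] by (simp add: k_def)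
        finally show "cq_mat (K (fst z) (snd z)) $ a $ b = (\<Sum>i\<in>I. g i (fst z) $ a * h i (snd z) $ b)" by simp
      qed
    qed
  qed
qed

lemma finite_rank_kernel_decomposition:
  assumes "sigma_finite_measure M" and "finite_rank_kernel M K"
  obtains r :: nat and g h :: "nat \<Rightarrow> 'a \<Rightarrow> complex ^ 2" where
    "\<And>i. i < r \<Longrightarrow> square_integrable M (g i)" "\<And>i. i < r \<Longrightarrow> h i \<in> borel_measurable M"
    "\<And>i j b. i < r \<Longrightarrow> j < r \<Longrightarrow> integrable M (\<lambda>y. h i y $ b * g j y $ b)"
    "AE z in M \<Otimes>\<^sub>M M. \<forall>a b. cq_mat (K (fst z) (snd z)) $ a $ b = (\<Sum>i<r. g i (fst z) $ a * h i (snd z) $ b)"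
proof -
  obtain I :: "(2 \<times> 2 \<times> ('a \<Rightarrow> complex ^ 2)) set" and g h :: "_ \<Rightarrow> 'a \<Rightarrow> complex ^ 2" where I: "finite I"
    "\<forall>i\<in>I. square_integrable M (g i)" "\<forall>i\<in>I. h i \<in> borel_measurable M"
    "\<forall>i\<in>I. \<forall>j\<in>I. \<forall>b. integrable M (\<lambda>y. h i y $ b * g j y $ b)"
    "AE z in M \<Otimes>\<^sub>M M. \<forall>a b. cq_mat (K (fst z) (snd z)) $ a $ b = (\<Sum>i\<in>I. g i (fst z) $ a * h i (snd z) $ b)"
    using finite_rank_kernel_decomposition_index[OF assms] by blast
  obtain e where e: "bij_betw e {0..<card I} I" using ex_bij_betw_nat_finite[OF I(1)] by blast
  have eI: "i < card I \<Longrightarrow> e i \<in> I" for i using e by (auto simp: bij_betw_def)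
  have "(\<Sum>i\<in>I. f i) = (\<Sum>i<card I. f (e i))" for f :: "_ \<Rightarrow> complex"
    using sum.reindex_bij_betw[OF e, of f] by (simp add: atLeast0LessThan)
  then show ?thesis
    using I eI by (intro that[of "card I" "\<lambda>i. g (e i)" "\<lambda>i. h (e i)"]) auto
qed

section \<open>Locality of the Moore-Dyson determinant and its principal minors\<close>

lemma walk_cong:
  "(\<And>i j. i \<in> insert a (set xs) \<Longrightarrow> j \<in> insert b (set xs) \<Longrightarrow> X i j = Y i j) \<Longrightarrow> walk X a xs b = walk Y a xs b"
proof (induction xs arbitrary: a)
  case (Cons x xs)
  have "walk X x xs b = walk Y x xs b" by (rule Cons.IH) (use Cons.prems in auto)
  then show ?case using Cons.prems[of a x] by simp
qed simp

lemma det_MD_on_cong: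
  assumes "finite S" "\<And>i j. i \<in> S \<Longrightarrow> j \<in> S \<Longrightarrow> X i j = Y i j"
  shows "det_MD_on S X = det_MD_on S Y"
  using assms
proof (induction "card S" arbitrary: S rule: less_induct)
  case less
  show ?case
  proof (cases "S = {}")
    case False
    define m where "m = Max S"
    have m: "m \<in> S" "\<And>a. a \<in> S \<Longrightarrow> a \<le> m" using False less.prems by (auto simp: m_def)
    have "det_MD_on S X = (\<Sum>xs\<in>path_lists (S - {m}). (- 1) ^ length xs * walk X m xs m * det_MD_on (S - insert m (set xs)) X)"
      by (rule det_MD_on_rec[OF less.prems(1) m])
    also have "\<dots> = (\<Sum>xs\<in>path_lists (S - {m}). (- 1) ^ length xs * walk Y m xs m * det_MD_on (S - insert m (set xs)) Y)"
    proof (rule sum.cong[OF refl])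
      fix xs assume xs: "xs \<in> path_lists (S - {m})"
      have "walk X m xs m = walk Y m xs m"
        using xs m by (intro walk_cong less.prems(2)) (auto simp: path_lists_def)
      moreover have "det_MD_on (S - insert m (set xs)) X = det_MD_on (S - insert m (set xs)) Y"
      proof (rule less.hyps)
        show "card (S - insert m (set xs)) < card S"
          using m less.prems by (intro psubset_card_mono) auto
      qed (use less.prems in auto)
      ultimately show "(- 1) ^ length xs * walk X m xs m * det_MD_on (S - insert m (set xs)) X =
          (- 1) ^ length xs * walk Y m xs m * det_MD_on (S - insert m (set xs)) Y" by simp
    qed
    also have "\<dots> = det_MD_on S Y" by (rule det_MD_on_rec[OF less.prems(1) m, symmetric])
    finally show ?thesis .
  qed (simp add: det_MD_on_empty)
qed

text \<open>Transfers the scalar property from initial segments to minors with arbitrary indices; f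
  is the increasing enumeration of S and serves all X at once.\<close>

lemma det_MD_on_eq_det_MD:
  assumes "finite S"
  shows "\<exists>f :: nat \<Rightarrow> nat. (\<forall>i<card S. f i \<in> S) \<and>
    (\<forall>X. det_MD_on S X = det_MD (card S) (\<lambda>i j. X (f i) (f j)))"
proof -
  define f where "f i = sorted_list_of_set S ! i" for i
  have in_S: "f i \<in> S" if "i < card S" for i
    using that assms nth_mem[of i "sorted_list_of_set S"] by (simp add: f_def)
  have "strict_mono_on {..<card S} f"
    using sorted_wrt_nth_less[OF strict_sorted_list_of_set[of S]]
    by (auto simp: strict_mono_on_def f_def)
  moreover have "f ` {..<card S} = set (sorted_list_of_set S)"
    unfolding set_conv_nth by (auto simp: f_def)
  then have "f ` {..<card S} = S" using assms by simp
  ultimately have "det_MD_on S X = det_MD (card S) (\<lambda>i j. X (f i) (f j))" for X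
    using det_MD_on_image[of "{..<card S}" f X] by (simp add: det_MD_eq_on)
  then show ?thesis using in_S by blast
qed

section \<open>Newton's identities for the correlation functions\<close>

text \<open>Fubini's theorem for factors in disjoint sets of coordinates. Functions are defined on
  all families, so depending only on the coordinates in I is expressed as invariance under
  \<open>restrict\<close>.\<close>

lemma (in product_sigma_finite) PiM_split:
  fixes f g :: "('i \<Rightarrow> 'a) \<Rightarrow> complex"
  assumes IJ: "finite I" "finite J" "I \<inter> J = {}"
    and f: "integrable (Pi\<^sub>M I M) f" "\<And>x. f (restrict x I) = f x"
    and g: "integrable (Pi\<^sub>M J M) g" "\<And>x. g (restrict x J) = g x"
  shows "integrable (Pi\<^sub>M (I \<union> J) M) (\<lambda>x. f x * g x)"
    and "(LINT x|Pi\<^sub>M (I \<union> J) M. f x * g x) = (LINT x|Pi\<^sub>M I M. f x) * (LINT x|Pi\<^sub>M J M. g x)"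
proof -
  interpret I: sigma_finite_measure "Pi\<^sub>M I M" by (rule sigma_finite[OF IJ(1)])
  interpret J: sigma_finite_measure "Pi\<^sub>M J M" by (rule sigma_finite[OF IJ(2)])
  interpret P: pair_sigma_finite "Pi\<^sub>M I M" "Pi\<^sub>M J M" ..
  have merge_f: "f (merge I J (x, y)) = f x" for x y
    by (metis IJ(3) f(2) restrict_merge(1) Int_commute)
  have merge_g: "g (merge I J (x, y)) = g y" for x y
    by (metis IJ(3) g(2) restrict_merge(2) Int_commute)
  have [measurable]: "f \<in> borel_measurable (Pi\<^sub>M I M)" "g \<in> borel_measurable (Pi\<^sub>M J M)"
    using f g by auto
  have "integrable (Pi\<^sub>M I M \<Otimes>\<^sub>M Pi\<^sub>M J M) (\<lambda>z. f (fst z) * g (snd z))"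
  proof (rule P.Fubini_integrable)
    show "AE x in Pi\<^sub>M I M. integrable (Pi\<^sub>M J M) (\<lambda>y. f (fst (x, y)) * g (snd (x, y)))"
      using g by simp
    show "integrable (Pi\<^sub>M I M) (\<lambda>x. LINT y|Pi\<^sub>M J M. norm (f (fst (x, y)) * g (snd (x, y))))"
      using f g by (simp add: norm_mult)
  qed measurable
  then have int: "integrable (Pi\<^sub>M I M \<Otimes>\<^sub>M Pi\<^sub>M J M) (\<lambda>z. f (merge I J z) * g (merge I J z))"
    by (rule iffD1[OF Bochner_Integration.integrable_cong, rotated 2]) (auto simp: merge_f merge_g)
  have fI: "f \<in> borel_measurable (Pi\<^sub>M (I \<union> J) M)"
    using measurable_compose[OF measurable_restrict_subset[of I "I \<union> J" M] \<open>f \<in> _\<close>] by (simp add: f(2))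
  have gJ: "g \<in> borel_measurable (Pi\<^sub>M (I \<union> J) M)"
    using measurable_compose[OF measurable_restrict_subset[of J "I \<union> J" M] \<open>g \<in> _\<close>] by (simp add: g(2))
  have "integrable (distr (Pi\<^sub>M I M \<Otimes>\<^sub>M Pi\<^sub>M J M) (Pi\<^sub>M (I \<union> J) M) (merge I J)) (\<lambda>x. f x * g x)"
    using int fI gJ by (subst integrable_distr_eq) auto
  then show I: "integrable (Pi\<^sub>M (I \<union> J) M) (\<lambda>x. f x * g x)"
    by (simp add: distr_merge[OF IJ(3,1,2)])
  have "(LINT x|Pi\<^sub>M (I \<union> J) M. f x * g x) = (LINT x|Pi\<^sub>M I M. LINT y|Pi\<^sub>M J M. f x * g y)"
    using product_integral_fold[OF IJ(3,1,2) I] by (simp add: merge_f merge_g)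
  then show "(LINT x|Pi\<^sub>M (I \<union> J) M. f x * g x) = (LINT x|Pi\<^sub>M I M. f x) * (LINT x|Pi\<^sub>M J M. g x)"
    by simp
qed

text \<open>The remaining coordinates may carry infinite measure, so the image of the product
  measure under the pair (x i, x j) is in general not the product of two copies. Its null sets are
  still controlled, by integrating the indicator of a null set coordinate by coordinate.\<close>

lemma (in sigma_finite_measure) AE_PiM_pair:
  assumes ae: "AE z in M \<Otimes>\<^sub>M M. Q z" and I: "finite I" "i \<in> I" "j \<in> I" "i \<noteq> j"
  shows "AE x in Pi\<^sub>M I (\<lambda>_. M). Q (x i, x j)"
proof -
  interpret PS: product_sigma_finite "\<lambda>_. M" by unfold_locales
  obtain N where N: "N \<in> null_sets (M \<Otimes>\<^sub>M M)" "{z \<in> space (M \<Otimes>\<^sub>M M). \<not> Q z} \<subseteq> N"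
    using ae by (auto elim!: AE_E simp: null_sets_def)
  then have [measurable]: "N \<in> sets (M \<Otimes>\<^sub>M M)" by auto
  define L where "L = I - {i, j}"
  have I_eq: "I = insert i (insert j L)" using I by (auto simp: L_def)
  have L: "finite L" "i \<notin> insert j L" "j \<notin> L" using I by (auto simp: L_def)
  have [measurable]: "(\<lambda>x. x i) \<in> measurable (Pi\<^sub>M I (\<lambda>_. M)) M" "(\<lambda>x. x j) \<in> measurable (Pi\<^sub>M I (\<lambda>_. M)) M"
    "(\<lambda>x. x j) \<in> measurable (Pi\<^sub>M (insert j L) (\<lambda>_. M)) M"
    using I by (auto intro: measurable_component_singleton)
  have zero: "(\<integral>\<^sup>+b. \<integral>\<^sup>+a. indicator N (a, b) \<partial>M \<partial>M) = 0"
  proof -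
    interpret P: pair_sigma_finite M M ..
    have "(\<integral>\<^sup>+b. \<integral>\<^sup>+a. indicator N (a, b) \<partial>M \<partial>M) = (\<integral>\<^sup>+z. indicator N z \<partial>(M \<Otimes>\<^sub>M M))"
      using P.nn_integral_snd[of "indicator N"] by simp
    then show ?thesis using N by (simp add: null_sets_def)
  qed
  have "(\<integral>\<^sup>+x. indicator N (x i, x j) \<partial>Pi\<^sub>M I (\<lambda>_. M)) = (\<integral>\<^sup>+x. \<integral>\<^sup>+a. indicator N (a, x j) \<partial>M \<partial>Pi\<^sub>M (insert j L) (\<lambda>_. M))"
    unfolding I_eq using L I(4) by (subst PS.product_nn_integral_insert) (auto simp flip: I_eq)
  also have "\<dots> = (\<integral>\<^sup>+x. \<integral>\<^sup>+b. \<integral>\<^sup>+a. indicator N (a, b) \<partial>M \<partial>M \<partial>Pi\<^sub>M L (\<lambda>_. M))"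
    using L by (subst PS.product_nn_integral_insert) auto
  also have "\<dots> = 0" by (simp add: zero)
  finally have "AE x in Pi\<^sub>M I (\<lambda>_. M). indicator N (x i, x j) = (0 :: ennreal)"
    by (subst (asm) nn_integral_0_iff_AE) auto
  then show ?thesis
    using AE_space
  proof eventually_elim
    case (elim x)
    then have "(x i, x j) \<in> space (M \<Otimes>\<^sub>M M)" using I by (auto simp: space_PiM space_pair_measure)
    then show ?case using N elim by (auto simp: indicator_def split: if_splits)
  qed
qed

section \<open>Cycles as traces of products of pairing matrices\<close>

lemma cq_s_trace: "cq_s q = (cq_mat q $ 1 $ 1 + cq_mat q $ 2 $ 2) / 2"
  by (simp add: cq_mat_def)

lemma cq_s_sum: "cq_s (\<Sum>i\<in>I. f i) = (\<Sum>i\<in>I. cq_s (f i))"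
  by (induction I rule: infinite_finite_induct) (auto simp: zero_cquat_def plus_cquat_def)

lemma cq_s_uminus: "cq_s (- q) = - cq_s q"
  by (simp add: uminus_cquat_def)

lemma cq_s_sign: "cq_s ((- 1) ^ n * q) = (- 1) ^ n * cq_s q"
  by (simp add: minus_one_power_iff cq_s_uminus)

lemma cq_s_mult_scalar: "cq_s (q * cq_of_complex c) = cq_s q * c"
  by (simp add: times_cquat_def cq_of_complex_def)

lemma cq_s_of_complex: "cq_s (cq_of_complex c) = c"
  by (simp add: cq_of_complex_def)

lemma cq_s_one: "cq_s 1 = 1"
  by (simp add: one_cquat_def)

text \<open>Products of the matrices \<open>n c\<close>; each factor depends on its own integration variable, so that the
  integral of such a product is a power of one matrix.\<close>

primrec chain :: "nat \<Rightarrow> ('c \<Rightarrow> nat \<Rightarrow> nat \<Rightarrow> complex) \<Rightarrow> 'c list \<Rightarrow> nat \<Rightarrow> nat \<Rightarrow> complex" where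
  "chain r n [] i j = (if i = j then 1 else 0)"
| "chain r n (c # cs) i j = (\<Sum>l<r. n c i l * chain r n cs l j)"

lemma chain_cong:
  "(\<And>c i j. c \<in> set cs \<Longrightarrow> n c i j = n' c i j) \<Longrightarrow> chain r n cs i j = chain r n' cs i j"
proof (induction cs arbitrary: i)
  case (Cons c cs)
  then show ?case by (simp add: Cons.IH)
qed simp

lemma chain_weight:
  "distinct cs \<Longrightarrow> (\<Prod>c\<in>set cs. t c) * chain r n cs i j = chain r (\<lambda>c i j. t c * n c i j) cs i j"
proof (induction cs arbitrary: i)
  case (Cons c cs)
  then have "(\<Prod>c\<in>set cs. t c) * chain r n cs l j = chain r (\<lambda>c i j. t c * n c i j) cs l j" for l by simp
  then show ?case using Cons.prems by (simp add: sum_distrib_left mult_ac flip: Cons.IH)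
qed simp

text \<open>The factor H that ends one step and the factor G that starts the next sit at the same
  point c; summing over the matrix index \<open>\<gamma>\<close> gives a matrix that depends on c
  alone. The factorization is only demanded off the diagonal, and the third assumption excludes the
  walk that is a single diagonal entry.\<close>

lemma walk_chain:
  fixes X :: "'c \<Rightarrow> 'c \<Rightarrow> cquat"
  assumes "distinct (a # xs)" "b \<notin> set xs" "xs \<noteq> [] \<or> a \<noteq> b"
    and "\<And>i j \<alpha> \<beta>. i \<in> insert a (insert b (set xs)) \<Longrightarrow> j \<in> insert a (insert b (set xs)) \<Longrightarrow> i \<noteq> j \<Longrightarrow>
      cq_mat (X i j) $ \<alpha> $ \<beta> = (\<Sum>l<r. G i l $ \<alpha> * H j l $ \<beta>)"
  shows "cq_mat (walk X a xs b) $ \<alpha> $ \<beta> =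
    (\<Sum>l<r. \<Sum>l'<r. G a l $ \<alpha> * chain r (\<lambda>c i j. \<Sum>\<gamma>\<in>UNIV. H c i $ \<gamma> * G c j $ \<gamma>) xs l l' * H b l' $ \<beta>)"
  using assms
proof (induction xs arbitrary: a \<alpha>)
  case Nil
  have "(\<Sum>l<r. \<Sum>l'<r. G a l $ \<alpha> * (if l = l' then 1 else 0) * H b l' $ \<beta>) = (\<Sum>l<r. G a l $ \<alpha> * H b l $ \<beta>)"
    by (intro sum.cong refl) (simp add: if_distrib if_distribR sum.delta' cong: if_cong)
  then show ?case using Nil.prems(4)[of a b] Nil.prems(3) by simp
next
  case (Cons c cs)
  let ?n = "\<lambda>c i j. \<Sum>\<gamma>\<in>UNIV. H c i $ \<gamma> * G c j $ \<gamma>"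
  have IH: "cq_mat (walk X c cs b) $ \<gamma> $ \<beta> = (\<Sum>l1<r. \<Sum>l'<r. G c l1 $ \<gamma> * chain r ?n cs l1 l' * H b l' $ \<beta>)" for \<gamma>
    by (rule Cons.IH) (use Cons.prems in auto)
  have X: "cq_mat (X a c) $ \<alpha> $ \<gamma> = (\<Sum>l<r. G a l $ \<alpha> * H c l $ \<gamma>)" for \<gamma>
    by (rule Cons.prems(4)) (use Cons.prems(1) in auto)
  have "cq_mat (walk X a (c # cs) b) $ \<alpha> $ \<beta> =
      (\<Sum>\<gamma>\<in>UNIV. (\<Sum>l<r. G a l $ \<alpha> * H c l $ \<gamma>) * (\<Sum>l1<r. \<Sum>l'<r. G c l1 $ \<gamma> * chain r ?n cs l1 l' * H b l' $ \<beta>))"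
    by (simp add: cq_mat_mult matrix_matrix_mult_def X IH)
  also have "\<dots> = (\<Sum>\<gamma>\<in>UNIV. \<Sum>l<r. \<Sum>l1<r. \<Sum>l'<r. G a l $ \<alpha> * (H c l $ \<gamma> * G c l1 $ \<gamma>) * chain r ?n cs l1 l' * H b l' $ \<beta>)"
    by (simp only: sum_product) (simp only: sum_distrib_left mult_ac)
  also have "\<dots> = (\<Sum>l<r. \<Sum>l1<r. \<Sum>l'<r. \<Sum>\<gamma>\<in>UNIV. G a l $ \<alpha> * (H c l $ \<gamma> * G c l1 $ \<gamma>) * chain r ?n cs l1 l' * H b l' $ \<beta>)"
    by (subst sum.swap, rule sum.cong[OF refl], subst sum.swap, rule sum.cong[OF refl], subst sum.swap, rule refl)
  also have "\<dots> = (\<Sum>l<r. \<Sum>l1<r. \<Sum>l'<r. G a l $ \<alpha> * (?n c l l1 * chain r ?n cs l1 l') * H b l' $ \<beta>)"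
    by (simp add: sum_distrib_left sum_distrib_right mult_ac)
  also have "\<dots> = (\<Sum>l<r. \<Sum>l'<r. \<Sum>l1<r. G a l $ \<alpha> * (?n c l l1 * chain r ?n cs l1 l') * H b l' $ \<beta>)"
    by (rule sum.cong[OF refl], rule sum.swap)
  also have "\<dots> = (\<Sum>l<r. \<Sum>l'<r. G a l $ \<alpha> * chain r ?n (c # cs) l l' * H b l' $ \<beta>)"
    by (simp only: chain.simps sum_distrib_left sum_distrib_right)
  finally show ?case .
qed

text \<open>Taking the trace joins the two loose ends at m, so that m contributes a matrix like
  every other point of the cycle. The division by 2 reflects that \<open>cq_s\<close> is half a
  trace.\<close>

lemma cycle_chain:
  fixes X :: "'c \<Rightarrow> 'c \<Rightarrow> cquat"
  assumes "distinct (m # xs)" "xs \<noteq> []"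
    and "\<And>i j \<alpha> \<beta>. i \<in> set (m # xs) \<Longrightarrow> j \<in> set (m # xs) \<Longrightarrow> i \<noteq> j \<Longrightarrow>
      cq_mat (X i j) $ \<alpha> $ \<beta> = (\<Sum>l<r. G i l $ \<alpha> * H j l $ \<beta>)"
  shows "cq_s (walk X m xs m) =
    (\<Sum>l<r. chain r (\<lambda>c i j. \<Sum>\<gamma>\<in>UNIV. H c i $ \<gamma> * G c j $ \<gamma>) (m # xs) l l) / 2"
proof -
  let ?n = "\<lambda>c i j. \<Sum>\<gamma>\<in>UNIV. H c i $ \<gamma> * G c j $ \<gamma>"
  have W: "cq_mat (walk X m xs m) $ \<alpha> $ \<alpha> = (\<Sum>l<r. \<Sum>l'<r. G m l $ \<alpha> * chain r ?n xs l l' * H m l' $ \<alpha>)" for \<alpha>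
    by (rule walk_chain) (use assms in auto)
  have "2 * cq_s (walk X m xs m) = (\<Sum>\<alpha>\<in>UNIV. cq_mat (walk X m xs m) $ \<alpha> $ \<alpha>)"
    by (simp add: cq_s_trace sum_2)
  also have "\<dots> = (\<Sum>l<r. \<Sum>l'<r. \<Sum>\<alpha>\<in>UNIV. G m l $ \<alpha> * chain r ?n xs l l' * H m l' $ \<alpha>)"
    unfolding W by (subst sum.swap, rule sum.cong[OF refl], rule sum.swap)
  also have "\<dots> = (\<Sum>l<r. \<Sum>l'<r. ?n m l' l * chain r ?n xs l l')"
    by (simp add: sum_distrib_right mult_ac)
  also have "\<dots> = (\<Sum>l'<r. \<Sum>l<r. ?n m l' l * chain r ?n xs l l')"
    by (rule sum.swap)
  also have "\<dots> = (\<Sum>l<r. chain r ?n (m # xs) l l)" by simp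
  finally show ?thesis by (simp del: chain.simps add: mult.commute[of _ 2])
qed

text \<open>The quotient of factorials counts the lists of s distinct elements of B; it becomes the
  coefficient in Newton's identities.\<close>

lemma sum_path_lists_length:
  fixes f :: "nat \<Rightarrow> complex"
  assumes "finite B"
  shows "(\<Sum>xs\<in>path_lists B. f (length xs)) = (\<Sum>s\<le>card B. fact (card B) / fact (card B - s) * f s)"
proof -
  have "(\<Sum>xs\<in>path_lists B. f (length xs)) = (\<Sum>s\<le>card B. \<Sum>xs | xs \<in> path_lists B \<and> length xs = s. f (length xs))"
  proof (rule sum.group[symmetric])
    show "length ` path_lists B \<subseteq> {..card B}"
      using assms by (auto simp: path_lists_def) (metis card_mono distinct_card)
  qed (use assms finite_path_lists in auto)
  also have "\<dots> = (\<Sum>s\<le>card B. fact (card B) / fact (card B - s) * f s)"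
  proof (rule sum.cong[OF refl])
    fix s assume "s \<in> {..card B}"
    then have s: "s \<le> card B" by simp
    have "{xs. xs \<in> path_lists B \<and> length xs = s} = {xs. length xs = s \<and> distinct xs \<and> set xs \<subseteq> B}"
      by (auto simp: path_lists_def)
    then have "card {xs. xs \<in> path_lists B \<and> length xs = s} = fact (card B) div fact (card B - s)"
      using card_lists_distinct_length_eq[OF assms s] by (simp add: fact_div_fact)
    moreover have "(of_nat (fact (card B) div fact (card B - s)) :: complex) = fact (card B) / fact (card B - s)"
    proof -
      have "fact (card B - s) * (fact (card B) div fact (card B - s)) = (fact (card B) :: nat)"
        by (intro dvd_mult_div_cancel fact_dvd) simp
      then have "(of_nat (fact (card B - s) * (fact (card B) div fact (card B - s))) :: complex) = of_nat (fact (card B))"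
        by (simp only:)
      then show ?thesis by (simp add: field_simps)
    qed
    ultimately show "(\<Sum>xs | xs \<in> path_lists B \<and> length xs = s. f (length xs)) = fact (card B) / fact (card B - s) * f s"
      by simp
  qed
  finally show ?thesis .
qed

text \<open>The decomposition \<open>dec\<close> says nothing about the diagonal when \<open>M\<close> has no atoms. The one-point
  function therefore enters separately, and \<open>power_trace 1\<close> need not be a trace of \<open>op_mat\<close>.\<close>

locale pfaffian_window = sigma_finite_measure M for M :: "'a measure" +
  fixes K :: "'a \<Rightarrow> 'a \<Rightarrow> cquat" and A :: "'a set" and r :: nat and g h :: "nat \<Rightarrow> 'a \<Rightarrow> complex ^ 2"
  assumes A[measurable]: "A \<in> sets M"
    and K_measurable: "(\<lambda>(x, y). cq_mat (K x y)) \<in> borel_measurable (M \<Otimes>\<^sub>M M)"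
    and diag: "integrable M (\<lambda>x. indicator A x * cq_s (K x x))"
    and hg: "\<And>i j b. i < r \<Longrightarrow> j < r \<Longrightarrow> integrable M (\<lambda>y. h i y $ b * g j y $ b)"
    and dec: "AE z in M \<Otimes>\<^sub>M M. \<forall>a b. cq_mat (K (fst z) (snd z)) $ a $ b = (\<Sum>i<r. g i (fst z) $ a * h i (snd z) $ b)"
    and scalar: "\<And>k x. (\<And>i. i < k \<Longrightarrow> x i \<in> space M) \<Longrightarrow> \<exists>c. det_MD k (\<lambda>i j. K (x i) (x j)) = cq_of_complex c"
begin

sublocale PS: product_sigma_finite "\<lambda>_ :: nat. M"
  by unfold_locales

definition N :: "nat \<Rightarrow> nat \<Rightarrow> 'a \<Rightarrow> complex" where
  "N i j y = indicator A y * (\<Sum>b\<in>UNIV. h i y $ b * g j y $ b)"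

text \<open>The pairings of the \<open>h i\<close> with the \<open>g j\<close> over A; the traces of
  powers of this matrix stand in for those of the operator cut down to A.\<close>

definition op_mat :: "nat \<Rightarrow> nat \<Rightarrow> complex" where
  "op_mat i j = (LINT y|M. N i j y)"

definition power_trace :: "nat \<Rightarrow> complex" where
  "power_trace s = (if s = 1 then LINT x|M. indicator A x * cq_s (K x x)
     else (\<Sum>i<r. fun_mat_pow r op_mat s i i) / 2)"

definition weight :: "nat set \<Rightarrow> (nat \<Rightarrow> 'a) \<Rightarrow> complex" where
  "weight S x = (\<Prod>i\<in>S. indicator A (x i))"

definition corr :: "nat set \<Rightarrow> (nat \<Rightarrow> 'a) \<Rightarrow> complex" where
  "corr S x = weight S x * cq_s (det_MD_on S (\<lambda>i j. K (x i) (x j)))"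

definition cyc :: "nat \<Rightarrow> nat list \<Rightarrow> (nat \<Rightarrow> 'a) \<Rightarrow> complex" where
  "cyc m xs x = weight (set (m # xs)) x * cq_s (walk (\<lambda>i j. K (x i) (x j)) m xs m)"

text \<open>For a Pfaffian field, the k-th factorial moment of the number of points in A.\<close>

definition moment :: "nat \<Rightarrow> complex" where
  "moment k = (LINT x|Pi\<^sub>M {..<k} (\<lambda>_. M). corr {..<k} x)"

section \<open>Integrals of cycles and minors over a window\<close>

lemma integrable_N: "i < r \<Longrightarrow> j < r \<Longrightarrow> integrable M (N i j)"
  unfolding N_def[abs_def] indicator_mult_complex
  by (intro integrable_mult_indicator Bochner_Integration.integrable_sum hg A)

lemma corr_restrict: "finite S \<Longrightarrow> corr S (restrict x S) = corr S x"
  using det_MD_on_cong[of S "\<lambda>i j. K (restrict x S i) (restrict x S j)" "\<lambda>i j. K (x i) (x j)"]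
  by (simp add: corr_def weight_def)

lemma cyc_restrict: "cyc m xs (restrict x (set (m # xs))) = cyc m xs x"
proof -
  have "walk (\<lambda>i j. K (restrict x (set (m # xs)) i) (restrict x (set (m # xs)) j)) m xs m = walk (\<lambda>i j. K (x i) (x j)) m xs m"
    by (rule walk_cong) auto
  moreover have "weight (set (m # xs)) (restrict x (set (m # xs))) = weight (set (m # xs)) x"
    unfolding weight_def by (rule prod.cong) auto
  ultimately show ?thesis by (simp only: cyc_def)
qed

text \<open>The scalar part of walk times minor factors because the minor is itself a scalar: by
  enumerating its indices increasingly, \<open>scalar\<close> applies to it.\<close>

lemma corr_rec:
  assumes S: "finite S" "m \<in> S" "\<And>a. a \<in> S \<Longrightarrow> a \<le> m" and x: "\<And>i. i \<in> S \<Longrightarrow> x i \<in> space M"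
  shows "corr S x = (\<Sum>xs\<in>path_lists (S - {m}). (- 1) ^ length xs * (cyc m xs x * corr (S - insert m (set xs)) x))"
proof -
  let ?X = "\<lambda>i j. K (x i) (x j)"
  have sc: "det_MD_on S' ?X = cq_of_complex (cq_s (det_MD_on S' ?X))" if S': "S' \<subseteq> S" for S'
  proof -
    have "finite S'" using S' S(1) by (rule finite_subset)
    from det_MD_on_eq_det_MD[OF this]
    obtain f where f: "\<forall>i<card S'. f i \<in> S'" "\<forall>X. det_MD_on S' X = det_MD (card S') (\<lambda>i j. X (f i) (f j))"
      by blast
    obtain c where "det_MD (card S') (\<lambda>i j. K (x (f i)) (x (f j))) = cq_of_complex c"
      using scalar[of "card S'" "\<lambda>i. x (f i)"] f(1) x S' by blast
    moreover have "det_MD_on S' ?X = det_MD (card S') (\<lambda>i j. K (x (f i)) (x (f j)))"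
      using f(2) by simp
    ultimately show ?thesis by (simp add: cq_s_of_complex)
  qed
  have "corr S x = (\<Sum>xs\<in>path_lists (S - {m}). weight S x * cq_s ((- 1) ^ length xs * walk ?X m xs m * det_MD_on (S - insert m (set xs)) ?X))"
  proof -
    have "det_MD_on S ?X = (\<Sum>xs\<in>path_lists (S - {m}). (- 1) ^ length xs * walk ?X m xs m * det_MD_on (S - insert m (set xs)) ?X)"
      by (rule det_MD_on_rec) (use S in auto)
    then show ?thesis by (simp only: corr_def cq_s_sum sum_distrib_left)
  qed
  also have "\<dots> = (\<Sum>xs\<in>path_lists (S - {m}). (- 1) ^ length xs * (cyc m xs x * corr (S - insert m (set xs)) x))"
  proof (rule sum.cong[OF refl])
    fix xs assume xs: "xs \<in> path_lists (S - {m})"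
    define S' where "S' = S - insert m (set xs)"
    have "S = set (m # xs) \<union> S'" using xs S by (auto simp: S'_def path_lists_def)
    then have w: "weight S x = weight (set (m # xs)) x * weight S' x"
      using S(1) unfolding weight_def by (simp only:) (rule prod.union_disjoint, auto simp: S'_def)
    define c where "c = cq_s (det_MD_on S' ?X)"
    have "cq_s ((- 1) ^ length xs * walk ?X m xs m * det_MD_on S' ?X) = (- 1) ^ length xs * (cq_s (walk ?X m xs m) * c)"
    proof -
      have "det_MD_on S' ?X = cq_of_complex c" unfolding c_def by (rule sc) (simp add: S'_def)
      then show ?thesis by (simp only: mult.assoc cq_s_sign cq_s_mult_scalar)
    qed
    then show "weight S x * cq_s ((- 1) ^ length xs * walk ?X m xs m * det_MD_on (S - insert m (set xs)) ?X) =
        (- 1) ^ length xs * (cyc m xs x * corr (S - insert m (set xs)) x)"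
      unfolding S'_def[symmetric] cyc_def corr_def c_def[symmetric] w by (simp add: mult_ac)
  qed
  finally show ?thesis .
qed

lemma chain_integral:
  fixes cs :: "nat list"
  assumes "distinct cs" "i < r" "j < r"
  shows "integrable (Pi\<^sub>M (set cs) (\<lambda>_. M)) (\<lambda>x. chain r (\<lambda>c i j. N i j (x c)) cs i j) \<and>
    (LINT x|Pi\<^sub>M (set cs) (\<lambda>_. M). chain r (\<lambda>c i j. N i j (x c)) cs i j) = fun_mat_pow r op_mat (length cs) i j"
  using assms
proof (induction cs arbitrary: i)
  case Nil
  then show ?case by (simp add: PiM_empty integrable_count_space lebesgue_integral_count_space_finite)
next
  case (Cons c cs)
  define C where "C l x = chain r (\<lambda>c i j. N i j (x c)) cs l j" for l x
  have C: "integrable (Pi\<^sub>M (set cs) (\<lambda>_. M)) (C l)" "(LINT x|Pi\<^sub>M (set cs) (\<lambda>_. M). C l x) = fun_mat_pow r op_mat (length cs) l j" if "l < r" for l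
    using Cons.IH[of l] Cons.prems that by (auto simp: C_def[abs_def])
  have C_restrict: "C l (restrict x (set cs)) = C l x" for l x
    unfolding C_def by (rule chain_cong) simp
  have N1: "integrable (Pi\<^sub>M {c} (\<lambda>_. M)) (\<lambda>x. N i l (x c))" "(LINT x|Pi\<^sub>M {c} (\<lambda>_. M). N i l (x c)) = op_mat i l" if "l < r" for l
  proof -
    have int: "integrable M (N i l)" using integrable_N Cons.prems that by simp
    then have meas: "N i l \<in> borel_measurable M" by simp
    have "integrable (distr (Pi\<^sub>M {c} (\<lambda>_. M)) M (\<lambda>x. x c)) (N i l)"
      using PS.distr_singleton[of c] int by (simp add: integrable_distr_eq)
    then show "integrable (Pi\<^sub>M {c} (\<lambda>_. M)) (\<lambda>x. N i l (x c))"
      using meas by (subst (asm) integrable_distr_eq) auto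
    show "(LINT x|Pi\<^sub>M {c} (\<lambda>_. M). N i l (x c)) = op_mat i l"
      unfolding op_mat_def by (rule PS.product_integral_singleton[OF meas])
  qed
  have split: "integrable (Pi\<^sub>M (set (c # cs)) (\<lambda>_. M)) (\<lambda>x. N i l (x c) * C l x)"
    "(LINT x|Pi\<^sub>M (set (c # cs)) (\<lambda>_. M). N i l (x c) * C l x) = op_mat i l * fun_mat_pow r op_mat (length cs) l j" if "l < r" for l
    using PS.PiM_split[of "{c}" "set cs" "\<lambda>x. N i l (x c)" "C l"] Cons.prems N1[OF that] C[OF that] C_restrict
    by auto
  have eq: "(\<lambda>x. chain r (\<lambda>c i j. N i j (x c)) (c # cs) i j) = (\<lambda>x. \<Sum>l<r. N i l (x c) * C l x)"
    by (simp add: C_def)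
  show ?case
    unfolding eq using split
    by (auto simp: Bochner_Integration.integral_sum intro!: Bochner_Integration.integrable_sum)
qed

lemma walk_measurable:
  assumes "set (a # xs) \<subseteq> S" "b \<in> S"
  shows "(\<lambda>x. cq_mat (walk (\<lambda>i j. K (x i) (x j)) a xs b) $ \<alpha> $ \<beta>) \<in> borel_measurable (Pi\<^sub>M S (\<lambda>_. M))"
  using assms
proof (induction xs arbitrary: a \<alpha>)
  have K: "(\<lambda>x. cq_mat (K (x i) (x j)) $ \<alpha> $ \<beta>) \<in> borel_measurable (Pi\<^sub>M S (\<lambda>_. M))" if "i \<in> S" "j \<in> S" for i j \<alpha> \<beta>
  proof -
    have "(\<lambda>x. (x i, x j)) \<in> measurable (Pi\<^sub>M S (\<lambda>_. M)) (M \<Otimes>\<^sub>M M)"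
      using that by (intro measurable_Pair measurable_component_singleton)
    from measurable_compose[OF this K_measurable]
    have "(\<lambda>x. cq_mat (K (x i) (x j))) \<in> borel_measurable (Pi\<^sub>M S (\<lambda>_. M))" by simp
    then show ?thesis by (intro borel_measurable_vec_nth_comp)
  qed
  {
    case Nil
    then show ?case using K by simp
  next
    case (Cons c cs)
    then show ?case
      using K by (simp add: cq_mat_mult matrix_matrix_mult_def)
  }
qed

text \<open>A fixed point evaluates K on the diagonal and gives the special value of
  \<open>power_trace\<close> at 1. A longer cycle visits pairs of distinct coordinates only, so the
  factorization can be inserted almost everywhere.\<close>

lemma cyc_integral:
  assumes dist: "distinct (m # xs)"
  shows "integrable (Pi\<^sub>M (set (m # xs)) (\<lambda>_. M)) (cyc m xs) \<and>
    (LINT x|Pi\<^sub>M (set (m # xs)) (\<lambda>_. M). cyc m xs x) = power_trace (Suc (length xs))"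
proof (cases "xs = []")
  case True
  let ?f = "\<lambda>y. indicator A y * cq_s (K y y)"
  have eq: "cyc m xs = (\<lambda>x. ?f (x m))" by (auto simp: cyc_def weight_def True)
  have meas: "?f \<in> borel_measurable M" using diag by simp
  have "integrable (distr (Pi\<^sub>M {m} (\<lambda>_. M)) M (\<lambda>x. x m)) ?f"
    using PS.distr_singleton[of m] diag by simp
  then have "integrable (Pi\<^sub>M {m} (\<lambda>_. M)) (\<lambda>x. ?f (x m))"
    using meas by (subst (asm) integrable_distr_eq) auto
  moreover have "(LINT x|Pi\<^sub>M {m} (\<lambda>_. M). ?f (x m)) = power_trace 1"
    unfolding power_trace_def using PS.product_integral_singleton[OF meas] by simp
  ultimately show ?thesis unfolding eq using True by simp
next
  case False
  let ?P = "Pi\<^sub>M (set (m # xs)) (\<lambda>_. M)"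
  define F where "F x = (\<Sum>l<r. chain r (\<lambda>c i j. N i j (x c)) (m # xs) l l) / 2" for x
  have ae: "AE x in ?P. \<forall>i\<in>set (m # xs). \<forall>j\<in>set (m # xs). i \<noteq> j \<longrightarrow>
      (\<forall>a b. cq_mat (K (x i) (x j)) $ a $ b = (\<Sum>l<r. g l (x i) $ a * h l (x j) $ b))"
  proof (intro AE_finite_allI)
    fix i j assume ij: "i \<in> set (m # xs)" "j \<in> set (m # xs)"
    show "AE x in ?P. i \<noteq> j \<longrightarrow> (\<forall>a b. cq_mat (K (x i) (x j)) $ a $ b = (\<Sum>l<r. g l (x i) $ a * h l (x j) $ b))"
    proof (cases "i = j")
      case False
      then show ?thesis using AE_PiM_pair[OF dec _ ij False] by simp
    qed simp
  qed simp_all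
  have eq: "AE x in ?P. F x = cyc m xs x"
    using ae
  proof eventually_elim
    case (elim x)
    let ?n = "\<lambda>c i j. \<Sum>\<gamma>\<in>UNIV. h i (x c) $ \<gamma> * g j (x c) $ \<gamma>"
    have "cq_s (walk (\<lambda>i j. K (x i) (x j)) m xs m) = (\<Sum>l<r. chain r ?n (m # xs) l l) / 2"
      by (rule cycle_chain[where G = "\<lambda>i l. g l (x i)" and H = "\<lambda>j l. h l (x j)"])
        (use dist False elim in auto)
    then have "cyc m xs x = (\<Sum>l<r. weight (set (m # xs)) x * chain r ?n (m # xs) l l) / 2"
      by (simp only: cyc_def sum_distrib_left times_divide_eq_right)
    also have "\<dots> = F x"
      unfolding F_def weight_def chain_weight[OF dist] N_def ..
    finally show ?case by simp
  qed
  have chain: "integrable ?P (\<lambda>x. chain r (\<lambda>c i j. N i j (x c)) (m # xs) l l)"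
    "(LINT x|?P. chain r (\<lambda>c i j. N i j (x c)) (m # xs) l l) = fun_mat_pow r op_mat (length (m # xs)) l l" if "l < r" for l
    using chain_integral[OF dist that that] by auto
  have F: "integrable ?P F" unfolding F_def[abs_def]
    using chain by (intro integrable_divide Bochner_Integration.integrable_sum) auto
  have intF: "(LINT x|?P. F x) = power_trace (Suc (length xs))"
    unfolding F_def power_trace_def using chain False
    by (simp add: Bochner_Integration.integral_sum del: chain.simps fun_mat_pow.simps)
  \<comment> \<open>Equality with F almost everywhere does not provide measurability, so this is
    derived from the measurability of K.\<close>
  have meas: "cyc m xs \<in> borel_measurable ?P"
  proof -
    have [measurable]: "(\<lambda>x. x i) \<in> measurable ?P M" if "i \<in> set (m # xs)" for i
      using that by (rule measurable_component_singleton)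
    have "(\<lambda>x. weight (set (m # xs)) x) \<in> borel_measurable ?P"
      unfolding weight_def by (intro borel_measurable_prod) measurable
    moreover have "(\<lambda>x. cq_s (walk (\<lambda>i j. K (x i) (x j)) m xs m)) \<in> borel_measurable ?P"
      unfolding cq_s_trace
      by (intro borel_measurable_divide borel_measurable_add walk_measurable borel_measurable_const) auto
    ultimately show ?thesis unfolding cyc_def[abs_def] by (rule borel_measurable_times)
  qed
  show ?thesis
    using integrable_cong_AE_imp[OF F meas] integral_cong_AE[OF borel_measurable_integrable[OF F] meas eq] eq intF
    by (auto simp: eq_commute)
qed

text \<open>A cycle and its complementary minor use disjoint coordinates, so each term of the
  expansion integrates to a product that depends on the length of the cycle alone. The induction
  hypothesis is a premise, because the step is used for a general S and for the initial segment of
  the same size.\<close>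

lemma corr_integral_step:
  assumes S: "finite S" "card S = Suc k"
    and IH: "\<And>S'. finite S' \<Longrightarrow> card S' < card S \<Longrightarrow>
      integrable (Pi\<^sub>M S' (\<lambda>_. M)) (corr S') \<and> (LINT x|Pi\<^sub>M S' (\<lambda>_. M). corr S' x) = moment (card S')"
  shows "integrable (Pi\<^sub>M S (\<lambda>_. M)) (corr S) \<and> (LINT x|Pi\<^sub>M S (\<lambda>_. M). corr S x) =
    (\<Sum>s\<le>k. (- 1) ^ s * (fact k / fact (k - s)) * power_trace (Suc s) * moment (k - s))"
proof -
  let ?P = "Pi\<^sub>M S (\<lambda>_. M)"
  define m where "m = Max S"
  have "S \<noteq> {}" using S by auto
  then have m: "m \<in> S" "\<And>a. a \<in> S \<Longrightarrow> a \<le> m" using S(1) by (auto simp: m_def)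
  have card: "card (S - {m}) = k" using S m by simp
  define tm where "tm xs x = (- 1) ^ length xs * (cyc m xs x * corr (S - insert m (set xs)) x)" for xs x
  have t: "integrable ?P (tm xs) \<and> (LINT x|?P. tm xs x) = (- 1) ^ length xs * (power_trace (Suc (length xs)) * moment (k - length xs))"
    if xs: "xs \<in> path_lists (S - {m})" for xs
  proof -
    define S' where "S' = S - insert m (set xs)"
    have dist: "distinct (m # xs)" using xs by (auto simp: path_lists_def)
    have S_eq: "set (m # xs) \<union> S' = S" using xs m by (auto simp: S'_def path_lists_def)
    have disj: "set (m # xs) \<inter> S' = {}" by (auto simp: S'_def)
    have fin': "finite S'" using S by (simp add: S'_def)
    have "card S = card (set (m # xs)) + card S'"
      using card_Un_disjoint[of "set (m # xs)" S'] disj fin' S_eq by simp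
    then have cS': "card S' = k - length xs" "card S' < card S"
      using distinct_card[OF dist] S by auto
    have "integrable ?P (\<lambda>x. cyc m xs x * corr S' x) \<and>
        (LINT x|?P. cyc m xs x * corr S' x) = power_trace (Suc (length xs)) * moment (k - length xs)"
      using PS.PiM_split[OF _ fin' disj, of "cyc m xs" "corr S'"] cyc_integral[OF dist] IH[OF fin' cS'(2)]
        cyc_restrict[of m xs] corr_restrict[OF fin'] cS'(1)
      unfolding S_eq by simp
    then show ?thesis
      unfolding tm_def[abs_def] S'_def[symmetric] by simp
  qed
  have eq: "corr S x = (\<Sum>xs\<in>path_lists (S - {m}). tm xs x)" if "x \<in> space ?P" for x
    unfolding tm_def by (rule corr_rec) (use S m that in \<open>auto simp: space_PiM\<close>)
  have int: "integrable ?P (\<lambda>x. \<Sum>xs\<in>path_lists (S - {m}). tm xs x)"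
    using t by (intro Bochner_Integration.integrable_sum) auto
  have "integrable ?P (corr S)"
    using int by (rule iffD1[OF Bochner_Integration.integrable_cong, rotated 2]) (auto simp: eq)
  moreover have "(LINT x|?P. corr S x) = (\<Sum>s\<le>k. (- 1) ^ s * (fact k / fact (k - s)) * power_trace (Suc s) * moment (k - s))"
  proof -
    have "(LINT x|?P. corr S x) = (LINT x|?P. (\<Sum>xs\<in>path_lists (S - {m}). tm xs x))"
      by (rule Bochner_Integration.integral_cong) (auto simp: eq)
    also have "\<dots> = (\<Sum>xs\<in>path_lists (S - {m}). (LINT x|?P. tm xs x))"
      using t by (intro Bochner_Integration.integral_sum) auto
    also have "\<dots> = (\<Sum>xs\<in>path_lists (S - {m}). (- 1) ^ length xs * (power_trace (Suc (length xs)) * moment (k - length xs)))"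
      using t by (intro sum.cong) auto
    also have "\<dots> = (\<Sum>s\<le>k. fact k / fact (k - s) * ((- 1) ^ s * (power_trace (Suc s) * moment (k - s))))"
      using sum_path_lists_length[of "S - {m}" "\<lambda>s. (- 1) ^ s * (power_trace (Suc s) * moment (k - s))"] S card by simp
    finally show ?thesis by (simp add: mult_ac)
  qed
  ultimately show ?thesis by blast
qed

text \<open>S and the initial segment of the same size satisfy the same recursion, so the integral
  depends on S only through its cardinality.\<close>

lemma corr_integral:
  assumes "finite S"
  shows "integrable (Pi\<^sub>M S (\<lambda>_. M)) (corr S) \<and> (LINT x|Pi\<^sub>M S (\<lambda>_. M). corr S x) = moment (card S)"
  using assms
proof (induction "card S" arbitrary: S rule: less_induct)
  case less
  show ?case
  proof (cases "card S")
    case 0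
    then have "S = {}" using less.prems by simp
    moreover have "corr {} = (\<lambda>_. 1)" by (auto simp: corr_def weight_def det_MD_on_empty cq_s_one)
    ultimately show ?thesis by (simp add: moment_def PiM_empty integrable_count_space)
  next
    case (Suc k)
    have *: "integrable (Pi\<^sub>M S' (\<lambda>_. M)) (corr S') \<and> (LINT x|Pi\<^sub>M S' (\<lambda>_. M). corr S' x) =
        (\<Sum>s\<le>k. (- 1) ^ s * (fact k / fact (k - s)) * power_trace (Suc s) * moment (k - s))"
      if "finite S'" "card S' = Suc k" for S'
      by (rule corr_integral_step) (use that less Suc in auto)
    have "moment (Suc k) = (\<Sum>s\<le>k. (- 1) ^ s * (fact k / fact (k - s)) * power_trace (Suc s) * moment (k - s))"
      unfolding moment_def[of "Suc k"] using *[of "{..<Suc k}"] by simp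
    then show ?thesis using *[OF less.prems Suc] Suc by simp
  qed
qed

lemma moment_recursion:
  "moment (Suc k) = (\<Sum>s\<le>k. (- 1) ^ s * (fact k / fact (k - s)) * power_trace (Suc s) * moment (k - s))"
  unfolding moment_def[of "Suc k"] using corr_integral_step[of "{..<Suc k}" k] corr_integral by simp

end

section \<open>Eigenvalues of the kernel\<close>

definition cq_column :: "complex ^ 2 \<Rightarrow> cquat" where
  "cq_column u = CQuat (u $ 1 / 2) (- \<i> * (u $ 2) / 2) (u $ 2 / 2) (- \<i> * (u $ 1) / 2)"

text \<open>The matrix of \<open>cq_column u\<close> has the columns \<open>u\<close> and \<open>0\<close>.\<close>

lemma mult_cq_column: "q * cq_column u = cq_column (cq_mat q *v u)"
  by (simp add: cq_column_def times_cquat_def cq_mat_def matrix_vector_mult_def sum_2 field_simps)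

lemma cq_column_scalar: "cq_column u * cq_of_complex z = cq_column (z *s u)"
  by (simp add: cq_column_def times_cquat_def cq_of_complex_def vector_scalar_mult_def)

lemma cq_column_eq_0_iff: "cq_column u = 0 \<longleftrightarrow> u = 0"
  by (auto simp: cq_column_def zero_cquat_def Finite_Cartesian_Product.vec_eq_iff forall_2)

lemma cq_integral_column: "cq_integral M (\<lambda>y. cq_column (u y)) = cq_column (\<chi> a. LINT y|M. u y $ a)"
  by (simp add: cq_integral_def cq_column_def)

text \<open>Let f be the combination of the \<open>g k\<close> with coefficients \<open>c k\<close>.
  The pairing of \<open>h i\<close> with f is \<open>l * c i\<close>, so K maps f to the combination
  of the \<open>g i\<close> with coefficients \<open>l * c i\<close>, which is l times f. The
  quaternion eigenfunction is \<open>cq_column\<close> applied to f.\<close>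

lemma (in sigma_finite_measure) kernel_eigenvalue_of_matrix:
  fixes g h :: "nat \<Rightarrow> 'a \<Rightarrow> complex ^ 2"
  assumes K: "(\<lambda>(x, y). cq_mat (K x y)) \<in> borel_measurable (M \<Otimes>\<^sub>M M)"
    and g: "\<And>i. i < r \<Longrightarrow> square_integrable M (g i)" and h: "\<And>i. i < r \<Longrightarrow> h i \<in> borel_measurable M"
    and hg: "\<And>i j b. i < r \<Longrightarrow> j < r \<Longrightarrow> integrable M (\<lambda>y. h i y $ b * g j y $ b)"
    and dec: "AE z in M \<Otimes>\<^sub>M M. \<forall>a b. cq_mat (K (fst z) (snd z)) $ a $ b = (\<Sum>i<r. g i (fst z) $ a * h i (snd z) $ b)"
    and eig: "\<And>i. i < r \<Longrightarrow> (\<Sum>k<r. (LINT y|M. (\<Sum>b\<in>UNIV. h i y $ b * g k y $ b)) * c k) = l * c i"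
    and l: "l \<noteq> 0" and nz: "i0 < r" "c i0 \<noteq> 0"
  shows "kernel_eigenvalue M K l"
proof -
  interpret P: pair_sigma_finite M M by (rule pair_sigma_finite_self)
  have gm[measurable]: "i < r \<Longrightarrow> g i \<in> borel_measurable M" for i using g by (simp add: square_integrable_def)
  note h[measurable]
  define f where "f y = (\<chi> a. \<Sum>k<r. c k * g k y $ a)" for y
  have f2: "square_integrable M (\<lambda>y. f y $ a)" for a
    unfolding f_def by simp (rule square_integrable_sum, auto intro: square_integrable_vec_nth g)
  have fm: "(\<lambda>y. f y $ a) \<in> borel_measurable M" for a using f2 by (simp add: square_integrable_def)
  have hf: "(LINT y|M. (\<Sum>b\<in>UNIV. h i y $ b * f y $ b)) = l * c i" if i: "i < r" for i
  proof -
    have "(LINT y|M. (\<Sum>b\<in>UNIV. h i y $ b * f y $ b)) = (LINT y|M. (\<Sum>k<r. (\<Sum>b\<in>UNIV. h i y $ b * g k y $ b) * c k))"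
    proof (rule Bochner_Integration.integral_cong[OF refl])
      fix y
      have "(\<Sum>b\<in>UNIV. h i y $ b * f y $ b) = (\<Sum>b\<in>UNIV. \<Sum>k<r. h i y $ b * g k y $ b * c k)"
        by (simp add: f_def sum_distrib_left mult_ac)
      also have "\<dots> = (\<Sum>k<r. (\<Sum>b\<in>UNIV. h i y $ b * g k y $ b) * c k)"
        by (subst sum.swap) (simp add: sum_distrib_right)
      finally show "(\<Sum>b\<in>UNIV. h i y $ b * f y $ b) = (\<Sum>k<r. (\<Sum>b\<in>UNIV. h i y $ b * g k y $ b) * c k)" .
    qed
    also have "\<dots> = (\<Sum>k<r. (LINT y|M. (\<Sum>b\<in>UNIV. h i y $ b * g k y $ b)) * c k)"
    proof (subst Bochner_Integration.integral_sum)
      show "integrable M (\<lambda>y. (\<Sum>b\<in>UNIV. h i y $ b * g k y $ b) * c k)" if "k \<in> {..<r}" for k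
        using hg i that by (intro integrable_mult_left Bochner_Integration.integrable_sum) auto
    qed simp
    finally show ?thesis using eig[OF i] by simp
  qed
  have "AE x in M. AE y in M. \<forall>a b. cq_mat (K x y) $ a $ b = (\<Sum>i<r. g i x $ a * h i y $ b)"
    using P.AE_pair[OF dec] by simp
  then have eq: "AE x in M. cq_integral M (\<lambda>y. K x y * cq_column (f y)) = cq_column (f x) * cq_of_complex l"
    using AE_space
  proof eventually_elim
    case (elim x)
    have Kx: "(\<lambda>y. cq_mat (K x y)) \<in> borel_measurable M"
      using measurable_compose[OF measurable_Pair1'[OF elim(2)] K] by simp
    have "(LINT y|M. (cq_mat (K x y) *v f y) $ a) = l * f x $ a" for a
    proof -
      have "(LINT y|M. (cq_mat (K x y) *v f y) $ a) = (LINT y|M. (\<Sum>i<r. g i x $ a * (\<Sum>b\<in>UNIV. h i y $ b * f y $ b)))"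
      proof (rule integral_cong_AE)
        show "(\<lambda>y. (cq_mat (K x y) *v f y) $ a) \<in> borel_measurable M"
          unfolding matrix_vector_mult_def vec_lambda_beta
          by (intro borel_measurable_sum borel_measurable_times borel_measurable_vec_nth_comp Kx fm)
        show "(\<lambda>y. \<Sum>i<r. g i x $ a * (\<Sum>b\<in>UNIV. h i y $ b * f y $ b)) \<in> borel_measurable M"
          by (intro borel_measurable_sum borel_measurable_times borel_measurable_const;
              (rule fm | rule borel_measurable_vec_nth_comp, rule h, simp))
        show "AE y in M. (cq_mat (K x y) *v f y) $ a = (\<Sum>i<r. g i x $ a * (\<Sum>b\<in>UNIV. h i y $ b * f y $ b))"
          using elim(1)
        proof eventually_elim
          case (elim y)
          have "(cq_mat (K x y) *v f y) $ a = (\<Sum>b\<in>UNIV. \<Sum>i<r. g i x $ a * (h i y $ b * f y $ b))"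
            unfolding matrix_vector_mult_def using elim by (simp add: sum_distrib_right mult.assoc)
          then show ?case by (subst (asm) sum.swap) (simp add: sum_distrib_left)
        qed
      qed
      also have "\<dots> = (\<Sum>i<r. g i x $ a * (LINT y|M. (\<Sum>b\<in>UNIV. h i y $ b * f y $ b)))"
      proof (subst Bochner_Integration.integral_sum)
        fix i assume i: "i \<in> {..<r}"
        have "integrable M (\<lambda>y. \<Sum>b\<in>UNIV. \<Sum>k<r. c k * (h i y $ b * g k y $ b))"
          using hg i by (intro Bochner_Integration.integrable_sum integrable_mult_right) auto
        then show "integrable M (\<lambda>y. g i x $ a * (\<Sum>b\<in>UNIV. h i y $ b * f y $ b))"
          by (intro integrable_mult_right) (simp add: f_def sum_distrib_left mult_ac)
      qed simp
      also have "\<dots> = (\<Sum>i<r. g i x $ a * (l * c i))" using hf by (intro sum.cong) auto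
      also have "\<dots> = l * f x $ a" by (simp add: f_def sum_distrib_left mult_ac)
      finally show ?thesis .
    qed
    then have "(\<chi> a. LINT y|M. (cq_mat (K x y) *v f y) $ a) = l *s f x"
      by (simp add: Finite_Cartesian_Product.vec_eq_iff)
    then show ?case unfolding mult_cq_column cq_integral_column cq_column_scalar by simp
  qed
  \<comment> \<open>The pairing with \<open>h i0\<close> is \<open>l * c i0\<close>, which is not 0;
    this is where a nonzero l enters.\<close>
  have "\<not> (AE x in M. cq_column (f x) = 0)"
  proof
    assume "AE x in M. cq_column (f x) = 0"
    then have "AE x in M. f x = 0" by (simp add: cq_column_eq_0_iff)
    then have "(LINT y|M. (\<Sum>b\<in>UNIV. h i0 y $ b * f y $ b)) = 0"
      by (intro integral_eq_zero_AE) (auto elim!: eventually_mono)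
    then show False using hf[OF nz(1)] nz l by simp
  qed
  moreover have "cq_square_integrable M (\<lambda>x. cq_column (f x))"
    unfolding cq_square_integrable_def cq_column_def
    using square_integrable_cmult[OF f2[of 1], of "1 / 2"] square_integrable_cmult[OF f2[of 2], of "1 / 2"]
      square_integrable_cmult[OF f2[of 1], of "- \<i> / 2"] square_integrable_cmult[OF f2[of 2], of "- \<i> / 2"]
    by simp
  ultimately show ?thesis unfolding kernel_eigenvalue_def using eq by blast
qed

section \<open>Pfaffian point fields\<close>

lemma num_points_cases: "num_points A c = \<infinity> \<or> (\<exists>m :: nat. num_points A c = of_nat m)"
proof (cases "finite {x \<in> A. 0 < c x}")
  case True
  then have "num_points A c = (\<Sum>x | x \<in> A \<and> 0 < c x. of_nat (c x))"
    unfolding num_points_def by (subst nn_integral_count_space) auto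
  then have "num_points A c = of_nat (\<Sum>x | x \<in> A \<and> 0 < c x. c x)" by simp
  then show ?thesis by blast
next
  case False
  have "(\<integral>\<^sup>+x. indicator {x \<in> A. 0 < c x} x \<partial>count_space A) \<le> num_points A c"
    unfolding num_points_def
  proof (rule nn_integral_mono)
    fix x
    show "indicator {x \<in> A. 0 < c x} x \<le> (of_nat (c x) :: ennreal)"
    proof (cases "0 < c x")
      case True
      then have "(of_nat 1 :: ennreal) \<le> of_nat (c x)" by (intro of_nat_mono) simp
      then show ?thesis by (simp add: indicator_def)
    qed simp
  qed
  moreover have "(\<integral>\<^sup>+x. indicator {x \<in> A. 0 < c x} x \<partial>count_space A) = \<infinity>"
    using False by (subst nn_integral_indicator) (auto simp: emeasure_count_space)
  ultimately show ?thesis by (simp add: top_unique)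
qed

lemma num_points_mono: "A \<subseteq> B \<Longrightarrow> num_points A c \<le> num_points B c"
  unfolding num_points_def
  by (subst (1 2) nn_integral_count_space_indicator) (auto intro!: nn_integral_mono simp: indicator_def)

text \<open>The generators only fix single values of a count. A count takes countably many values,
  so every preimage is a countable union of generators.\<close>

lemma num_points_measurable:
  assumes P: "random_point_field T \<mu> P" and A: "A \<in> sets \<mu>"
  shows "num_points A \<in> borel_measurable P"
proof (rule measurableI)
  fix B :: "ennreal set"
  have lev: "{c \<in> space P. num_points A c = t} \<in> sets P" for t
    using P A unfolding random_point_field_def by (auto intro: sigma_sets.Basic)
  have "num_points A -` B \<inter> space P = (\<Union>t\<in>B \<inter> insert \<infinity> (range of_nat). {c \<in> space P. num_points A c = t})"
  proof -
    have "num_points A c \<in> insert \<infinity> (range of_nat)" for c using num_points_cases[of A c] by auto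
    then show ?thesis by blast
  qed
  also have "\<dots> \<in> sets P"
    by (intro sets.countable_UN' countable_Int2) (use lev in auto)
  finally show "num_points A -` B \<inter> space P \<in> sets P" .
qed simp

lemma ennreal_ffact_of_nat: "ennreal_ffact k (of_nat n) = ennreal (fact k * real (n choose k))"
proof (cases "k \<le> n")
  case True
  have "ennreal_ffact k (of_nat n) = (\<Prod>j<k. ennreal (real (n - j)))"
    unfolding ennreal_ffact_def
  proof (rule prod.cong[OF refl])
    fix j assume "j \<in> {..<k}"
    then show "of_nat n - of_nat j = ennreal (real (n - j))"
      using True by (simp add: ennreal_of_nat_eq_real_of_nat ennreal_minus of_nat_diff)
  qed
  also have "\<dots> = ennreal (\<Prod>j<k. real (n - j))" by (rule prod_ennreal) simp
  also have "(\<Prod>j<k. real (n - j)) = fact k * real (n choose k)"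
  proof -
    have "real (n choose k) = (\<Prod>j<k. real n - real j) / fact k"
      using gbinomial_prod_rev[of "real n" k] by (simp add: binomial_gbinomial atLeast0LessThan)
    moreover have "(\<Prod>j<k. real (n - j)) = (\<Prod>j<k. real n - real j)"
      using True by (intro prod.cong) (auto simp: of_nat_diff)
    ultimately show ?thesis by simp
  qed
  finally show ?thesis .
next
  case False
  then have "(of_nat n - of_nat n :: ennreal) = 0" by (simp add: ennreal_of_nat_eq_real_of_nat ennreal_minus)
  then have "ennreal_ffact k (of_nat n) = 0"
    unfolding ennreal_ffact_def using False by (intro prod_zero) (auto intro!: bexI[of _ n])
  then show ?thesis using False by (simp add: binomial_eq_0)
qed

text \<open>Junk value: an infinite number of points is counted as \<open>0\<close>, as in \<open>total_points\<close>.\<close>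

definition point_count :: "'a set \<Rightarrow> ('a \<Rightarrow> nat) \<Rightarrow> nat" where
  "point_count A c = nat \<lfloor>enn2real (num_points A c)\<rfloor>"

lemma point_count_of_nat: "num_points A c = of_nat m \<Longrightarrow> point_count A c = m"
  by (simp add: point_count_def ennreal_of_nat_eq_real_of_nat)

lemma num_points_eq_point_count: "num_points A c \<noteq> \<infinity> \<Longrightarrow> num_points A c = of_nat (point_count A c)"
  using num_points_cases[of A c] point_count_of_nat[of A c] by auto

lemma real_point_count: "real (point_count A c) = enn2real (num_points A c)"
proof (cases "num_points A c = \<infinity>")
  case False
  from num_points_eq_point_count[OF this] show ?thesis
    by (metis enn2real_ennreal ennreal_of_nat_eq_real_of_nat of_nat_0_le_iff)
qed (simp add: point_count_def)

lemma det_MD_1: "det_MD 1 X = X 0 0"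
proof -
  have "path_lists {} = {[] :: nat list}" by (auto simp: path_lists_def)
  then show ?thesis
    using det_MD_on_rec[of "{..<1}" 0 X] by (simp add: det_MD_eq_on det_MD_on_empty lessThan_Suc)
qed

locale pfaffian_field =
  fixes T :: "'a topology" and \<mu> :: "'a measure" and P :: "('a \<Rightarrow> nat) measure" and K :: "'a \<Rightarrow> 'a \<Rightarrow> cquat"
  assumes background: "background_space T \<mu>"
    and pfaffian: "pfaffian_point_field T \<mu> P K"
    and finite_rank: "finite_rank_kernel \<mu> K"
begin

sublocale bg: sigma_finite_measure \<mu>
  using background by (simp add: background_space_def)

lemma field: "random_point_field T \<mu> P"
  using pfaffian by (simp add: pfaffian_point_field_def)

sublocale prob_space P
  using field by (simp add: random_point_field_def)

lemma space_eq: "space \<mu> = topspace T"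
  using background by (simp add: background_space_def)

lemma K_measurable: "(\<lambda>(x, y). cq_mat (K x y)) \<in> borel_measurable (\<mu> \<Otimes>\<^sub>M \<mu>)"
  using finite_rank by (simp add: finite_rank_kernel_def L2_kernel_def)

definition R :: "nat \<Rightarrow> (nat \<Rightarrow> 'a) \<Rightarrow> real" where
  "R k = (SOME R. correlation_function T \<mu> P k R \<and>
     (\<forall>x \<in> {..<k} \<rightarrow>\<^sub>E topspace T. cq_of_complex (complex_of_real (R x)) = det_MD k (\<lambda>i j. K (x i) (x j))))"

lemma R:
  assumes "k \<ge> 1"
  shows "correlation_function T \<mu> P k (R k)"
    and "x \<in> {..<k} \<rightarrow>\<^sub>E topspace T \<Longrightarrow> cq_of_complex (complex_of_real (R k x)) = det_MD k (\<lambda>i j. K (x i) (x j))"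
proof -
  have "\<exists>R. correlation_function T \<mu> P k R \<and>
     (\<forall>x \<in> {..<k} \<rightarrow>\<^sub>E topspace T. cq_of_complex (complex_of_real (R x)) = det_MD k (\<lambda>i j. K (x i) (x j)))"
    using pfaffian assms by (simp add: pfaffian_point_field_def)
  from someI_ex[OF this, folded R_def]
  show "correlation_function T \<mu> P k (R k)"
    "x \<in> {..<k} \<rightarrow>\<^sub>E topspace T \<Longrightarrow> cq_of_complex (complex_of_real (R k x)) = det_MD k (\<lambda>i j. K (x i) (x j))"
    by blast+
qed

lemma det_MD_R:
  assumes "k \<ge> 1" "\<And>i. i < k \<Longrightarrow> x i \<in> space \<mu>"
  shows "det_MD k (\<lambda>i j. K (x i) (x j)) = cq_of_complex (complex_of_real (R k (restrict x {..<k})))"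
proof -
  have "restrict x {..<k} \<in> {..<k} \<rightarrow>\<^sub>E topspace T" using assms(2) by (simp add: space_eq)
  from R(2)[OF assms(1) this]
  have "cq_of_complex (complex_of_real (R k (restrict x {..<k}))) = det_MD k (\<lambda>i j. K (restrict x {..<k} i) (restrict x {..<k} j))" .
  also have "\<dots> = det_MD k (\<lambda>i j. K (x i) (x j))"
    unfolding det_MD_eq_on by (rule det_MD_on_cong) auto
  finally show ?thesis by simp
qed

text \<open>The one-point correlation function, as a function of a point instead of a family with
  one member.\<close>

definition intensity :: "'a \<Rightarrow> real" where
  "intensity x = Re (cq_s (K x x))"

lemma intensity:
  assumes "x \<in> space \<mu>"
  shows "cq_s (K x x) = complex_of_real (intensity x)" and "0 \<le> intensity x"
proof -
  have "K x x = det_MD 1 (\<lambda>i j. K x x)" by (simp only: det_MD_1)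
  also have "\<dots> = cq_of_complex (complex_of_real (R 1 (restrict (\<lambda>_. x) {..<1})))"
    by (rule det_MD_R) (use assms in auto)
  finally have eq: "cq_s (K x x) = complex_of_real (R 1 (restrict (\<lambda>_. x) {..<1}))"
    by (metis cq_s_of_complex)
  then show "cq_s (K x x) = complex_of_real (intensity x)" by (simp add: intensity_def)
  have "restrict (\<lambda>_. x) {..<1} \<in> {..<1 :: nat} \<rightarrow>\<^sub>E space \<mu>" using assms by simp
  then have "0 \<le> R 1 (restrict (\<lambda>_. x) {..<1})"
    using R(1)[of 1] by (simp add: correlation_function_def)
  then show "0 \<le> intensity x" by (simp add: intensity_def eq)
qed

lemma intensity_measurable [measurable]: "intensity \<in> borel_measurable \<mu>"
proof -
  have "(\<lambda>x. (x, x)) \<in> measurable \<mu> (\<mu> \<Otimes>\<^sub>M \<mu>)" by simp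
  from measurable_compose[OF this K_measurable]
  have [measurable]: "(\<lambda>x. cq_mat (K x x)) \<in> borel_measurable \<mu>" by simp
  show ?thesis unfolding intensity_def[abs_def] cq_s_trace by measurable
qed

section \<open>Moments of the number of points in a window\<close>

lemma windowI:
  assumes A: "A \<in> sets \<mu>" and int: "integrable \<mu> (\<lambda>x. indicator A x * intensity x)"
    and hg: "\<And>i j b. i < r \<Longrightarrow> j < r \<Longrightarrow> integrable \<mu> (\<lambda>y. h i y $ b * g j y $ b)"
    and dec: "AE z in \<mu> \<Otimes>\<^sub>M \<mu>. \<forall>a b. cq_mat (K (fst z) (snd z)) $ a $ b = (\<Sum>i<r. g i (fst z) $ a * h i (snd z) $ b)"
  shows "pfaffian_window \<mu> K A r g h"
proof
  show "A \<in> sets \<mu>" by (rule A)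
  show "(\<lambda>(x, y). cq_mat (K x y)) \<in> borel_measurable (\<mu> \<Otimes>\<^sub>M \<mu>)" by (rule K_measurable)
  have "integrable \<mu> (\<lambda>x. complex_of_real (indicator A x * intensity x))"
    using int by (simp only: complex_of_real_integrable_eq)
  then show "integrable \<mu> (\<lambda>x. indicator A x * cq_s (K x x))"
    by (rule iffD1[OF Bochner_Integration.integrable_cong, rotated 2]) (auto simp: intensity indicator_def)
  show "\<exists>c. det_MD k (\<lambda>i j. K (x i) (x j)) = cq_of_complex c" if "\<And>i. i < k \<Longrightarrow> x i \<in> space \<mu>" for k x
  proof (cases "k \<ge> 1")
    case False
    then have "det_MD k (\<lambda>i j. K (x i) (x j)) = cq_of_complex 1"
      by (simp add: det_MD_eq_on det_MD_on_empty cq_of_complex_def one_cquat_def not_le)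
    then show ?thesis by blast
  qed (use det_MD_R that in blast)
qed (use hg dec in blast)+

text \<open>The defining identity of the correlation function is used for the single block in which
  A is repeated k times; the weights in \<open>corr\<close> are the indicator of that block.\<close>

lemma window_moment:
  assumes W: "pfaffian_window \<mu> K A r g h" and k: "k \<ge> 1"
  defines "a \<equiv> pfaffian_window.moment \<mu> K A k"
  shows "a = complex_of_real (Re a)"
    and "(\<integral>\<^sup>+c. ennreal_ffact k (num_points A c) \<partial>P) = ennreal (Re a)"
    and "0 \<le> Re a"
proof -
  interpret W: pfaffian_window \<mu> K A r g h by (rule W)
  let ?P = "Pi\<^sub>M {..<k} (\<lambda>_. \<mu>)"
  let ?B = "block_product \<mu> 1 (\<lambda>_. A) (\<lambda>_. k)"
  have corr: "W.corr {..<k} x = complex_of_real (R k x * indicator ?B x)" and R0: "0 \<le> R k x" if x: "x \<in> space ?P" for x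
  proof -
    have xE: "x \<in> {..<k} \<rightarrow>\<^sub>E space \<mu>" using x by (simp add: space_PiM)
    then have "restrict x {..<k} = x" by (rule PiE_restrict)
    moreover have "det_MD k (\<lambda>i j. K (x i) (x j)) = cq_of_complex (complex_of_real (R k (restrict x {..<k})))"
      by (rule det_MD_R) (use k xE in auto)
    ultimately have "cq_s (det_MD k (\<lambda>i j. K (x i) (x j))) = complex_of_real (R k x)"
      by (simp add: cq_s_of_complex)
    moreover have "W.weight {..<k} x = indicator ?B x"
    proof (cases "\<forall>i<k. x i \<in> A")
      case True
      then have "W.weight {..<k} x = 1" by (simp add: W.weight_def)
      then show ?thesis using True xE by (simp add: block_product_def indicator_def)
    next
      case False
      then have "W.weight {..<k} x = 0" unfolding W.weight_def by (intro prod_zero) (auto simp: indicator_def)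
      then show ?thesis using False by (auto simp: block_product_def indicator_def)
    qed
    ultimately show "W.corr {..<k} x = complex_of_real (R k x * indicator ?B x)"
      by (simp add: W.corr_def det_MD_eq_on indicator_def)
    show "0 \<le> R k x" using R(1)[OF k] xE by (simp add: correlation_function_def)
  qed
  have int: "integrable ?P (W.corr {..<k})" using W.corr_integral[of "{..<k}"] by simp
  have "integrable ?P (\<lambda>x. complex_of_real (R k x * indicator ?B x))"
    using int by (rule iffD1[OF Bochner_Integration.integrable_cong, rotated 2]) (auto simp: corr)
  then have intR: "integrable ?P (\<lambda>x. R k x * indicator ?B x)" by (simp only: complex_of_real_integrable_eq)
  have "a = (LINT x|?P. W.corr {..<k} x)" by (simp add: a_def W.moment_def)
  also have "\<dots> = (LINT x|?P. complex_of_real (R k x * indicator ?B x))"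
    by (rule Bochner_Integration.integral_cong) (auto simp: corr)
  also have "\<dots> = complex_of_real (LINT x|?P. R k x * indicator ?B x)" by (rule integral_complex_of_real)
  finally have a: "a = complex_of_real (LINT x|?P. R k x * indicator ?B x)" .
  then show "a = complex_of_real (Re a)" by simp
  have "0 \<le> (LINT x|?P. R k x * indicator ?B x)"
    by (rule integral_nonneg_AE) (auto intro!: AE_I2 simp: R0)
  then show "0 \<le> Re a" by (simp add: a)
  have "(\<integral>\<^sup>+c. ennreal_ffact k (num_points A c) \<partial>P) = (\<integral>\<^sup>+c. (\<Prod>i<1 :: nat. ennreal_ffact k (num_points A c)) \<partial>P)" by simp
  also have "\<dots> = (\<integral>\<^sup>+x. ennreal (R k x) * indicator ?B x \<partial>?P)"
  proof -
    have *: "\<forall>m A \<kappa>. (\<forall>i<m. A i \<in> sets \<mu>) \<and> disjoint_family_on A {..<m} \<and> (\<Sum>i<m. \<kappa> i) = k \<longrightarrow>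
        (\<integral>\<^sup>+c. (\<Prod>i<m. ennreal_ffact (\<kappa> i) (num_points (A i) c)) \<partial>P) =
        (\<integral>\<^sup>+x. ennreal (R k x) * indicator (block_product \<mu> m A \<kappa>) x \<partial>Pi\<^sub>M {..<k} (\<lambda>_. \<mu>))"
      using R(1)[OF k] unfolding correlation_function_def by blast
    show ?thesis
      by (rule *[rule_format, of 1 "\<lambda>_. A" "\<lambda>_. k"]) (simp add: disjoint_family_on_def W.A)
  qed
  also have "\<dots> = (\<integral>\<^sup>+x. ennreal (R k x * indicator ?B x) \<partial>?P)"
    by (rule nn_integral_cong) (simp add: indicator_def)
  also have "\<dots> = ennreal (LINT x|?P. R k x * indicator ?B x)"
    by (rule nn_integral_eq_integral[OF intR]) (auto intro!: AE_I2 simp: R0)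
  finally show "(\<integral>\<^sup>+c. ennreal_ffact k (num_points A c) \<partial>P) = ennreal (Re a)" by (simp add: a)
qed

lemma point_count_measurable:
  assumes "A \<in> sets \<mu>"
  shows "point_count A \<in> measurable P (count_space UNIV)"
proof -
  have [measurable]: "num_points A \<in> borel_measurable P" by (rule num_points_measurable[OF field assms])
  show ?thesis unfolding point_count_def[abs_def] by measurable
qed

text \<open>The finite first moment excludes infinitely many points almost surely, so the value of
  \<open>point_count\<close> at infinity does not affect the expectations.\<close>

lemma window_counts:
  assumes W: "pfaffian_window \<mu> K A r g h"
  shows "AE c in P. num_points A c = of_nat (point_count A c)"
    and "integrable P (\<lambda>c. real (point_count A c choose k))"
    and "pfaffian_window.moment \<mu> K A k = complex_of_real (fact k * expectation (\<lambda>c. real (point_count A c choose k)))"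
proof -
  interpret W: pfaffian_window \<mu> K A r g h by (rule W)
  have meas[measurable]: "num_points A \<in> borel_measurable P" by (rule num_points_measurable[OF field W.A])
  have [measurable]: "point_count A \<in> measurable P (count_space UNIV)" by (rule point_count_measurable[OF W.A])
  have "(\<integral>\<^sup>+c. num_points A c \<partial>P) = (\<integral>\<^sup>+c. ennreal_ffact 1 (num_points A c) \<partial>P)"
    by (simp add: ennreal_ffact_def)
  also have "\<dots> \<noteq> \<infinity>" using window_moment(2)[OF W, of 1] by simp
  finally have "AE c in P. num_points A c \<noteq> \<infinity>" by (intro nn_integral_PInf_AE meas)
  then show ae: "AE c in P. num_points A c = of_nat (point_count A c)"
    by (rule eventually_mono) (rule num_points_eq_point_count)
  have "integrable P (\<lambda>c. real (point_count A c choose k)) \<and>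
      W.moment k = complex_of_real (fact k * expectation (\<lambda>c. real (point_count A c choose k)))"
  proof (cases "k \<ge> 1")
    case True
    have "(\<integral>\<^sup>+c. ennreal (fact k * real (point_count A c choose k)) \<partial>P) = (\<integral>\<^sup>+c. ennreal_ffact k (num_points A c) \<partial>P)"
      using ae by (intro nn_integral_cong_AE) (auto elim!: eventually_mono simp: ennreal_ffact_of_nat)
    also have "\<dots> = ennreal (Re (W.moment k))" by (rule window_moment(2)[OF W True])
    finally have nn: "(\<integral>\<^sup>+c. ennreal (fact k * real (point_count A c choose k)) \<partial>P) = ennreal (Re (W.moment k))" .
    then have int: "integrable P (\<lambda>c. fact k * real (point_count A c choose k))"
      by (intro integrableI_nn_integral_finite) auto
    then have "ennreal (expectation (\<lambda>c. fact k * real (point_count A c choose k))) = ennreal (Re (W.moment k))"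
      using nn by (subst nn_integral_eq_integral[symmetric]) auto
    moreover have "0 \<le> Re (W.moment k)"
      by (rule window_moment(3)[OF W True])
    ultimately have "expectation (\<lambda>c. fact k * real (point_count A c choose k)) = Re (W.moment k)"
      by (subst (asm) ennreal_inj) auto
    then show ?thesis using int window_moment(1)[OF W True] by simp
  next
    case False
    then have "k = 0" by simp
    moreover have "W.moment 0 = 1"
    proof -
      have "W.corr {} = (\<lambda>_. 1)" by (auto simp: W.corr_def W.weight_def det_MD_on_empty cq_s_one)
      then show ?thesis by (simp add: W.moment_def PiM_empty lebesgue_integral_count_space_finite)
    qed
    ultimately show ?thesis by (simp add: prob_space)
  qed
  then show "integrable P (\<lambda>c. real (point_count A c choose k))"
    and "W.moment k = complex_of_real (fact k * expectation (\<lambda>c. real (point_count A c choose k)))" by auto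
qed

text \<open>By the first two Newton identities the variance is the mean minus
  \<open>power_trace 2\<close>. The bound is useful because that trace can be estimated uniformly in
  A.\<close>

lemma window_moments_1_2:
  assumes W: "pfaffian_window \<mu> K A r g h"
  defines "X \<equiv> \<lambda>c. real (point_count A c)"
  shows "expectation X = (LINT x|\<mu>. indicator A x * intensity x)"
    and "integrable P (\<lambda>c. (X c)\<^sup>2)"
    and "variance X \<le> expectation X + norm (pfaffian_window.power_trace \<mu> K A r g h 2)"
proof -
  interpret W: pfaffian_window \<mu> K A r g h by (rule W)
  define b where "b k = fact k * expectation (\<lambda>c. real (point_count A c choose k))" for k
  have b: "W.moment k = complex_of_real (b k)" for k
    unfolding b_def by (rule window_counts(3)[OF W])
  have int: "integrable P (\<lambda>c. real (point_count A c choose k))" for k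
    by (rule window_counts(2)[OF W])
  have b0: "b 0 = 1" by (simp add: b_def prob_space)
  have p1: "W.power_trace 1 = complex_of_real (b 1)"
    using W.moment_recursion[of 0] by (simp add: b b0)
  have p2: "W.power_trace 2 = complex_of_real ((b 1)\<^sup>2 - b 2)"
    using W.moment_recursion[of 1] p1 by (simp add: b b0 numeral_2_eq_2 power2_eq_square)
  have E: "expectation X = b 1" by (simp add: b_def X_def)
  have "complex_of_real (b 1) = (LINT x|\<mu>. indicator A x * cq_s (K x x))"
    using p1 by (simp add: W.power_trace_def)
  also have "\<dots> = (LINT x|\<mu>. complex_of_real (indicator A x * intensity x))"
    by (rule Bochner_Integration.integral_cong) (auto simp: intensity indicator_def)
  also have "\<dots> = complex_of_real (LINT x|\<mu>. indicator A x * intensity x)" by (rule integral_complex_of_real)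
  finally show "expectation X = (LINT x|\<mu>. indicator A x * intensity x)" by (simp only: E of_real_eq_iff)
  have sq: "(X c)\<^sup>2 = 2 * real (point_count A c choose 2) + real (point_count A c choose 1)" for c
    unfolding X_def
    using choose_two[of "point_count A c"] by (cases "point_count A c") (auto simp: power2_eq_square algebra_simps real_of_nat_div)
  show i2: "integrable P (\<lambda>c. (X c)\<^sup>2)"
    unfolding sq by (intro Bochner_Integration.integrable_add integrable_mult_right int)
  have i1: "integrable P X" using int[of 1] by (simp add: X_def)
  have "expectation (\<lambda>c. (X c)\<^sup>2) = b 2 + b 1"
    unfolding sq using int int[of 1] by (subst Bochner_Integration.integral_add) (simp_all add: b_def)
  then have "variance X = b 1 - ((b 1)\<^sup>2 - b 2)"
    using i1 i2 by (subst variance_eq) (auto simp: E)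
  also have "\<dots> \<le> b 1 + norm (W.power_trace 2)"
    unfolding p2 norm_of_real by simp
  finally show "variance X \<le> expectation X + norm (W.power_trace 2)" by (simp add: E)
qed

text \<open>Dropping the indicator of A only enlarges the integrals of the norms of the pairings, so
  the right side does not depend on A.\<close>

lemma window_power_trace_bound:
  assumes W: "pfaffian_window \<mu> K A r g h"
  defines "B \<equiv> \<lambda>i j. (LINT y|\<mu>. norm (\<Sum>b\<in>UNIV. h i y $ b * g j y $ b))"
  shows "norm (pfaffian_window.power_trace \<mu> K A r g h 2) \<le> (\<Sum>i<r. \<Sum>k<r. B i k * B k i)"
proof -
  interpret W: pfaffian_window \<mu> K A r g h by (rule W)
  have op: "norm (W.op_mat i j) \<le> B i j" if "i < r" "j < r" for i j
  proof -
    have "norm (W.op_mat i j) \<le> (LINT y|\<mu>. norm (W.N i j y))"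
      unfolding W.op_mat_def by (rule integral_norm_bound)
    also have "\<dots> \<le> B i j"
      unfolding B_def
    proof (rule integral_mono)
      show "integrable \<mu> (\<lambda>y. norm (W.N i j y))" using W.integrable_N[OF that] by simp
      show "integrable \<mu> (\<lambda>y. norm (\<Sum>b\<in>UNIV. h i y $ b * g j y $ b))"
        using W.hg that by (intro integrable_norm Bochner_Integration.integrable_sum) auto
      show "norm (W.N i j y) \<le> norm (\<Sum>b\<in>UNIV. h i y $ b * g j y $ b)" for y
        by (simp add: W.N_def norm_mult indicator_def)
    qed
    finally show ?thesis .
  qed
  have B0: "0 \<le> B i j" for i j by (simp add: B_def)
  have "W.power_trace 2 = (\<Sum>i<r. \<Sum>k<r. W.op_mat i k * W.op_mat k i) / 2"
    by (simp add: W.power_trace_def numeral_2_eq_2 if_distrib cong: if_cong)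
  then have "norm (W.power_trace 2) \<le> norm (\<Sum>i<r. \<Sum>k<r. W.op_mat i k * W.op_mat k i)"
  proof -
    have "norm (W.power_trace 2) = norm (\<Sum>i<r. \<Sum>k<r. W.op_mat i k * W.op_mat k i) / 2"
      unfolding \<open>W.power_trace 2 = _\<close> norm_divide by simp
    then show ?thesis using norm_ge_zero[of "W.power_trace 2"] by linarith
  qed
  also have "\<dots> \<le> (\<Sum>i<r. \<Sum>k<r. norm (W.op_mat i k * W.op_mat k i))"
    by (intro order_trans[OF norm_sum] sum_mono order_refl norm_sum)
  also have "\<dots> \<le> (\<Sum>i<r. \<Sum>k<r. B i k * B k i)"
    unfolding norm_mult by (intro sum_mono mult_mono op B0) auto
  finally show ?thesis .
qed

text \<open>If the intensity had infinite mass, then along an exhaustion by windows of finite mass the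
  variance would exceed the mean by a bounded amount only, so that Chebyshev's inequality makes the
  total number of points infinite almost surely.\<close>

lemma intensity_integrable:
  assumes var: "variance (total_points T) \<noteq> 0"
  shows "integrable \<mu> intensity"
proof (rule ccontr)
  assume not_int: "\<not> integrable \<mu> intensity"
  obtain r :: nat and g h :: "nat \<Rightarrow> 'a \<Rightarrow> complex ^ 2" where
    hg: "\<And>i j b. i < r \<Longrightarrow> j < r \<Longrightarrow> integrable \<mu> (\<lambda>y. h i y $ b * g j y $ b)"
    and dec: "AE z in \<mu> \<Otimes>\<^sub>M \<mu>. \<forall>a b. cq_mat (K (fst z) (snd z)) $ a $ b = (\<Sum>i<r. g i (fst z) $ a * h i (snd z) $ b)"
    by (rule finite_rank_kernel_decomposition[OF bg.sigma_finite_measure_axioms finite_rank]) (rule that)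
  define C where "C = (\<Sum>i<r. \<Sum>k<r. (LINT y|\<mu>. norm (\<Sum>b\<in>UNIV. h i y $ b * g k y $ b)) * (LINT y|\<mu>. norm (\<Sum>b\<in>UNIV. h k y $ b * g i y $ b)))"
  obtain S :: "nat \<Rightarrow> 'a set" where S: "range S \<subseteq> sets \<mu>" "(\<Union>i. S i) = space \<mu>" "\<And>i. emeasure \<mu> (S i) \<noteq> \<infinity>" "incseq S"
    using bg.sigma_finite_incseq by metis
  have [measurable]: "S n \<in> sets \<mu>" for n using S by auto
  \<comment> \<open>On these sets of finite measure the intensity is bounded, hence integrable; they
    increase to the whole space.\<close>
  define A where "A n = {x \<in> space \<mu>. x \<in> S n \<and> intensity x \<le> real n}" for n
  have A[measurable]: "A n \<in> sets \<mu>" for n unfolding A_def by measurable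
  define m where "m n = (LINT x|\<mu>. indicator (A n) x * intensity x)" for n
  have intA: "integrable \<mu> (\<lambda>x. indicator (A n) x * intensity x)" for n
  proof (rule Bochner_Integration.integrable_bound)
    show "integrable \<mu> (\<lambda>x. real n * indicator (S n) x)"
      using S(3)[of n] by (intro integrable_mult_right integrable_real_indicator) (auto simp: less_top)
    show "AE x in \<mu>. norm (indicator (A n) x * intensity x) \<le> norm (real n * indicator (S n) x)"
      by (auto intro!: AE_I2 simp: A_def indicator_def intensity)
  qed measurable
  have m_unbounded: "\<exists>n. x < m n" for x
  proof -
    have "(\<integral>\<^sup>+x. ennreal (intensity x) \<partial>\<mu>) = \<infinity>"
    proof -
      have "(\<integral>\<^sup>+x. ennreal (norm (intensity x)) \<partial>\<mu>) = (\<integral>\<^sup>+x. ennreal (intensity x) \<partial>\<mu>)"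
        by (rule nn_integral_cong) (simp add: intensity)
      then have "\<not> (\<integral>\<^sup>+x. ennreal (intensity x) \<partial>\<mu>) < \<infinity>"
        using not_int by (simp add: integrable_iff_bounded)
      then show ?thesis by (metis infinity_ennreal_def top.not_eq_extremum)
    qed
    also have "(\<integral>\<^sup>+x. ennreal (intensity x) \<partial>\<mu>) = (\<integral>\<^sup>+x. (SUP n. ennreal (indicator (A n) x * intensity x)) \<partial>\<mu>)"
    proof (rule nn_integral_cong)
      fix x assume x: "x \<in> space \<mu>"
      obtain i where i: "x \<in> S i" using S(2) x by auto
      obtain j :: nat where j: "intensity x \<le> real j" using real_arch_simple by blast
      have "x \<in> S (max i j)" using i incseqD[OF S(4), of i "max i j"] by auto
      then have "x \<in> A (max i j)" using j x by (auto simp: A_def)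
      then have "ennreal (intensity x) = ennreal (indicator (A (max i j)) x * intensity x)" by simp
      also have "\<dots> \<le> (SUP n. ennreal (indicator (A n) x * intensity x))" by (rule SUP_upper) simp
      finally have "ennreal (intensity x) \<le> (SUP n. ennreal (indicator (A n) x * intensity x))" .
      moreover have "(SUP n. ennreal (indicator (A n) x * intensity x)) \<le> ennreal (intensity x)"
        by (rule SUP_least) (auto simp: indicator_def)
      ultimately show "ennreal (intensity x) = (SUP n. ennreal (indicator (A n) x * intensity x))" by (rule antisym)
    qed
    also have "\<dots> = (SUP n. (\<integral>\<^sup>+x. ennreal (indicator (A n) x * intensity x) \<partial>\<mu>))"
    proof (rule nn_integral_monotone_convergence_SUP_AE)
      fix n
      show "AE x in \<mu>. ennreal (indicator (A n) x * intensity x) \<le> ennreal (indicator (A (Suc n)) x * intensity x)"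
        using incseqD[OF S(4), of n "Suc n"] by (intro AE_I2) (auto simp: A_def indicator_def intensity)
    qed measurable
    also have "\<dots> = (SUP n. ennreal (m n))"
      unfolding m_def
      by (intro SUP_cong refl nn_integral_eq_integral intA AE_I2) (auto simp: intensity)
    finally have SUP: "(SUP n. ennreal (m n)) = \<infinity>" .
    have "ennreal x < (SUP n. ennreal (m n))" unfolding SUP by simp
    then obtain n where "ennreal x < ennreal (m n)" unfolding less_SUP_iff by blast
    then have "\<not> m n \<le> x" using ennreal_leI[of "m n" x] by (auto simp: leD)
    then show ?thesis by (auto simp: not_le)
  qed
  define Q where "Q n = prob {c \<in> space P. num_points (topspace T) c \<le> of_nat n}" for n :: nat
  have [measurable]: "num_points (topspace T) \<in> borel_measurable P"
    using num_points_measurable[OF field sets.top] by (simp add: space_eq)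
  \<comment> \<open>If the whole space holds at most n points, so does \<open>A j\<close>, and its
    count falls short of the mean m j by at least m j - n.\<close>
  have Q_le: "Q n \<le> (m j + C) / (m j - real n)\<^sup>2" if mj: "real n < m j" for n j
  proof -
    define X where "X c = real (point_count (A j) c)" for c
    have W: "pfaffian_window \<mu> K (A j) r g h" by (rule windowI[OF A intA hg dec])
    have Xm[measurable]: "X \<in> borel_measurable P"
      using point_count_measurable[OF A, of j] unfolding X_def[abs_def] by measurable
    note mom = window_moments_1_2[OF W, folded X_def]
    have E: "expectation X = m j" using mom(1) by (simp add: m_def)
    have "variance X \<le> m j + C"
      using mom(3) window_power_trace_bound[OF W] unfolding C_def E by linarith
    have "Q n \<le> prob {c \<in> space P. m j - real n \<le> \<bar>X c - expectation X\<bar>}"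
      unfolding Q_def
    proof (rule finite_measure_mono)
      show "{c \<in> space P. num_points (topspace T) c \<le> of_nat n} \<subseteq> {c \<in> space P. m j - real n \<le> \<bar>X c - expectation X\<bar>}"
      proof safe
        fix c assume "num_points (topspace T) c \<le> of_nat n"
        moreover have "num_points (A j) c \<le> num_points (topspace T) c"
          using sets.sets_into_space[OF A[of j]] by (intro num_points_mono) (simp add: space_eq)
        ultimately have le: "num_points (A j) c \<le> of_nat n" by (rule order_trans[rotated])
        then have "num_points (A j) c \<noteq> \<infinity>" by (auto simp: top_unique)
        from num_points_eq_point_count[OF this] le have "point_count (A j) c \<le> n" by simp
        then show "m j - real n \<le> \<bar>X c - expectation X\<bar>" using mj by (simp add: E X_def)
      qed
    qed measurable
    also have "\<dots> \<le> variance X / (m j - real n)\<^sup>2"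
      by (rule Chebyshev_inequality) (use mom(2) mj in auto)
    also have "\<dots> \<le> (m j + C) / (m j - real n)\<^sup>2"
      using \<open>variance X \<le> m j + C\<close> by (rule divide_right_mono) simp
    finally show ?thesis .
  qed
  have "Q n = 0" for n
  proof (rule ccontr)
    assume "Q n \<noteq> 0"
    then have "0 < Q n" using measure_nonneg[of P] by (simp add: Q_def less_le)
    \<comment> \<open>The variance grows at most linearly in the mean, but Chebyshev's inequality
      divides it by a square.\<close>
    have "((\<lambda>x. (x + C) / (x - real n)\<^sup>2) \<longlongrightarrow> 0) at_top" by real_asymp
    then have "\<forall>\<^sub>F x in at_top. (x + C) / (x - real n)\<^sup>2 < Q n"
      using \<open>0 < Q n\<close> by (rule Topological_Spaces.order_tendstoD(2))
    then obtain x0 where x0: "\<And>x. x \<ge> x0 \<Longrightarrow> (x + C) / (x - real n)\<^sup>2 < Q n"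
      by (auto simp: eventually_at_top_linorder)
    obtain j where "max x0 (real n) < m j" using m_unbounded by blast
    then show False using x0[of "m j"] Q_le[of n j] by simp
  qed
  then have "AE c in P. \<not> num_points (topspace T) c \<le> of_nat n" for n :: nat
    by (intro AE_I'[of "{c \<in> space P. num_points (topspace T) c \<le> of_nat n}"])
      (auto simp: null_sets_def Q_def emeasure_eq_measure)
  then have "AE c in P. \<forall>n :: nat. \<not> num_points (topspace T) c \<le> of_nat n"
    by (subst AE_all_countable) blast
  \<comment> \<open>\<open>enn2real\<close> sends an infinite count to 0. So
    \<open>total_points\<close> vanishes almost surely and its variance is 0, against the
    assumption.\<close>
  then have zero: "AE c in P. total_points T c = 0"
  proof eventually_elim
    case (elim c)
    then have "num_points (topspace T) c = \<infinity>" using num_points_cases[of "topspace T" c] by auto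
    then show ?case by (simp add: total_points_def)
  qed
  then have E0: "expectation (total_points T) = 0" by (rule integral_eq_zero_AE)
  have "variance (total_points T) = 0"
    unfolding E0 by (rule integral_eq_zero_AE) (use zero in \<open>auto elim!: eventually_mono\<close>)
  with var show False by contradiction
qed

text \<open>The positive variance makes the intensity integrable, so the whole space is a window.
  The parameters ls are the eigenvalues of its matrix of pairings.\<close>

lemma square_char_total_points:
  assumes eig: "\<And>z. kernel_eigenvalue \<mu> K z \<Longrightarrow> z \<in> complex_of_real ` {0..1}"
    and var: "variance (total_points T) \<noteq> 0"
  shows "\<exists>c ls. 0 \<le> c \<and> set ls \<subseteq> {0..1} \<and>
    2 * expectation (total_points T) = c + sum_list ls \<and>
    2 * variance (total_points T) = c + (\<Sum>l\<leftarrow>ls. l * (1 - l)) \<and>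
    (\<forall>u. (char (distr P borel (total_points T)) u)\<^sup>2 =
       exp (complex_of_real c * (iexp u - 1)) * (\<Prod>l\<leftarrow>ls. 1 + complex_of_real l * (iexp u - 1)))"
proof -
  obtain r :: nat and g h :: "nat \<Rightarrow> 'a \<Rightarrow> complex ^ 2" where
    g: "\<And>i. i < r \<Longrightarrow> square_integrable \<mu> (g i)" and h: "\<And>i. i < r \<Longrightarrow> h i \<in> borel_measurable \<mu>"
    and hg: "\<And>i j b. i < r \<Longrightarrow> j < r \<Longrightarrow> integrable \<mu> (\<lambda>y. h i y $ b * g j y $ b)"
    and dec: "AE z in \<mu> \<Otimes>\<^sub>M \<mu>. \<forall>a b. cq_mat (K (fst z) (snd z)) $ a $ b = (\<Sum>i<r. g i (fst z) $ a * h i (snd z) $ b)"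
    by (rule finite_rank_kernel_decomposition[OF bg.sigma_finite_measure_axioms finite_rank]) (rule that)
  have W: "pfaffian_window \<mu> K (space \<mu>) r g h"
  proof (rule windowI[OF sets.top _ hg dec])
    show "integrable \<mu> (\<lambda>x. indicator (space \<mu>) x * intensity x)"
      using intensity_integrable[OF var]
      by (rule iffD1[OF Bochner_Integration.integrable_cong, rotated 2]) auto
  qed
  interpret W: pfaffian_window \<mu> K "space \<mu>" r g h by (rule W)
  define n where "n = point_count (space \<mu>)"
  have total: "total_points T = (\<lambda>c. real (n c))"
    by (auto simp: total_points_def n_def real_point_count space_eq)
  define b where "b k = fact k * expectation (\<lambda>c. real (n c choose k))" for k
  have b: "W.moment k = complex_of_real (b k)" for k
    unfolding b_def n_def by (rule window_counts(3)[OF W])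
  obtain zs where zs: "\<And>l. l \<in> set zs \<Longrightarrow> \<exists>c. (\<exists>i<r. c i \<noteq> 0) \<and> (\<forall>i<r. (\<Sum>k<r. W.op_mat i k * c k) = l * c i)"
    and tr: "\<And>s. (\<Sum>i<r. fun_mat_pow r W.op_mat s i i) = (\<Sum>l\<leftarrow>zs. l ^ s)"
    by (rule eigenvalues_power_sums[of r W.op_mat]) (rule that)
  have op: "W.op_mat i k = (LINT y|\<mu>. (\<Sum>b\<in>UNIV. h i y $ b * g k y $ b))" for i k
    unfolding W.op_mat_def by (rule Bochner_Integration.integral_cong) (auto simp: W.N_def)
  have zs_real: "l \<in> complex_of_real ` {0..1}" if l: "l \<in> set zs" for l
  \<comment> \<open>For l = 0 the function built from an eigenvector of the matrix may vanish, so
    that 0 need not be an eigenvalue of the kernel; it lies in the interval anyway.\<close>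
  proof (cases "l = 0")
    case True
    then show ?thesis by (auto intro!: image_eqI[of _ _ 0])
  next
    case False
    obtain c i0 where c: "i0 < r" "c i0 \<noteq> 0" "\<forall>i<r. (\<Sum>k<r. W.op_mat i k * c k) = l * c i"
      using zs[OF l] by blast
    show ?thesis
    proof (rule eig, rule bg.kernel_eigenvalue_of_matrix[where r = r and g = g and h = h and c = c])
      show "(\<Sum>k<r. (LINT y|\<mu>. (\<Sum>b\<in>UNIV. h i y $ b * g k y $ b)) * c k) = l * c i" if "i < r" for i
        using c(3) that unfolding op by simp
      show "i0 < r" "c i0 \<noteq> 0" by (fact c)+
    qed (fact K_measurable g h hg dec False)+
  qed
  define ls where "ls = map Re zs"
  have zs_eq: "zs = map complex_of_real ls"
    unfolding ls_def map_map by (rule map_idI[symmetric]) (use zs_real in force)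
  have ls: "set ls \<subseteq> {0..1}" using zs_real by (force simp: ls_def)
  have pt: "2 * W.power_trace s = complex_of_real (\<Sum>l\<leftarrow>ls. l ^ s)" if "s \<ge> 2" for s
  proof -
    have "2 * W.power_trace s = (\<Sum>l\<leftarrow>zs. l ^ s)" using that tr[of s] by (simp add: W.power_trace_def)
    also have "\<dots> = complex_of_real (\<Sum>l\<leftarrow>ls. l ^ s)" unfolding zs_eq by (induction ls) auto
    finally show ?thesis .
  qed
  have b0: "b 0 = 1" by (simp add: b_def prob_space)
  have p1: "W.power_trace 1 = complex_of_real (b 1)"
    using W.moment_recursion[of 0] by (simp add: b b0)
  define p where "p s = Re (W.power_trace s)" for s
  have p: "W.power_trace (Suc s) = complex_of_real (p (Suc s))" for s
  proof (cases "s = 0")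
    case True
    then show ?thesis using p1 by (simp add: p_def)
  next
    case False
    then have "2 * W.power_trace (Suc s) = complex_of_real (\<Sum>l\<leftarrow>ls. l ^ Suc s)" by (intro pt) simp
    then have "W.power_trace (Suc s) = complex_of_real (\<Sum>l\<leftarrow>ls. l ^ Suc s) / 2"
      by (metis nonzero_mult_div_cancel_left zero_neq_numeral)
    then have "W.power_trace (Suc s) = complex_of_real ((\<Sum>l\<leftarrow>ls. l ^ Suc s) / 2)" by simp
    then show ?thesis by (simp only: p_def Re_complex_of_real)
  qed
  \<comment> \<open>The surplus of twice the integral of the diagonal over the sum of the
    eigenvalues; it would be 0 if the diagonal values gave the trace of the operator.\<close>
  define c where "c = 2 * p 1 - sum_list ls"
  have rec: "b (Suc k) = (\<Sum>s\<le>k. (- 1) ^ s * (fact k / fact (k - s)) * p (Suc s) * b (k - s))" for k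
  proof -
    have "complex_of_real (b (Suc k)) = (\<Sum>s\<le>k. (- 1) ^ s * (fact k / fact (k - s)) * complex_of_real (p (Suc s)) * complex_of_real (b (k - s)))"
      using W.moment_recursion[of k] unfolding b p .
    also have "\<dots> = complex_of_real (\<Sum>s\<le>k. (- 1) ^ s * (fact k / fact (k - s)) * p (Suc s) * b (k - s))" by simp
    finally show ?thesis by (simp only: of_real_eq_iff)
  qed
  have n_meas: "n \<in> measurable P (count_space UNIV)"
    unfolding n_def by (rule point_count_measurable) simp
  have int: "integrable P (\<lambda>x. real (n x choose k))" for k
    unfolding n_def by (rule window_counts(2)[OF W])
  have p1': "2 * p 1 = c + sum_list ls" by (simp add: c_def)
  have ps: "2 * p s = (\<Sum>l\<leftarrow>ls. l ^ s)" if "s \<ge> 2" for s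
    using arg_cong[OF pt[OF that], of Re] by (simp add: p_def)
  note nbp = newton_bernoulli_poisson[where M = P and n = n and b = b and p = p and c = c and ls = ls,
      OF prob_space_axioms n_meas int b_def rec p1' _ ls]
  have "0 \<le> c" by (rule nbp(1)) (rule ps)
  moreover have "2 * expectation (\<lambda>x. real (n x)) = c + sum_list ls" by (rule nbp(3)) (rule ps)
  moreover have "2 * variance (\<lambda>x. real (n x)) = c + (\<Sum>l\<leftarrow>ls. l * (1 - l))" by (rule nbp(4)) (rule ps)
  moreover have "(char (distr P borel (\<lambda>x. real (n x))) u)\<^sup>2 =
      exp (complex_of_real c * (iexp u - 1)) * (\<Prod>l\<leftarrow>ls. 1 + complex_of_real l * (iexp u - 1))" for u
    by (rule nbp(2)) (rule ps)
  ultimately show ?thesis unfolding total using ls by (intro exI[of _ c] exI[of _ ls] conjI allI)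
qed

end

theorem theorem1p9:
  fixes T :: "nat \<Rightarrow> 'a topology"
    and \<mu> :: "nat \<Rightarrow> 'a measure"
    and P :: "nat \<Rightarrow> ('a \<Rightarrow> nat) measure"
    and K :: "nat \<Rightarrow> 'a \<Rightarrow> 'a \<Rightarrow> cquat"
  assumes "\<And>n. background_space (T n) (\<mu> n)"
    and "\<And>n. pfaffian_point_field (T n) (\<mu> n) (P n) (K n)"
    and "\<And>n. finite_rank_kernel (\<mu> n) (K n)"
    and "\<And>n z. kernel_eigenvalue (\<mu> n) (K n) z \<Longrightarrow> z \<in> complex_of_real ` {0..1}"
    and "filterlim (\<lambda>n. prob_space.variance (P n) (total_points (T n))) at_top sequentially"
  shows "weak_conv_m
    (\<lambda>n. distr (P n) borel
       (\<lambda>c. (total_points (T n) c - prob_space.expectation (P n) (total_points (T n))) /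
             sqrt (prob_space.variance (P n) (total_points (T n)))))
    std_normal_distribution"
proof -
  have field: "pfaffian_field (T n) (\<mu> n) (P n) (K n)" for n
    using assms(1-3) by (rule pfaffian_field.intro)
  have meas: "total_points (T n) \<in> borel_measurable (P n)" for n
  proof -
    interpret pfaffian_field "T n" "\<mu> n" "P n" "K n" by (rule field)
    have [measurable]: "num_points (topspace (T n)) \<in> borel_measurable (P n)"
      using num_points_measurable[OF field sets.top] by (simp add: space_eq)
    show ?thesis unfolding total_points_def[abs_def] by measurable
  qed
  define good where "good n c ls \<longleftrightarrow> 0 \<le> c \<and> set ls \<subseteq> {0..1} \<and>
    2 * prob_space.expectation (P n) (total_points (T n)) = c + sum_list ls \<and>
    2 * prob_space.variance (P n) (total_points (T n)) = c + (\<Sum>l\<leftarrow>ls. l * (1 - l)) \<and>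
    (\<forall>u. (char (distr (P n) borel (total_points (T n))) u)\<^sup>2 =
       exp (complex_of_real c * (iexp u - 1)) * (\<Prod>l\<leftarrow>ls. 1 + complex_of_real l * (iexp u - 1)))" for n c ls
  have "\<exists>c ls. good n c ls" if "prob_space.variance (P n) (total_points (T n)) > 0" for n
    unfolding good_def
    by (rule pfaffian_field.square_char_total_points[OF field assms(4)]) (use that in auto)
  \<comment> \<open>The variance is known to be positive for large n only; the implication allows
    sequences c and ls to be chosen for every n.\<close>
  then have "\<forall>n. \<exists>c ls. prob_space.variance (P n) (total_points (T n)) > 0 \<longrightarrow> good n c ls" by blast
  then obtain c ls where good: "\<And>n. prob_space.variance (P n) (total_points (T n)) > 0 \<Longrightarrow> good n (c n) (ls n)"
    by metis
  show ?thesis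
  proof (rule clt_of_square_char[OF _ meas assms(5)])
    show "prob_space (P n)" for n
    proof -
      interpret pfaffian_field "T n" "\<mu> n" "P n" "K n" by (rule field)
      show ?thesis by unfold_locales
    qed
    show "\<forall>\<^sub>F n in sequentially. 0 \<le> c n \<and> set (ls n) \<subseteq> {0..1} \<and>
        2 * prob_space.expectation (P n) (total_points (T n)) = c n + sum_list (ls n) \<and>
        2 * prob_space.variance (P n) (total_points (T n)) = c n + (\<Sum>l\<leftarrow>ls n. l * (1 - l)) \<and>
        (\<forall>u. (char (distr (P n) borel (total_points (T n))) u)\<^sup>2 =
             exp (complex_of_real (c n) * (iexp u - 1)) * (\<Prod>l\<leftarrow>ls n. 1 + complex_of_real l * (iexp u - 1)))"
      using assms(5)[unfolded filterlim_at_top_dense, rule_format, of 0]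
    proof eventually_elim
      case (elim n)
      then show ?case using good[of n] by (simp add: good_def)
    qed
  qed
qed

end
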